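(* Let $N\ge2$, let $K$ be the $N$-dimensional Sierpinski gasket and $\nu$ the Kusuoka measure on $K$. Let $w\in W_*$, let $i,j\in S$ be distinct, and let $h\in\mathcal H$ be a harmonic function. Then for every $\omega\in\{i,j\}^{\mathbb N}$ the limit $$\delta_{h,w}(\omega):=\lim_{n\to\infty}\frac{\nu_h(K_{w[\omega]_n})}{\nu(K_{w[\omega]_n})}$$ exists. Moreover, the function $\frac{\delta\nu_h}{\delta\nu}$ on $\psi_w(\overline{p_ip_j})$ given by $\frac{\delta\nu_h}{\delta\nu}(x):=\delta_{h,w}(\omega)$ for $x=\Psi_w(\omega)$ is well-defined (that is, $\delta_{h,w}(\omega)=\delta_{h,w}(\omega')$ whenever $\Psi_w(\omega)=\Psi_w(\omega')$, $\omega,\omega'\in\{i,j\}^{\mathbb N}$), and it is $\gamma_N$-Hölder continuous on $\psi_w(\overline{p_ip_j})$ with $$\gamma_N=\log_2\frac{\sqrt{4N+5}+1}{\sqrt{4N+5}-1}.$$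
   Context: Let $N\ge 2$ be an integer and $S=\{1,2,\dots,N+1\}$. Let $V_0=\{p_1,\dots,p_{N+1}\}$ be the vertex set of a (nondegenerate) closed $N$-simplex in $\mathbb R^N$, and let $\psi_i(z)=(z+p_i)/2$ for $i\in S$. The $N$-dimensional Sierpinski gasket $K$ is the unique nonempty compact subset of $\mathbb R^N$ with $K=\bigcup_{i\in S}\psi_i(K)$; it carries the Euclidean metric. Let $W_m=S^m$ (words of length $m$; $W_0=\{\emptyset\}$), $W_*=\bigcup_{m\ge0}W_m$, $\psi_w=\psi_{w_1}\circ\cdots\circ\psi_{w_m}$ for $w=w_1\cdots w_m$ ($\psi_\emptyset=\mathrm{id}$), and $K_w=\psi_w(K)$. Concatenation of words is written $ww'$. For $\omega=\omega_1\omega_2\cdots\in S^{\mathbb N}$, $[\omega]_n=\omega_1\cdots\omega_n\in W_n$ (with $[\omega]_0=\emptyset$). For $p,p'\in K$, $\overline{pp'}$ is the line segment connecting $p$ and $p'$. For $w\in W_*$, distinct $i,j\in S$ and $\omega\in\{i,j\}^{\mathbb N}$, $\Psi_w(\omega)$ denotes the unique point $x$ with $\bigcap_{n\ge0}K_{w[\omega]_n}=\{x\}$; it lies in $\psi_w(\overline{p_ip_j})$, and $\Psi_w:\{i,j\}^{\mathbb N}\to\psi_w(\overline{p_ip_j})$ is surjective (but not injective). Energy form: for $f:V_0\to\mathbb R$ put $Q_0(f,f)=\frac12\sum_{i,j\in S}(f(p_i)-f(p_j))^2$. For $f\in C(K)$ the sequence $\left(\frac{N+3}{N+1}\right)^m\sum_{w\in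 W_m}Q_0(f\circ\psi_w|_{V_0},f\circ\psi_w|_{V_0})$ is nondecreasing in $m$; its limit is $\mathcal E(f,f)\in[0,\infty]$. Let $\mathcal F=\{f\in C(K)\mid\mathcal E(f,f)<\infty\}$ (real-valued functions) and define $\mathcal E(f,g)$ for $f,g\in\mathcal F$ by polarization, $\mathcal E(f,g)=\frac12\{\mathcal E(f+g,f+g)-\mathcal E(f,f)-\mathcal E(g,g)\}$. Energy measure: for $f\in\mathcal F$, $\nu_f$ is the unique positive Borel measure on $K$ with $\int_K g\,\mathrm d\nu_f=2\mathcal E(f,fg)-\mathcal E(f^2,g)$ for every $g\in\mathcal F$. Harmonic functions: for every $u:V_0\to\mathbb R$ there is a unique $h\in\mathcal F$ with $h|_{V_0}=u$ and $\mathcal E(h,h)=\inf\{\mathcal E(f,f)\mid f\in\mathcal F,\ f|_{V_0}=u\}$; such $h$ is called harmonic, and $\mathcal H$ is the space of harmonic functions. For $k\in S$, $h_k\in\mathcal H$ is the harmonic function with $h_k(p_k)=1$ and $h_k(p_i)=0$ for $i\ne k$. Kusuoka measure: $\nu=\sum_{k\in S}\nu_{h_k}$. *)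

theory Defs
  imports "HOL-Analysis.Analysis"
begin

text \<open>
  The ambient space is an arbitrary Euclidean space \<open>'a\<close> with \<open>N = DIM('a)\<close>, and the vertices of
  the simplex are \<open>p 1, \<dots>, p (N + 1)\<close> for a map \<open>p :: nat \<Rightarrow> 'a\<close>; values of \<open>p\<close> at other
  indices are never used. Finite words are lists, infinite words are functions \<open>\<omega> :: nat \<Rightarrow> nat\<close>
  whose first letter is \<open>\<omega> 0\<close>, so the prefix of length \<open>n\<close> is \<open>map \<omega> [0..<n]\<close>.

  Functions on the gasket are represented by functions on \<open>'a\<close>; their values off the gasket
  are irrelevant.
\<close>

definition letters :: "'a::euclidean_space itself \<Rightarrow> nat set" where
  "letters _ = {1..DIM('a) + 1}"

definition words :: "'a::euclidean_space itself \<Rightarrow> nat \<Rightarrow> nat list set" where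
  "words T m = {w. length w = m \<and> set w \<subseteq> letters T}"

definition simplex_vertices :: "(nat \<Rightarrow> 'a::euclidean_space) \<Rightarrow> bool" where
  "simplex_vertices p \<longleftrightarrow>
     inj_on p (letters TYPE('a)) \<and> \<not> affine_dependent (p ` letters TYPE('a))"

definition psi :: "(nat \<Rightarrow> 'a::euclidean_space) \<Rightarrow> nat \<Rightarrow> 'a \<Rightarrow> 'a" where
  "psi p i z = (z + p i) /\<^sub>R 2"

primrec psi_word :: "(nat \<Rightarrow> 'a::euclidean_space) \<Rightarrow> nat list \<Rightarrow> 'a \<Rightarrow> 'a" where
  "psi_word p [] = id"
| "psi_word p (i # w) = psi p i \<circ> psi_word p w"

definition gasket :: "(nat \<Rightarrow> 'a::euclidean_space) \<Rightarrow> 'a set" where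
  "gasket p = (THE K. K \<noteq> {} \<and> compact K \<and> K = (\<Union>i\<in>letters TYPE('a). psi p i ` K))"

definition cell :: "(nat \<Rightarrow> 'a::euclidean_space) \<Rightarrow> nat list \<Rightarrow> 'a set" where
  "cell p w = psi_word p w ` gasket p"

definition coding :: "(nat \<Rightarrow> 'a::euclidean_space) \<Rightarrow> nat list \<Rightarrow> (nat \<Rightarrow> nat) \<Rightarrow> 'a" where
  "coding p w \<omega> = (THE x. (\<Inter>n. cell p (w @ map \<omega> [0..<n])) = {x})"


definition Q0 :: "(nat \<Rightarrow> 'a::euclidean_space) \<Rightarrow> ('a \<Rightarrow> real) \<Rightarrow> real" where
  "Q0 p f = (\<Sum>i\<in>letters TYPE('a). \<Sum>j\<in>letters TYPE('a). (f (p i) - f (p j))\<^sup>2) / 2"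

definition level_energy :: "(nat \<Rightarrow> 'a::euclidean_space) \<Rightarrow> nat \<Rightarrow> ('a \<Rightarrow> real) \<Rightarrow> real" where
  "level_energy p m f =
     ((real DIM('a) + 3) / (real DIM('a) + 1)) ^ m *
     (\<Sum>w\<in>words TYPE('a) m. Q0 p (f \<circ> psi_word p w))"

definition energy :: "(nat \<Rightarrow> 'a::euclidean_space) \<Rightarrow> ('a \<Rightarrow> real) \<Rightarrow> ennreal" where
  "energy p f = lim (\<lambda>m. ennreal (level_energy p m f))"

definition energy_dom :: "(nat \<Rightarrow> 'a::euclidean_space) \<Rightarrow> ('a \<Rightarrow> real) set" where
  "energy_dom p = {f. continuous_on (gasket p) f \<and> energy p f < \<infinity>}"

definition energy_form ::
    "(nat \<Rightarrow> 'a::euclidean_space) \<Rightarrow> ('a \<Rightarrow> real) \<Rightarrow> ('a \<Rightarrow> real) \<Rightarrow> real" where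
  "energy_form p f g =
     (enn2real (energy p (\<lambda>x. f x + g x)) - enn2real (energy p f) - enn2real (energy p g)) / 2"

text \<open>
  Integrability has to be required explicitly: the Bochner integral of a non-integrable
  function is \<open>0\<close>, and without it the measure would not be unique (for constant \<open>f\<close>, any
  measure taking only the values \<open>0\<close> and \<open>\<infinity>\<close> would qualify).
\<close>

definition energy_measure ::
    "(nat \<Rightarrow> 'a::euclidean_space) \<Rightarrow> ('a \<Rightarrow> real) \<Rightarrow> 'a measure" where
  "energy_measure p f = (THE M.
     sets M = sets (restrict_space borel (gasket p)) \<and>
     (\<forall>g\<in>energy_dom p. integrable M g \<and>
        (\<integral>x. g x \<partial>M) =
          2 * energy_form p f (\<lambda>x. f x * g x) - energy_form p (\<lambda>x. (f x)\<^sup>2) g))"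

definition harmonic :: "(nat \<Rightarrow> 'a::euclidean_space) \<Rightarrow> ('a \<Rightarrow> real) set" where
  "harmonic p = {h \<in> energy_dom p.
     energy p h =
       Inf {energy p f | f. f \<in> energy_dom p \<and> (\<forall>i\<in>letters TYPE('a). f (p i) = h (p i))}}"

text \<open>
  A harmonic function is determined by its vertex values only on the gasket; the
  representative vanishing off the gasket is chosen.
\<close>

definition harmonic_basis :: "(nat \<Rightarrow> 'a::euclidean_space) \<Rightarrow> nat \<Rightarrow> 'a \<Rightarrow> real" where
  "harmonic_basis p k = (THE h. h \<in> harmonic p \<and>
     (\<forall>i\<in>letters TYPE('a). h (p i) = (if i = k then 1 else 0)) \<and>
     (\<forall>x. x \<notin> gasket p \<longrightarrow> h x = 0))"

definition kusuoka_measure :: "(nat \<Rightarrow> 'a::euclidean_space) \<Rightarrow> 'a measure" where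
  "kusuoka_measure p =
     measure_of (gasket p) (sets (restrict_space borel (gasket p)))
       (\<lambda>A. \<Sum>k\<in>letters TYPE('a). emeasure (energy_measure p (harmonic_basis p k)) A)"


definition density_ratio ::
    "(nat \<Rightarrow> 'a::euclidean_space) \<Rightarrow> ('a \<Rightarrow> real) \<Rightarrow> nat list \<Rightarrow> (nat \<Rightarrow> nat) \<Rightarrow> nat \<Rightarrow> real" where
  "density_ratio p h w \<omega> n =
     measure (energy_measure p h) (cell p (w @ map \<omega> [0..<n])) /
     measure (kusuoka_measure p) (cell p (w @ map \<omega> [0..<n]))"

definition density_limit ::
    "(nat \<Rightarrow> 'a::euclidean_space) \<Rightarrow> ('a \<Rightarrow> real) \<Rightarrow> nat list \<Rightarrow> (nat \<Rightarrow> nat) \<Rightarrow> real" where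
  "density_limit p h w \<omega> = lim (density_ratio p h w \<omega>)"

definition edge_density ::
    "(nat \<Rightarrow> 'a::euclidean_space) \<Rightarrow> ('a \<Rightarrow> real) \<Rightarrow> nat list \<Rightarrow> nat \<Rightarrow> nat \<Rightarrow> 'a \<Rightarrow> real" where
  "edge_density p h w i j x =
     (THE d. \<exists>\<omega>\<in>UNIV \<rightarrow> {i, j}. coding p w \<omega> = x \<and> density_limit p h w \<omega> = d)"

definition holder_on :: "real \<Rightarrow> 'a::metric_space set \<Rightarrow> ('a \<Rightarrow> real) \<Rightarrow> bool" where
  "holder_on \<gamma> A f \<longleftrightarrow> (\<exists>C. \<forall>x\<in>A. \<forall>y\<in>A. \<bar>f x - f y\<bar> \<le> C * dist x y powr \<gamma>)"

end

theory Submission imports Defs begin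

text \<open>
  Why the theorem holds. A harmonic function is determined by its vector of vertex values, and
  passing to the cell \<open>i\<close> acts on this vector by a linear map \<open>extend S i\<close>. The energy measure of
  a cell is twice a power of \<open>(N + 3) / (N + 1)\<close> times the Dirichlet form of the transported vector, and
  the power cancels in \<open>\<nu>\<^sub>h(K\<^sub>v) / \<nu>(K\<^sub>v)\<close>. What remains is a quotient of quadratic forms
  evaluated along a product of the matrices \<open>extend S i\<close>.

  Along an edge only the letters \<open>i\<close> and \<open>j\<close> occur. Write \<open>n = N + 1\<close>. The two normal derivatives
  \<open>flux S i\<close> and \<open>flux S j\<close> then transform among themselves, by two matrices of determinant
  \<open>n / (n + 2)\<^sup>2\<close>, and the part of the Dirichlet form that they do not see is multiplied by
  exactly \<open>1 / (n + 2)\<^sup>2\<close> in each step (\<open>residue_extend\<close>, \<open>wedge_extend\<close>). The numerator of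
  an increment of the quotient is a combination of two-by-two minors of pairs of transported
  vectors and of these unseen parts, with coefficients of the order of the Kusuoka mass; the
  denominator is the product of two such masses. So one mass is left in the denominator. A
  quadratic form on the dual space that grows by a factor of at least \<open>\<Lambda> / (n + 2)\<^sup>2\<close>,
  \<open>\<Lambda> = (\<surd>(4n + 1) + 1)\<^sup>2 / 4\<close>, under both dual matrices bounds it from below
  (\<open>dual_form_step\<close>, \<open>total_growth\<close>). Hence the increments at level \<open>m\<close> are at most a constant
  times \<open>\<tau> ^ m\<close> with \<open>\<tau> = n / \<Lambda> = (\<surd>(4N + 5) - 1) / (\<surd>(4N + 5) + 1)\<close> (\<open>energy_ratio_step\<close>).
  The limit therefore exists, and it changes by at most a constant times \<open>\<tau> ^ m\<close> between codes that
  agree in \<open>m\<close> letters. As such codes have points at a distance of order at most \<open>2 ^ (- m)\<close>, this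
  is Hoelder continuity with exponent \<open>log\<^sub>2 (1 / \<tau>)\<close>, provided that the two codes of a dyadic
  point have the same limit. They do, since these limits depend only on the squares of the normal
  derivatives at the junction point from the two sides, and these derivatives add up to zero
  (\<open>ratio_limit_junction\<close>).

  The formula for the measure of a cell needs the harmonic functions and the energy measures
  themselves. Harmonic functions are built as a uniform limit of interpolations (\<open>harmonic_ext\<close>)
  and identified with the energy minimizers through an orthogonal decomposition of the energy of
  one subdivision (\<open>dirichlet_subdivision\<close>). The energy measure is built as an image of Lebesgue
  measure on an interval that is cut into pieces of the prescribed masses (\<open>nu\<close>); junction points
  are null sets, so the masses are those of the closed cells. It is the only measure with the
  defining integrals because the functions of finite energy form an algebra that is uniformly
  dense in the continuous functions, by the Stone-Weierstrass theorem.
\<close>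

section \<open>Vertex vectors and the harmonic extension rule\<close>

definition dirichlet :: "nat set \<Rightarrow> (nat \<Rightarrow> real) \<Rightarrow> real" where
  "dirichlet S u = (\<Sum>i\<in>S. \<Sum>j\<in>S. (u i - u j)\<^sup>2) / 2"

text \<open>
  The normal derivative at the vertex \<open>i\<close>, up to sign and normalization: the sum of the differences
  \<open>u k - u i\<close>.
\<close>

definition flux :: "nat set \<Rightarrow> nat \<Rightarrow> (nat \<Rightarrow> real) \<Rightarrow> real" where
  "flux S i u = (\<Sum>k\<in>S. u k) - real (card S) * u i"

text \<open>
  The values of the harmonic function with vertex values \<open>u\<close> at the vertices of the cell \<open>i\<close>. The
  value at the junction of the cells \<open>i\<close> and \<open>j\<close> is the average that gives \<open>i\<close> and \<open>j\<close> weight \<open>2\<close>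
  and the other vertices weight \<open>1\<close>; with \<open>card S = 3\<close> this is the familiar 2/5-2/5-1/5 rule.
\<close>

definition extend :: "nat set \<Rightarrow> nat \<Rightarrow> (nat \<Rightarrow> real) \<Rightarrow> nat \<Rightarrow> real" where
  "extend S i u = (\<lambda>j. if j = i then u i else (u i + u j + (\<Sum>k\<in>S. u k)) / (real (card S) + 2))"

lemma half_power_tendsto_0: "(\<lambda>n. (1/2) ^ n * (c::real)) \<longlonglongrightarrow> 0"
  by (intro tendsto_mult_left_zero LIMSEQ_realpow_zero) auto

lemma eq_if_dist_le_half_powers:
  fixes x :: "'a::metric_space"
  assumes "\<And>n. dist x y \<le> (1/2) ^ n * c" shows "x = y"
proof -
  have "dist x y \<le> 0"
    using assms by (intro LIMSEQ_le_const[OF half_power_tendsto_0[of c]]) auto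
  then show ?thesis by simp
qed

lemma dirichlet_nonneg: "0 \<le> dirichlet S u"
  unfolding dirichlet_def by (intro divide_nonneg_nonneg sum_nonneg) auto

lemma dirichlet_cong: "(\<And>k. k \<in> S \<Longrightarrow> u k = v k) \<Longrightarrow> dirichlet S u = dirichlet S v"
  unfolding dirichlet_def by (intro arg_cong2[where f = "(/)"] refl sum.cong) auto

lemma extend_cong:
  assumes "\<And>k. k \<in> S \<Longrightarrow> u k = v k" "i \<in> S" "j \<in> S"
  shows "extend S i u j = extend S i v j"
proof -
  have "(\<Sum>k\<in>S. u k) = (\<Sum>k\<in>S. v k)" using assms(1) by (rule sum.cong[OF refl])
  then show ?thesis using assms by (simp add: extend_def)
qed

lemma dirichlet_eq:
  assumes "finite S"
  shows "dirichlet S u = real (card S) * (\<Sum>k\<in>S. (u k)\<^sup>2) - (\<Sum>k\<in>S. u k)\<^sup>2"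
proof -
  have "(\<Sum>i\<in>S. \<Sum>j\<in>S. (u i - u j)\<^sup>2)
      = (\<Sum>i\<in>S. \<Sum>j\<in>S. (u i)\<^sup>2 + (u j)\<^sup>2 - 2 * (u i * u j))"
    by (simp add: power2_diff mult.assoc)
  also have "\<dots> = 2 * (card S * (\<Sum>k\<in>S. (u k)\<^sup>2)) - 2 * (\<Sum>k\<in>S. u k)\<^sup>2"
    by (simp add: sum.distrib sum_subtractf power2_eq_square sum_product
        flip: sum_distrib_left)
  finally show ?thesis unfolding dirichlet_def by simp
qed

lemma dirichlet_scale: "dirichlet S (\<lambda>k. a * u k) = a\<^sup>2 * dirichlet S u"
proof -
  have "(a * u i - a * u j)\<^sup>2 = a\<^sup>2 * (u i - u j)\<^sup>2" for i j
    by (simp add: power2_eq_square algebra_simps)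
  then show ?thesis by (simp add: dirichlet_def sum_distrib_left)
qed

lemma difference_square_le_dirichlet:
  assumes "finite S" "i \<in> S" "j \<in> S"
  shows "(u i - u j)\<^sup>2 \<le> dirichlet S u"
proof (cases "i = j")
  case False
  have "2 * (u i - u j)\<^sup>2 = (\<Sum>(a,b)\<in>{(i,j),(j,i)}. (u a - u b)\<^sup>2)"
    using False by (simp add: power2_commute)
  also have "\<dots> \<le> (\<Sum>(a,b)\<in>S \<times> S. (u a - u b)\<^sup>2)"
    using assms by (intro sum_mono2) auto
  also have "\<dots> = 2 * dirichlet S u"
    by (simp add: dirichlet_def sum.cartesian_product)
  finally show ?thesis by simp
qed (simp add: dirichlet_nonneg)

text \<open>
  Every vertex is joined to every other one, so the graph Laplacian \<open>L = n I - J\<close> satisfies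
  \<open>L\<^sup>2 = n L\<close>, and \<open>dirichlet S\<close> is its quadratic form.
\<close>

lemma sum_flux_square:
  assumes "finite S"
  shows "(\<Sum>i\<in>S. (flux S i u)\<^sup>2) = real (card S) * dirichlet S u"
proof -
  let ?n = "real (card S)" and ?s = "\<Sum>k\<in>S. u k"
  have "(flux S i u)\<^sup>2 = ?s\<^sup>2 + ?n\<^sup>2 * (u i)\<^sup>2 - 2 * ?n * ?s * u i" for i
    by (simp add: flux_def power2_eq_square algebra_simps)
  then have "(\<Sum>i\<in>S. (flux S i u)\<^sup>2) = ?n * ?s\<^sup>2 + ?n\<^sup>2 * (\<Sum>i\<in>S. (u i)\<^sup>2) - 2 * ?n * ?s * ?s"
    by (simp add: sum.distrib sum_subtractf flip: sum_distrib_left)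
  then show ?thesis
    by (simp add: dirichlet_eq[OF assms] power2_eq_square algebra_simps)
qed

lemma flux_square_le:
  assumes "finite S" "i \<in> S"
  shows "(flux S i u)\<^sup>2 \<le> real (card S) * dirichlet S u"
proof -
  have "(flux S i u)\<^sup>2 \<le> (\<Sum>i\<in>S. (flux S i u)\<^sup>2)"
    using assms by (intro member_le_sum) auto
  then show ?thesis by (simp add: sum_flux_square[OF assms(1)])
qed

lemma sum_extend:
  assumes "finite S" "i \<in> S"
  shows "(\<Sum>j\<in>S. extend S i u j)
       = real (card S) * (2 * u i + (\<Sum>k\<in>S. u k)) / (real (card S) + 2)"
proof -
  let ?n = "real (card S)" and ?s = "\<Sum>k\<in>S. u k"
  have r: "(\<Sum>j\<in>S-{i}. u j) = ?s - u i" using assms by (simp add: sum_diff1)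
  have n: "real (card (S - {i})) = ?n - 1"
    using assms card_gt_0_iff[of S] by (subst card_Diff_singleton) (auto simp: of_nat_diff Suc_leI)
  have "(\<Sum>j\<in>S. extend S i u j) = u i + (\<Sum>j\<in>S-{i}. (u i + u j + ?s) / (?n + 2))"
    using assms by (subst sum.remove[of _ i]) (auto simp: extend_def intro!: sum.cong)
  also have "(\<Sum>j\<in>S-{i}. (u i + u j + ?s) / (?n + 2))
      = ((?n - 1) * (u i + ?s) + (?s - u i)) / (?n + 2)"
    by (simp add: sum.distrib r n flip: sum_divide_distrib) (simp add: algebra_simps)
  also have "u i + \<dots> = ?n * (2 * u i + ?s) / (?n + 2)"
    by (simp add: divide_simps add_eq_0_iff) (simp add: algebra_simps)
  finally show ?thesis .
qed

text \<open>
  The flux at \<open>i\<close> and the Dirichlet form together determine the Dirichlet form on the cell \<open>i\<close>. This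
  identity carries the whole analysis: it yields contraction of the cell energies, conservation of
  the total energy, and the increments of the density ratios.
\<close>

lemma dirichlet_extend:
  assumes "finite S" "i \<in> S"
  shows "dirichlet S (extend S i u)
       = (dirichlet S u + (real (card S) + 1) * (flux S i u)\<^sup>2) / (real (card S) + 2)\<^sup>2"
proof -
  let ?n = "real (card S)" and ?s = "\<Sum>k\<in>S. u k" and ?q = "\<Sum>k\<in>S. (u k)\<^sup>2"
  have r: "(\<Sum>j\<in>S-{i}. u j) = ?s - u i" "(\<Sum>j\<in>S-{i}. (u j)\<^sup>2) = ?q - (u i)\<^sup>2"
    using assms by (simp_all add: sum_diff1)
  have n: "real (card (S - {i})) = ?n - 1"
    using assms card_gt_0_iff[of S] by (subst card_Diff_singleton) (auto simp: of_nat_diff Suc_leI)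
  have pos: "?n + 2 \<noteq> 0" by linarith
  have "(\<Sum>j\<in>S. (extend S i u j)\<^sup>2)
      = (u i)\<^sup>2 + (\<Sum>j\<in>S-{i}. ((u i + ?s)\<^sup>2 + 2 * (u i + ?s) * u j + (u j)\<^sup>2) / (?n + 2)\<^sup>2)"
    using assms
    by (subst sum.remove[of _ i])
       (auto simp: extend_def power_divide power2_eq_square algebra_simps intro!: sum.cong)
  also have "(\<Sum>j\<in>S-{i}. ((u i + ?s)\<^sup>2 + 2 * (u i + ?s) * u j + (u j)\<^sup>2) / (?n + 2)\<^sup>2)
      = ((?n - 1) * (u i + ?s)\<^sup>2 + 2 * (u i + ?s) * (?s - u i) + (?q - (u i)\<^sup>2)) / (?n + 2)\<^sup>2"
    by (simp only: sum_divide_distrib[symmetric] sum.distrib sum_distrib_left[symmetric] r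
        sum_constant n)
  finally have sq: "(\<Sum>j\<in>S. (extend S i u j)\<^sup>2) * (?n + 2)\<^sup>2 = (u i)\<^sup>2 * (?n + 2)\<^sup>2
      + ((?n - 1) * (u i + ?s)\<^sup>2 + 2 * (u i + ?s) * (?s - u i) + (?q - (u i)\<^sup>2))"
    using pos by (simp add: divide_simps)
  have sm: "(\<Sum>j\<in>S. extend S i u j)\<^sup>2 * (?n + 2)\<^sup>2 = (?n * (2 * u i + ?s))\<^sup>2"
    using pos by (simp add: sum_extend[OF assms] power_divide)
  have "dirichlet S (extend S i u) * (?n + 2)\<^sup>2
      = ?n * ((\<Sum>j\<in>S. (extend S i u j)\<^sup>2) * (?n + 2)\<^sup>2) - (\<Sum>j\<in>S. extend S i u j)\<^sup>2 * (?n + 2)\<^sup>2"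
    unfolding dirichlet_eq[OF assms(1)] by (simp add: algebra_simps)
  also have "\<dots> = dirichlet S u + (?n + 1) * (flux S i u)\<^sup>2"
    unfolding sq sm dirichlet_eq[OF assms(1)] flux_def by algebra
  finally show ?thesis using pos by (simp add: divide_simps mult.commute)
qed

lemma flux_extend_same:
  assumes "finite S" "i \<in> S"
  shows "flux S i (extend S i u) = real (card S) / (real (card S) + 2) * flux S i u"
proof -
  have pos: "real (card S) + 2 \<noteq> 0" by linarith
  show ?thesis
    unfolding flux_def sum_extend[OF assms] using pos
    by (simp add: extend_def divide_simps) (simp add: algebra_simps)
qed

text \<open>
  Exchanging \<open>i\<close> and \<open>j\<close> changes only the sign of the right-hand side: at the junction of the cells
  \<open>i\<close> and \<open>j\<close> the normal derivatives from the two sides cancel.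
\<close>

lemma flux_extend_other:
  assumes "finite S" "i \<in> S" "i \<noteq> j"
  shows "flux S j (extend S i u) = (flux S j u - flux S i u) / (real (card S) + 2)"
proof -
  have pos: "real (card S) + 2 \<noteq> 0" by linarith
  show ?thesis
    unfolding flux_def sum_extend[OF assms(1,2)] using pos assms(3)
    by (simp add: extend_def divide_simps) (simp add: algebra_simps)
qed

lemma dirichlet_extend_contracts:
  assumes "finite S" "i \<in> S"
  defines "n \<equiv> real (card S)"
  shows "(n + 2) / n * dirichlet S (extend S i u)
       \<le> (n\<^sup>2 + n + 1) / (n\<^sup>2 + 2 * n) * dirichlet S u"
proof -
  have n: "n > 0" using assms card_gt_0_iff[of S] by (auto simp: n_def)
  have "(n + 2)\<^sup>2 * dirichlet S (extend S i u) = dirichlet S u + (n + 1) * (flux S i u)\<^sup>2"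
    using n by (simp add: dirichlet_extend[OF assms(1,2)] n_def[symmetric])
  also have "\<dots> \<le> (1 + (n + 1) * n) * dirichlet S u"
    using mult_left_mono[OF flux_square_le[OF assms(1,2), of u], of "n + 1"] n
    by (simp add: n_def[symmetric] algebra_simps)
  finally have "(n + 2)\<^sup>2 * dirichlet S (extend S i u) \<le> (1 + (n + 1) * n) * dirichlet S u" .
  then have "(n + 2)\<^sup>2 * dirichlet S (extend S i u) / (n * (n + 2))
      \<le> (1 + (n + 1) * n) * dirichlet S u / (n * (n + 2))"
    using n by (intro divide_right_mono) auto
  moreover have "(n + 2)\<^sup>2 * dirichlet S (extend S i u) / (n * (n + 2))
      = (n + 2) / n * dirichlet S (extend S i u)"
    using n by (simp add: power2_eq_square)
  ultimately show ?thesis by (simp add: power2_eq_square algebra_simps)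
qed

lemma sum_dirichlet_extend:
  assumes "finite S"
  shows "(real (card S) + 2) * (\<Sum>i\<in>S. dirichlet S (extend S i u)) = real (card S) * dirichlet S u"
proof -
  let ?n = "real (card S)"
  have pos: "?n + 2 \<noteq> 0" by linarith
  have "(\<Sum>i\<in>S. dirichlet S (extend S i u))
      = (\<Sum>i\<in>S. dirichlet S u + (?n + 1) * (flux S i u)\<^sup>2) / (?n + 2)\<^sup>2"
    by (simp add: dirichlet_extend[OF assms] sum_divide_distrib cong: sum.cong)
  also have "(\<Sum>i\<in>S. dirichlet S u + (?n + 1) * (flux S i u)\<^sup>2)
      = ?n * (?n + 2) * dirichlet S u"
    by (simp add: sum.distrib sum_flux_square[OF assms] algebra_simps flip: sum_distrib_left)
  finally show ?thesis using pos by (simp add: power2_eq_square)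
qed

text \<open>
  The harmonic extension is the orthogonal projection: the energy of any function on one subdivision
  is the energy of the harmonic extension plus that of the deviation from it. This gives both the
  monotonicity of the level energies and the uniqueness of energy minimizers.
\<close>

lemma dirichlet_subdivision:
  assumes "finite S"
    and diag: "\<And>i. i \<in> S \<Longrightarrow> x i i = u i"
    and sym: "\<And>i j. i \<in> S \<Longrightarrow> j \<in> S \<Longrightarrow> x i j = x j i"
  shows "(\<Sum>i\<in>S. dirichlet S (x i))
       = real (card S) / (real (card S) + 2) * dirichlet S u
         + (\<Sum>i\<in>S. dirichlet S (\<lambda>j. x i j - extend S i u j))"
proof -
  let ?n = "real (card S)" and ?s = "\<Sum>k\<in>S. u k"
  have pos: "?n + 2 \<noteq> 0" by linarith
  define a where "a i = extend S i u" for i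
  define d where "d i j = x i j - a i j" for i j
  define A where "A i = (\<Sum>j\<in>S. a i j)" for i
  have a_sym: "a i j = a j i" for i j
    by (simp add: a_def extend_def add.commute)
  have d_diag: "d i i = 0" if "i \<in> S" for i
    using diag[OF that] by (simp add: d_def a_def extend_def)
  have d_sym: "d i j = d j i" if "i \<in> S" "j \<in> S" for i j
    using sym[OF that] by (simp add: d_def a_sym[of i j])
  have split: "dirichlet S (x i)
      = dirichlet S (a i) + dirichlet S (d i) + 2 * (\<Sum>j\<in>S. d i j * (?n * a i j - A i))" for i
  proof -
    have x: "x i = (\<lambda>j. a i j + d i j)" by (simp add: d_def)
    have "(\<Sum>j\<in>S. (a i j + d i j)\<^sup>2)
        = (\<Sum>j\<in>S. (a i j)\<^sup>2) + (\<Sum>j\<in>S. (d i j)\<^sup>2) + 2 * (\<Sum>j\<in>S. a i j * d i j)"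
      by (simp add: power2_sum sum.distrib sum_distrib_left mult.assoc)
    moreover have "(\<Sum>j\<in>S. d i j * (?n * a i j - A i))
        = ?n * (\<Sum>j\<in>S. a i j * d i j) - A i * (\<Sum>j\<in>S. d i j)"
      by (simp add: algebra_simps sum_subtractf sum_distrib_left)
    ultimately show ?thesis
      unfolding x dirichlet_eq[OF assms(1)] sum.distrib A_def[symmetric]
      by (simp add: power2_eq_square algebra_simps)
  qed
  \<comment> \<open>The cross term vanishes: each junction value is the mean of its neighbours.\<close>
  have "2 * (\<Sum>i\<in>S. \<Sum>j\<in>S. d i j * (?n * a i j - A i))
      = (\<Sum>i\<in>S. \<Sum>j\<in>S. d i j * (?n * a i j - A i)) + (\<Sum>j\<in>S. \<Sum>i\<in>S. d i j * (?n * a i j - A i))"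
    by (subst (3) sum.swap) simp
  also have "(\<Sum>j\<in>S. \<Sum>i\<in>S. d i j * (?n * a i j - A i))
      = (\<Sum>i\<in>S. \<Sum>j\<in>S. d i j * (?n * a i j - A j))"
    by (intro sum.cong refl) (metis a_sym d_sym)
  also have "(\<Sum>i\<in>S. \<Sum>j\<in>S. d i j * (?n * a i j - A i)) + \<dots>
      = (\<Sum>i\<in>S. \<Sum>j\<in>S. d i j * (2 * ?n * a i j - A i - A j))"
    by (simp add: algebra_simps flip: sum.distrib)
  also have "\<dots> = 0"
  proof (intro sum.neutral ballI)
    fix i j assume ij: "i \<in> S" "j \<in> S"
    show "d i j * (2 * ?n * a i j - A i - A j) = 0"
    proof (cases "i = j")
      case False
      have "A i = ?n * (2 * u i + ?s) / (?n + 2)" "A j = ?n * (2 * u j + ?s) / (?n + 2)"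
        using ij by (simp_all add: A_def a_def sum_extend[OF assms(1)])
      moreover have "a i j = (u i + u j + ?s) / (?n + 2)"
        using False by (simp add: a_def extend_def)
      ultimately have "2 * ?n * a i j - A i - A j
          = (2 * ?n * (u i + u j + ?s) - ?n * (2 * u i + ?s) - ?n * (2 * u j + ?s)) / (?n + 2)"
        by (simp only: diff_divide_distrib times_divide_eq_right)
      also have "\<dots> = 0" by (simp add: algebra_simps)
      finally have "2 * ?n * a i j - A i - A j = 0" .
      then show ?thesis by simp
    qed (use ij d_diag in simp)
  qed
  finally have cross: "(\<Sum>i\<in>S. \<Sum>j\<in>S. d i j * (?n * a i j - A i)) = 0" by simp
  have "(\<Sum>i\<in>S. dirichlet S (x i)) = (\<Sum>i\<in>S. dirichlet S (a i)) + (\<Sum>i\<in>S. dirichlet S (d i))"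
    using cross by (simp add: split sum.distrib flip: sum_distrib_left)
  moreover have "(\<Sum>i\<in>S. dirichlet S (a i)) = ?n / (?n + 2) * dirichlet S u"
    using sum_dirichlet_extend[OF assms(1), of u] pos
    by (simp add: a_def divide_simps mult.commute)
  moreover have "d i = (\<lambda>j. x i j - extend S i u j)" for i
    by (simp add: d_def a_def fun_eq_iff)
  ultimately show ?thesis by simp
qed

lemma dirichlet_eq_0_iff:
  assumes "finite S"
  shows "dirichlet S u = 0 \<longleftrightarrow> (\<forall>i\<in>S. \<forall>j\<in>S. u i = u j)"
proof
  assume z: "dirichlet S u = 0"
  show "\<forall>i\<in>S. \<forall>j\<in>S. u i = u j"
  proof (intro ballI)
    fix i j assume "i \<in> S" "j \<in> S"
    then have "(u i - u j)\<^sup>2 \<le> 0"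
      using difference_square_le_dirichlet[OF assms, of i j u] z by simp
    then show "u i = u j" by simp
  qed
next
  assume eq: "\<forall>i\<in>S. \<forall>j\<in>S. u i = u j"
  have "(u i - u j)\<^sup>2 = 0" if "i \<in> S" "j \<in> S" for i j
  proof -
    have "u i = u j" using eq that by blast
    then show ?thesis by simp
  qed
  then have "(\<Sum>i\<in>S. \<Sum>j\<in>S. (u i - u j)\<^sup>2) = 0" by (intro sum.neutral ballI)
  then show "dirichlet S u = 0" by (simp only: dirichlet_def div_0)
qed

lemma extend_sum:
  "extend S i (\<lambda>j. \<Sum>k\<in>I. a k * v k j) = (\<lambda>j. \<Sum>k\<in>I. a k * extend S i (v k) j)"
proof
  fix j
  have "(\<Sum>l\<in>S. \<Sum>k\<in>I. a k * v k l) = (\<Sum>k\<in>I. a k * (\<Sum>l\<in>S. v k l))"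
    by (subst sum.swap) (simp add: sum_distrib_left)
  then show "extend S i (\<lambda>j. \<Sum>k\<in>I. a k * v k j) j = (\<Sum>k\<in>I. a k * extend S i (v k) j)"
    by (simp add: extend_def algebra_simps sum.distrib flip: sum_divide_distrib)
qed

lemma extend_scale: "extend S i (\<lambda>j. a * v j) = (\<lambda>j. a * extend S i v j)"
  using extend_sum[where S = S and i = i and I = "{0::nat}" and a = "\<lambda>_. a" and v = "\<lambda>_. v"] by simp

text \<open>
  Consequently the harmonic functions restricted to a cell are all harmonic functions on it. This
  is used to separate points, and to show that cell masses see every direction.
\<close>

lemma extend_surj:
  assumes "finite S" "i \<in> S"
  obtains u where "extend S i u = y"
proof -
  let ?n = "real (card S)"
  have n: "?n > 0" using assms card_gt_0_iff[of S] by auto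
  \<comment> \<open>The sum of the preimage, found by adding up the equations for its entries.\<close>
  define c where "c = ((\<Sum>k\<in>S. y k) * (?n + 2) - 2 * ?n * y i) / ?n"
  define u where "u j = (if j = i then y i else (?n + 2) * y j - y i - c)" for j
  have r: "(\<Sum>j\<in>S-{i}. y j) = (\<Sum>k\<in>S. y k) - y i" using assms by (simp add: sum_diff1)
  have m: "real (card (S - {i})) = ?n - 1"
    using assms card_gt_0_iff[of S] by (subst card_Diff_singleton) (auto simp: of_nat_diff Suc_leI)
  have "(\<Sum>k\<in>S. u k) = y i + (\<Sum>j\<in>S-{i}. (?n + 2) * y j - y i - c)"
    using assms by (subst sum.remove[of _ i]) (auto simp: u_def intro!: sum.cong)
  also have "\<dots> = y i + ((?n + 2) * ((\<Sum>k\<in>S. y k) - y i) - (?n - 1) * (y i + c))"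
    by (simp only: sum_subtractf sum_distrib_left[symmetric] sum_constant m r)
       (simp add: algebra_simps)
  also have "\<dots> = c"
  proof -
    have "c * ?n = (\<Sum>k\<in>S. y k) * (?n + 2) - 2 * ?n * y i"
      using n by (simp add: c_def)
    then show ?thesis by (simp add: algebra_simps)
  qed
  finally have "extend S i u = y"
    using n by (auto simp: extend_def u_def fun_eq_iff)
  then show thesis using that by blast
qed

lemma extend_between:
  assumes "finite S" "i \<in> S" "j \<in> S" "\<And>k. k \<in> S \<Longrightarrow> a \<le> u k" "\<And>k. k \<in> S \<Longrightarrow> u k \<le> b"
  shows "a \<le> extend S i u j" "extend S i u j \<le> b"
proof -
  have pos: "real (card S) + 2 > 0" by linarith
  have "real (card S) * a \<le> (\<Sum>k\<in>S. u k)" "(\<Sum>k\<in>S. u k) \<le> real (card S) * b"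
    using sum_bounded_below[of S a u] sum_bounded_above[of S u b] assms by auto
  then show "a \<le> extend S i u j" "extend S i u j \<le> b"
    using pos assms(4)[OF assms(2)] assms(4)[OF assms(3)] assms(5)[OF assms(2)] assms(5)[OF assms(3)]
    by (auto simp: extend_def field_simps)
qed

section \<open>The gasket as the image of the code space\<close>

text \<open>
  The letter set depends on the type of the ambient space only; as a parameter of the locale it can
  be written without that type.
\<close>

locale simplex_gasket =
  fixes p :: "nat \<Rightarrow> 'a::euclidean_space" and S :: "nat set"
  assumes dim: "DIM('a) \<ge> 2" and simplex: "simplex_vertices p"
    and S_eq: "S = letters TYPE('a)"
begin

abbreviation K :: "'a set" where "K \<equiv> gasket p"
abbreviation codes :: "(nat \<Rightarrow> nat) set" where "codes \<equiv> UNIV \<rightarrow> S"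

lemma finite_S [simp, intro]: "finite S"
  and card_S: "card S = DIM('a) + 1"
  and one_in_S [intro]: "1 \<in> S" and one_in_S' [simp, intro]: "Suc 0 \<in> S"
  by (auto simp: S_eq letters_def)

lemma code_letter [simp]: "\<omega> \<in> codes \<Longrightarrow> \<omega> n \<in> S"
  by auto

lemma code_Cons [simp]: "i \<in> S \<Longrightarrow> \<omega> \<in> codes \<Longrightarrow> case_nat i \<omega> \<in> codes"
  by (auto split: nat.split)

lemma card_S_ge: "real (card S) \<ge> 3"
  using dim by (simp add: card_S)

definition code_point :: "(nat \<Rightarrow> nat) \<Rightarrow> 'a" where
  "code_point \<omega> = (\<Sum>m. (1/2) ^ Suc m *\<^sub>R p (\<omega> m))"

lemma vertex_bound: obtains B where "B > 0" "\<And>k. k \<in> S \<Longrightarrow> norm (p k) \<le> B"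
proof
  show "norm (p k) \<le> 1 + (\<Sum>k\<in>S. norm (p k))" if "k \<in> S" for k
    using member_le_sum[OF that, of "\<lambda>k. norm (p k)"] by simp
qed (simp add: add_pos_nonneg sum_nonneg)

lemma code_point_sums:
  assumes "\<omega> \<in> codes"
  shows "(\<lambda>m. (1/2) ^ Suc m *\<^sub>R p (\<omega> m)) sums code_point \<omega>"
proof -
  obtain B where B: "\<And>k. k \<in> S \<Longrightarrow> norm (p k) \<le> B" using vertex_bound by blast
  have "summable (\<lambda>m. (1/2::real) ^ Suc m * B)"
    by (intro summable_mult2 sums_summable[OF power_half_series])
  then have "summable (\<lambda>m. (1/2) ^ Suc m *\<^sub>R p (\<omega> m))"
    by (rule summable_comparison_test'[where N = 0])
       (use assms in \<open>auto intro!: mult_left_mono B\<close>)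
  then show ?thesis unfolding code_point_def by (rule summable_sums)
qed

lemma psi_in_terms_of_difference: "psi p i x - psi p i y = (1/2) *\<^sub>R (x - y)"
  by (simp add: psi_def algebra_simps)

lemma psi_eq_iff [simp]: "psi p i x = psi p i y \<longleftrightarrow> x = y"
  by (simp add: psi_def)

lemma psi_vertex [simp]: "psi p i (p i) = p i"
  by (simp add: psi_def scaleR_2[symmetric])

lemma continuous_on_psi [continuous_intros]:
  "continuous_on A f \<Longrightarrow> continuous_on A (\<lambda>x. psi p i (f x))"
  unfolding psi_def by (intro continuous_intros)

lemma psi_word_append: "psi_word p (v @ w) x = psi_word p v (psi_word p w x)"
  by (induction v) auto

lemma psi_word_difference: "psi_word p w x - psi_word p w y = (1/2) ^ length w *\<^sub>R (x - y)"
proof (induction w)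
  case (Cons i w)
  have "psi_word p (i # w) x - psi_word p (i # w) y
      = (1/2) *\<^sub>R (psi_word p w x - psi_word p w y)"
    by (simp only: psi_word.simps o_apply psi_in_terms_of_difference)
  then show ?case by (simp add: Cons)
qed simp

lemma dist_psi_word: "dist (psi_word p w x) (psi_word p w y) = (1/2) ^ length w * dist x y"
  by (simp add: dist_norm psi_word_difference)

lemma psi_word_eq_iff [simp]: "psi_word p w x = psi_word p w y \<longleftrightarrow> x = y"
  using dist_psi_word[of w x y] by auto

lemma code_point_step:
  assumes "\<omega> \<in> codes"
  shows "code_point \<omega> = psi p (\<omega> 0) (code_point (\<lambda>m. \<omega> (Suc m)))"
proof -
  have tail: "(\<lambda>m. \<omega> (Suc m)) \<in> codes" using assms by auto
  have "(\<lambda>m. (1/2) *\<^sub>R ((1/2) ^ Suc m *\<^sub>R p (\<omega> (Suc m))))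
      sums ((1/2) *\<^sub>R code_point (\<lambda>m. \<omega> (Suc m)))"
    by (intro sums_scaleR_right code_point_sums tail)
  then have "(\<lambda>m. (1/2) ^ Suc (Suc m) *\<^sub>R p (\<omega> (Suc m)))
      sums ((1/2) *\<^sub>R code_point (\<lambda>m. \<omega> (Suc m)))" by simp
  then have "(\<lambda>m. (1/2) ^ Suc m *\<^sub>R p (\<omega> m))
      sums ((1/2) *\<^sub>R code_point (\<lambda>m. \<omega> (Suc m)) + (1/2) ^ Suc 0 *\<^sub>R p (\<omega> 0))"
    by (rule sums_Suc)
  then show ?thesis
    using code_point_sums[OF assms] by (simp add: sums_unique2 psi_def scaleR_add_right)
qed

lemma code_point_prefix:
  assumes "\<omega> \<in> codes"
  shows "code_point \<omega> = psi_word p (map \<omega> [0..<n]) (code_point (\<lambda>m. \<omega> (m + n)))"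
proof (induction n)
  case (Suc n)
  have "(\<lambda>m. \<omega> (m + n)) \<in> codes" using assms by auto
  from code_point_step[OF this] Suc show ?case by (simp add: psi_word_append)
qed simp

lemma code_point_const [simp]:
  assumes "k \<in> S" shows "code_point (\<lambda>_. k) = p k"
proof -
  have "(\<lambda>m. (1/2) ^ Suc m *\<^sub>R p k) sums (1 *\<^sub>R p k)"
    by (rule sums_scaleR_left[OF power_half_series])
  then show ?thesis
    using code_point_sums[of "\<lambda>_. k"] assms by (simp add: sums_unique2)
qed

lemma compact_code_points: "compact (code_point ` codes)"
proof (rule compact_continuous_image)
  have "compactin (product_topology (\<lambda>_. euclidean) UNIV) (PiE UNIV (\<lambda>_::nat. S))"
    by (subst compactin_PiE) (simp add: finite_imp_compact)
  then show "compact codes"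
    unfolding euclidean_product_topology compactin_euclidean_iff by (simp add: PiE_UNIV_domain)
  obtain B where B: "B > 0" "\<And>k. k \<in> S \<Longrightarrow> norm (p k) \<le> B" using vertex_bound by blast
  have "summable (\<lambda>m. (1/2::real) ^ Suc m * B)"
    by (intro summable_mult2 sums_summable[OF power_half_series])
  then have "uniform_limit codes (\<lambda>n \<omega>. \<Sum>m<n. (1/2) ^ Suc m *\<^sub>R p (\<omega> m)) code_point sequentially"
    unfolding code_point_def
    by (intro Weierstrass_m_test[where M = "\<lambda>m. (1/2) ^ Suc m * B"])
       (auto intro!: mult_left_mono B)
  moreover have "continuous_on codes (\<lambda>\<omega>. \<Sum>m<n. (1/2) ^ Suc m *\<^sub>R p (\<omega> m))" for n
  proof (intro continuous_intros)
    fix m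
    show "continuous_on codes (\<lambda>\<omega>. p (\<omega> m))"
      by (rule continuous_on_compose2[where g = p and t = UNIV and f = "\<lambda>\<omega>. \<omega> m"])
         (auto intro: continuous_on_subset[OF continuous_on_product_coordinates])
  qed
  ultimately show "continuous_on codes code_point"
    by (intro uniform_limit_theorem[where F = sequentially]) auto
qed

lemma dist_bound_of_bounded:
  assumes "bounded A"
  obtains D where "D > 0" "\<And>x y. x \<in> A \<Longrightarrow> y \<in> A \<Longrightarrow> dist x y \<le> D"
proof -
  have "dist x y \<le> diameter A + 1" if "x \<in> A" "y \<in> A" for x y
    using diameter_bounded_bound[OF assms that] by simp
  then show thesis using diameter_ge_0[OF assms] that[of "diameter A + 1"] by auto
qed

text \<open>
  Existence and uniqueness of the attractor at once. A point of a self-similar set can be pulled back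
  through the maps again and again, and boundedness identifies it with the point of the resulting
  code; conversely, code points are limits of images of any point of the set.
\<close>

lemma self_similar_iff_code_points:
  "(A \<noteq> {} \<and> compact A \<and> A = (\<Union>i\<in>S. psi p i ` A)) \<longleftrightarrow> A = code_point ` codes"
proof
  assume A: "A \<noteq> {} \<and> compact A \<and> A = (\<Union>i\<in>S. psi p i ` A)"
  have step: "psi p i x \<in> A" if "i \<in> S" "x \<in> A" for i x using A that by blast
  have words: "psi_word p v x \<in> A" if "set v \<subseteq> S" "x \<in> A" for v x
    using that by (induction v) (auto intro: step)
  obtain D where D: "dist x y \<le> D" if "x \<in> A \<union> code_point ` codes" "y \<in> A \<union> code_point ` codes" for x y
    using dist_bound_of_bounded[of "A \<union> code_point ` codes"] A compact_code_points
      compact_imp_bounded bounded_Un by metis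
  show "A = code_point ` codes"
  proof (intro subset_antisym subsetI)
    fix x assume x: "x \<in> A"
    have "\<exists>i y. i \<in> S \<and> y \<in> A \<and> z = psi p i y" if "z \<in> A" for z using A that by blast
    then obtain d r where dr: "\<And>z. z \<in> A \<Longrightarrow> d z \<in> S \<and> r z \<in> A \<and> z = psi p (d z) (r z)" by metis
    define \<omega> where "\<omega> n = d ((r ^^ n) x)" for n
    have rA: "(r ^^ n) x \<in> A" for n using x dr by (induction n) auto
    then have \<omega>: "\<omega> \<in> codes" using dr by (auto simp: \<omega>_def)
    have eq: "x = psi_word p (map \<omega> [0..<n]) ((r ^^ n) x)" for n
    proof (induction n)
      case (Suc n)
      then show ?case using dr[OF rA[of n]] by (simp add: psi_word_append \<omega>_def)
    qed simp
    have "dist x (code_point \<omega>) \<le> (1/2) ^ n * D" for n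
    proof -
      have "dist x (code_point \<omega>)
          = (1/2) ^ n * dist ((r ^^ n) x) (code_point (\<lambda>m. \<omega> (m + n)))"
        by (subst eq[of n], subst code_point_prefix[OF \<omega>, of n]) (simp add: dist_psi_word)
      also have "\<dots> \<le> (1/2) ^ n * D"
      proof (intro mult_left_mono D)
        show "code_point (\<lambda>m. \<omega> (m + n)) \<in> A \<union> code_point ` codes"
          using \<omega> by (intro UnI2 imageI) auto
      qed (use rA in auto)
      finally show ?thesis .
    qed
    then have "x = code_point \<omega>" by (rule eq_if_dist_le_half_powers)
    then show "x \<in> code_point ` codes" using \<omega> by auto
  next
    fix x assume "x \<in> code_point ` codes"
    then obtain \<omega> where \<omega>: "\<omega> \<in> codes" "x = code_point \<omega>" by auto
    obtain a where a: "a \<in> A" using A by auto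
    define y where "y n = psi_word p (map \<omega> [0..<n]) a" for n
    have yA: "y n \<in> A" for n using \<omega>(1) a by (simp add: y_def words image_subset_iff)
    have "dist (y n) x \<le> (1/2) ^ n * D" for n
      unfolding y_def \<omega>(2)
      by (subst code_point_prefix[OF \<omega>(1), of n], unfold dist_psi_word)
         (use \<omega>(1) a in \<open>auto intro!: D\<close>)
    then have "y \<longlonglongrightarrow> x"
      by (intro metric_tendsto_imp_tendsto[OF half_power_tendsto_0[of D]] eventuallyI) (simp add: order_trans[OF _ abs_ge_self])
    moreover have "closed A" using A compact_imp_closed by blast
    ultimately show "x \<in> A" using yA by (intro closed_sequentially[of A y x]) auto
  qed
next
  assume A: "A = code_point ` codes"
  have "(\<lambda>_. 1) \<in> codes" by auto
  moreover have "A = (\<Union>i\<in>S. psi p i ` A)"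
  proof (intro subset_antisym subsetI)
    fix x assume "x \<in> A"
    then obtain \<omega> where \<omega>: "\<omega> \<in> codes" "x = code_point \<omega>" using A by auto
    have "code_point (\<lambda>m. \<omega> (Suc m)) \<in> A" using \<omega>(1) A by auto
    moreover have "\<omega> 0 \<in> S" using \<omega>(1) by auto
    ultimately show "x \<in> (\<Union>i\<in>S. psi p i ` A)" using code_point_step[OF \<omega>(1)] \<omega>(2) by blast
  next
    fix x assume "x \<in> (\<Union>i\<in>S. psi p i ` A)"
    then obtain i \<omega> where i: "i \<in> S" "\<omega> \<in> codes" "x = psi p i (code_point \<omega>)" using A by auto
    define \<eta> where "\<eta> = case_nat i \<omega>"
    have "\<eta> \<in> codes" using i by (simp add: \<eta>_def)
    moreover from code_point_step[OF this] have "x = code_point \<eta>" using i by (simp add: \<eta>_def)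
    ultimately show "x \<in> A" using A by auto
  qed
  ultimately show "A \<noteq> {} \<and> compact A \<and> A = (\<Union>i\<in>S. psi p i ` A)"
    using compact_code_points A by auto
qed

lemma gasket_eq_code_points: "K = code_point ` codes"
  unfolding gasket_def S_eq[symmetric] self_similar_iff_code_points by (rule the_equality) auto

lemma compact_K: "compact K" and K_eq: "K = (\<Union>i\<in>S. psi p i ` K)" and K_nonempty: "K \<noteq> {}"
  using self_similar_iff_code_points[of K] gasket_eq_code_points by auto

lemma closed_K: "closed K" by (rule compact_imp_closed[OF compact_K])

lemma psi_in_K [intro]: "i \<in> S \<Longrightarrow> x \<in> K \<Longrightarrow> psi p i x \<in> K"
  using K_eq by blast

lemma K_cases:
  assumes "x \<in> K" obtains i y where "i \<in> S" "y \<in> K" "x = psi p i y"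
  using assms K_eq by blast

lemma psi_word_in_K [intro]: "set w \<subseteq> S \<Longrightarrow> x \<in> K \<Longrightarrow> psi_word p w x \<in> K"
  by (induction w) auto

lemma vertex_in_K [intro]: "k \<in> S \<Longrightarrow> p k \<in> K"
  unfolding gasket_eq_code_points by (rule image_eqI[where x = "\<lambda>_. k"]) auto

definition gasket_diameter :: real where
  "gasket_diameter = diameter K"

lemma gasket_diameter: "x \<in> K \<Longrightarrow> y \<in> K \<Longrightarrow> dist x y \<le> gasket_diameter"
  unfolding gasket_diameter_def using compact_imp_bounded[OF compact_K]
  by (rule diameter_bounded_bound)

lemma gasket_diameter_nonneg: "0 \<le> gasket_diameter"
  unfolding gasket_diameter_def by (rule diameter_ge_0[OF compact_imp_bounded[OF compact_K]])

text \<open>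
  The affine independence of the vertices is used here: a linear map can be prescribed on independent
  vectors.
\<close>

lemma affine_interpolation:
  obtains f c where "linear f" "\<And>k. k \<in> S \<Longrightarrow> f (p k) + c = (u k :: real)"
proof -
  have inj: "inj_on p S" and aff: "\<not> affine_dependent (p ` S)"
    using simplex by (auto simp: simplex_vertices_def S_eq)
  let ?B = "(\<lambda>x. - p 1 + x) ` (p ` S - {p 1})"
  have "independent ?B"
    using aff affine_dependent_iff_dependent2[OF imageI[OF one_in_S], of p] by blast
  then obtain f where f: "linear f"
      "\<And>x. x \<in> ?B \<Longrightarrow> f x = u (inv_into S p (p 1 + x)) - u 1"
    using linear_independent_extend[of ?B "\<lambda>x. u (inv_into S p (p 1 + x)) - u 1"] by blast
  have "f (p k) + (u 1 - f (p 1)) = u k" if "k \<in> S" for k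
  proof (cases "k = 1")
    case False
    then have "p k \<noteq> p 1" using inj that one_in_S by (auto dest: inj_onD)
    then have "f (- p 1 + p k) = u k - u 1"
      using that inj by (subst f(2)) (auto simp: image_iff)
    then show ?thesis using f(1) by (simp add: linear_diff)
  qed simp
  then show thesis using that f(1) by blast
qed

lemma affine_code_point_sums:
  assumes "linear f" "\<omega> \<in> codes"
  shows "(\<lambda>m. (1/2) ^ Suc m * (f (p (\<omega> m)) + c)) sums (f (code_point \<omega>) + (c::real))"
proof -
  have "bounded_linear f" using assms(1) by (rule linear_conv_bounded_linear[THEN iffD1])
  from bounded_linear.sums[OF this code_point_sums[OF assms(2)]]
  have "(\<lambda>m. (1/2) ^ Suc m * f (p (\<omega> m))) sums f (code_point \<omega>)"
    using assms(1) by (simp add: linear_scale)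
  from sums_add[OF this sums_mult2[OF power_half_series, of c]]
  show ?thesis by (simp only: distrib_left mult_1)
qed

text \<open>
  For a code of a point, this is the barycentric coordinate of the point with respect to \<open>p k\<close>; on
  codes with two letters it is the number with the corresponding binary digits.
\<close>

definition weight :: "nat \<Rightarrow> (nat \<Rightarrow> nat) \<Rightarrow> real" where
  "weight k \<omega> = (\<Sum>m. (1/2) ^ Suc m * of_bool (\<omega> m = k))"

lemma weight_sums: "(\<lambda>m. (1/2) ^ Suc m * of_bool (\<omega> m = k)) sums weight k \<omega>"
proof -
  have "summable (\<lambda>m. (1/2::real) ^ Suc m * of_bool (\<omega> m = k))"
    by (rule summable_comparison_test'[OF sums_summable[OF power_half_series], where N = 0]) auto
  then show ?thesis unfolding weight_def by (rule summable_sums)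
qed

lemma weight_le_1: "weight k \<omega> \<le> 1"
  by (rule sums_le[OF _ weight_sums power_half_series]) auto

lemma weight_nonneg: "0 \<le> weight k \<omega>"
  by (rule sums_le[OF _ sums_zero weight_sums]) auto

lemma weight_step: "weight k \<omega> = (of_bool (\<omega> 0 = k) + weight k (\<lambda>m. \<omega> (Suc m))) / 2"
proof -
  have "(\<lambda>m. (1/2) * ((1/2) ^ Suc m * of_bool (\<omega> (Suc m) = k)))
      sums ((1/2) * weight k (\<lambda>m. \<omega> (Suc m)))"
    by (intro sums_mult weight_sums)
  then have "(\<lambda>m. (1/2) ^ Suc (Suc m) * of_bool (\<omega> (Suc m) = k))
      sums ((1/2) * weight k (\<lambda>m. \<omega> (Suc m)))" by (simp add: mult.assoc)
  then have "(\<lambda>m. (1/2) ^ Suc m * of_bool (\<omega> m = k))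
      sums ((1/2) * weight k (\<lambda>m. \<omega> (Suc m)) + (1/2) ^ Suc 0 * of_bool (\<omega> 0 = k))"
    by (rule sums_Suc)
  then show ?thesis using sums_unique2[OF weight_sums[of \<omega> k]] by simp
qed

lemma weight_eq_1: 
  assumes "weight k \<omega> \<ge> 1" shows "\<omega> m = k"
  using assms
proof (induction m arbitrary: \<omega>)
  case 0
  then show ?case using weight_step[of k \<omega>] weight_le_1[of k "\<lambda>m. \<omega> (Suc m)"]
    by (cases "\<omega> 0 = k") auto
next
  case (Suc m)
  have "weight k (\<lambda>m. \<omega> (Suc m)) \<ge> 1"
    using Suc.prems weight_step[of k \<omega>] by (cases "\<omega> 0 = k") auto
  from Suc.IH[OF this] show ?case .
qed

text \<open>
  The weight of a code is the value at its point of the affine function that is \<open>1\<close> at \<open>p k\<close> and \<open>0\<close>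
  at the other vertices.
\<close>

lemma weight_eq_of_code_point_eq:
  assumes "\<omega> \<in> codes" "\<eta> \<in> codes" "code_point \<omega> = code_point \<eta>"
  shows "weight k \<omega> = weight k \<eta>"
proof -
  obtain f c where f: "linear f" "\<And>l. l \<in> S \<Longrightarrow> f (p l) + c = (of_bool (l = k) :: real)"
    using affine_interpolation[of "\<lambda>l. of_bool (l = k)"] by blast
  have "weight k \<xi> = f (code_point \<xi>) + c" if "\<xi> \<in> codes" for \<xi>
  proof -
    have "f (p (\<xi> m)) + c = of_bool (\<xi> m = k)" for m
      by (rule f(2)) (use that in auto)
    then show ?thesis
      using sums_unique2[OF weight_sums[of \<xi> k]] affine_code_point_sums[OF f(1) that, of c] by simp
  qed
  then show ?thesis using assms by simp
qed

text \<open>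
  Comparison of the barycentric coordinates for \<open>j\<close>: on the cell \<open>j\<close> it is at least \<open>1/2\<close>, and on the
  cell \<open>i\<close> it is half of that of \<open>x\<close>, which has to be \<open>1\<close>.
\<close>

lemma junction:
  assumes "i \<in> S" "j \<in> S" "i \<noteq> j" "x \<in> K" "y \<in> K" "psi p i x = psi p j y"
  shows "x = p j" "y = p i"
proof -
  have *: "x = p j" if "i \<in> S" "j \<in> S" "i \<noteq> j" "x \<in> K" "y \<in> K" "psi p i x = psi p j y" for i j x y
  proof -
    have "x \<in> code_point ` codes" "y \<in> code_point ` codes"
      using that gasket_eq_code_points by simp_all
    then obtain \<omega> \<eta> where c: "\<omega> \<in> codes" "x = code_point \<omega>" "\<eta> \<in> codes" "y = code_point \<eta>"
      by blast
    define \<omega>' where "\<omega>' = case_nat i \<omega>"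
    define \<eta>' where "\<eta>' = case_nat j \<eta>"
    have "\<omega>' \<in> codes" "\<eta>' \<in> codes" using c that by (simp_all add: \<omega>'_def \<eta>'_def)
    moreover from code_point_step[OF this(1)] code_point_step[OF this(2)]
    have "code_point \<omega>' = psi p i x" "code_point \<eta>' = psi p j y"
      by (simp_all add: c \<omega>'_def \<eta>'_def)
    ultimately have "weight j \<omega>' = weight j \<eta>'"
      using weight_eq_of_code_point_eq that by metis
    then have "weight j \<omega> = 1 + weight j \<eta>"
      using weight_step[of j \<omega>'] weight_step[of j \<eta>'] that(3) by (simp add: \<omega>'_def \<eta>'_def)
    then have "weight j \<omega> \<ge> 1" using weight_nonneg[of j \<eta>] by simp
    then have "\<omega> = (\<lambda>_. j)" using weight_eq_1 by (simp add: fun_eq_iff)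
    then show ?thesis using c that by simp
  qed
  show "x = p j" using *[OF assms] .
  show "y = p i" using *[of j i y x] assms by simp
qed

lemma junction_point: "psi p i (p j) = psi p j (p i)"
  by (simp add: psi_def add.commute)

lemma vertex_only_in_own_cell:
  assumes "i \<in> S" "j \<in> S" "x \<in> K" "psi p i x = p j"
  shows "i = j \<and> x = p j"
proof (cases "i = j")
  case True
  then show ?thesis using assms psi_vertex[of j] psi_eq_iff[of j x "p j"] by simp
next
  case False
  have "psi p i x = psi p j (p j)" using assms by simp
  from junction(2)[OF assms(1,2) False assms(3) _ this] assms False
  have "p j = p i" by auto
  then show ?thesis using simplex False assms by (auto simp: simplex_vertices_def S_eq dest: inj_onD)
qed

lemma coding_eq:
  assumes "set w \<subseteq> S" "\<omega> \<in> codes"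
  shows "coding p w \<omega> = psi_word p w (code_point \<omega>)"
proof -
  let ?z = "psi_word p w (code_point \<omega>)"
  have in_cell: "?z \<in> cell p (w @ map \<omega> [0..<n])" for n
  proof -
    have "(\<lambda>m. \<omega> (m + n)) \<in> codes" using assms(2) by auto
    then have "code_point (\<lambda>m. \<omega> (m + n)) \<in> K" by (simp add: gasket_eq_code_points)
    then show ?thesis
      unfolding cell_def
      by (subst code_point_prefix[OF assms(2), of n]) (simp add: psi_word_append[symmetric])
  qed
  have "y = ?z" if y: "\<And>n. y \<in> cell p (w @ map \<omega> [0..<n])" for y
  proof -
    have "dist y ?z \<le> (1/2) ^ n * gasket_diameter" for n
    proof -
      obtain a b where ab: "a \<in> K" "b \<in> K"
          "y = psi_word p (w @ map \<omega> [0..<n]) a" "?z = psi_word p (w @ map \<omega> [0..<n]) b"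
        using y[of n] in_cell[of n] unfolding cell_def by blast
      have "dist y ?z = (1/2) ^ (length w + n) * dist a b"
        unfolding ab(4) unfolding ab(3) dist_psi_word by simp
      also have "\<dots> \<le> (1/2) ^ n * gasket_diameter"
        using gasket_diameter ab by (intro mult_mono power_decreasing) auto
      finally show ?thesis .
    qed
    then show ?thesis by (rule eq_if_dist_le_half_powers)
  qed
  then have "(\<Inter>n. cell p (w @ map \<omega> [0..<n])) = {?z}" using in_cell by blast
  then show ?thesis unfolding coding_def by simp
qed

end

section \<open>Harmonic functions on the gasket\<close>

lemma extend_sym: "extend S i u j = extend S j u i"
  by (simp add: extend_def add.commute)

context simplex_gasket begin

definition affine_ext :: "(nat \<Rightarrow> real) \<Rightarrow> 'a \<Rightarrow> real" where
  "affine_ext u = (SOME g. \<exists>f c. linear f \<and> (\<forall>x. g x = f x + c) \<and> (\<forall>k\<in>S. g (p k) = u k))"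

lemma affine_ext:
  obtains f c where "linear f" "affine_ext u = (\<lambda>x. f x + c)" "\<And>k. k \<in> S \<Longrightarrow> f (p k) + c = u k"
proof -
  obtain f c where fc: "linear f" "\<And>k. k \<in> S \<Longrightarrow> f (p k) + c = u k"
    using affine_interpolation[of u] by blast
  then have "\<exists>g f c. linear f \<and> (\<forall>x. g x = f x + c) \<and> (\<forall>k\<in>S. g (p k) = u k)"
    by (intro exI[of _ "\<lambda>x. f x + c"] exI[of _ f] exI[of _ c]) auto
  from someI_ex[OF this] show thesis
    unfolding affine_ext_def[symmetric] using that by (auto simp: fun_eq_iff)
qed

lemma affine_ext_vertex: "k \<in> S \<Longrightarrow> affine_ext u (p k) = u k"
  by (rule affine_ext[of u]) simp

lemma continuous_on_affine_ext: "continuous_on A (affine_ext u)"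
proof (rule affine_ext[of u])
  fix f c assume f: "linear f" "affine_ext u = (\<lambda>x. f x + c)"
  have "continuous_on A f"
    using f(1) by (simp add: linear_continuous_on linear_conv_bounded_linear)
  then show ?thesis unfolding f(2) by (intro continuous_intros)
qed

lemma affine_ext_between:
  assumes "x \<in> K" "\<And>k. k \<in> S \<Longrightarrow> a \<le> u k" "\<And>k. k \<in> S \<Longrightarrow> u k \<le> b"
  shows "a \<le> affine_ext u x \<and> affine_ext u x \<le> b"
proof -
  obtain \<omega> where \<omega>: "\<omega> \<in> codes" "x = code_point \<omega>"
    using assms(1) gasket_eq_code_points by auto
  obtain f c where f: "linear f" "affine_ext u = (\<lambda>x. f x + c)" "\<And>k. k \<in> S \<Longrightarrow> f (p k) + c = u k"
    using affine_ext[of u] by blast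
  have s: "(\<lambda>m. (1/2) ^ Suc m * u (\<omega> m)) sums affine_ext u x"
    using affine_code_point_sums[OF f(1) \<omega>(1), of c] \<omega> by (simp add: f(2,3))
  have "1 * a \<le> affine_ext u x"
    by (rule sums_le[OF _ sums_mult2[OF power_half_series] s])
       (intro mult_left_mono assms(2), use \<omega>(1) in auto)
  moreover have "affine_ext u x \<le> 1 * b"
    by (rule sums_le[OF _ s sums_mult2[OF power_half_series]])
       (intro mult_left_mono assms(3), use \<omega>(1) in auto)
  ultimately show ?thesis by simp
qed

definition cell_letter :: "'a \<Rightarrow> nat" where
  "cell_letter x = (SOME i. i \<in> S \<and> x \<in> psi p i ` K)"

text \<open>
  Interpolation of order \<open>n\<close>: harmonic at the vertices of level \<open>n\<close>, affine on each cell of that level.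
  The choice of a cell in \<open>cell_letter\<close> does not matter, by \<open>approx_psi\<close>.
\<close>

primrec approx :: "nat \<Rightarrow> (nat \<Rightarrow> real) \<Rightarrow> 'a \<Rightarrow> real" where
  "approx 0 u x = affine_ext u x"
| "approx (Suc n) u x =
     approx n (extend S (cell_letter x) u) (2 *\<^sub>R x - p (cell_letter x))"

lemma cell_letter:
  assumes "i \<in> S" "y \<in> K" 
  defines "l \<equiv> cell_letter (psi p i y)"
  shows "l \<in> S" "2 *\<^sub>R psi p i y - p l \<in> K" "psi p l (2 *\<^sub>R psi p i y - p l) = psi p i y"
proof -
  have "\<exists>i. i \<in> S \<and> psi p i y \<in> psi p i ` K" using assms by blast
  then have "\<exists>l. l \<in> S \<and> psi p i y \<in> psi p l ` K" using assms by blast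
  from someI_ex[OF this] have l: "l \<in> S" "psi p i y \<in> psi p l ` K"
    unfolding l_def cell_letter_def by auto
  show "l \<in> S" by (rule l(1))
  obtain z where z: "z \<in> K" "psi p i y = psi p l z" using l(2) by auto
  have "2 *\<^sub>R psi p i y - p l = z" unfolding z(2) by (simp add: psi_def)
  then show "2 *\<^sub>R psi p i y - p l \<in> K" "psi p l (2 *\<^sub>R psi p i y - p l) = psi p i y"
    using z by simp_all
qed

lemma approx_vertex: "j \<in> S \<Longrightarrow> approx n u (p j) = u j"
proof (induction n arbitrary: u)
  case (Suc n)
  have v: "psi p j (p j) = p j" by simp
  note c = cell_letter[OF Suc.prems vertex_in_K[OF Suc.prems], unfolded v]
  have "cell_letter (p j) = j"
    using vertex_only_in_own_cell[OF c(1) Suc.prems c(2,3)] by simp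
  moreover have "2 *\<^sub>R p j - p j = p j" by (simp add: scaleR_2)
  moreover have "extend S j u j = u j" by (simp add: extend_def)
  ultimately show ?case using Suc by simp
qed (simp add: affine_ext_vertex)

text \<open>
  At a junction point, the only place where cells overlap, both cells give the same value because
  \<open>extend\<close> is symmetric in its two letters.
\<close>

lemma approx_psi:
  assumes "i \<in> S" "y \<in> K"
  shows "approx (Suc n) u (psi p i y) = approx n (extend S i u) y"
proof -
  define l where "l = cell_letter (psi p i y)"
  define z where "z = 2 *\<^sub>R psi p i y - p l"
  have c: "l \<in> S" "z \<in> K" "psi p l z = psi p i y"
    using cell_letter[OF assms] by (simp_all add: l_def z_def)
  have "approx (Suc n) u (psi p i y) = approx n (extend S l u) z"
    by (simp add: l_def z_def)
  also have "\<dots> = approx n (extend S i u) y"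
  proof (cases "l = i")
    case False
    from junction[OF c(1) assms(1) False c(2) assms(2) c(3)] have "z = p i" "y = p l" by auto
    then show ?thesis using c(1) assms(1) by (simp add: approx_vertex extend_sym)
  qed (use c in auto)
  finally show ?thesis .
qed

lemma approx_between:
  assumes "x \<in> K" "\<And>k. k \<in> S \<Longrightarrow> a \<le> u k" "\<And>k. k \<in> S \<Longrightarrow> u k \<le> b"
  shows "a \<le> approx n u x \<and> approx n u x \<le> b"
  using assms
proof (induction n arbitrary: u x)
  case 0
  from affine_ext_between[OF 0] show ?case by simp
next
  case (Suc n)
  obtain i y where iy: "i \<in> S" "y \<in> K" "x = psi p i y" using K_cases[OF Suc.prems(1)] .
  have "a \<le> approx n (extend S i u) y \<and> approx n (extend S i u) y \<le> b"
    using extend_between[OF finite_S iy(1), of _ a u b] Suc.prems iy by (intro Suc.IH) auto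
  then show ?case using approx_psi[OF iy(1,2)] iy(3) by simp
qed

lemma continuous_on_approx: "continuous_on K (approx n u)"
proof (induction n arbitrary: u)
  case 0
  have "approx 0 u = affine_ext u" by (simp add: fun_eq_iff)
  then show ?case by (simp add: continuous_on_affine_ext)
next
  case (Suc n)
  have "continuous_on (\<Union>i\<in>S. psi p i ` K) (approx (Suc n) u)"
  proof (rule continuous_on_closed_Union)
    fix i assume i: "i \<in> S"
    have "compact (psi p i ` K)"
      by (intro compact_continuous_image compact_K continuous_intros)
    then show "closed (psi p i ` K)" by (rule compact_imp_closed)
    have eq: "approx (Suc n) u x = approx n (extend S i u) (2 *\<^sub>R x - p i)"
      if x: "x \<in> psi p i ` K" for x
    proof -
      obtain y where y: "y \<in> K" "x = psi p i y" using x by blast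
      have "2 *\<^sub>R x - p i = y" using y by (simp add: psi_def)
      then show ?thesis using approx_psi[OF i y(1)] y(2) by simp
    qed
    have "continuous_on (psi p i ` K) (\<lambda>x. approx n (extend S i u) (2 *\<^sub>R x - p i))"
    proof (rule continuous_on_compose2[OF Suc.IH])
      show "(\<lambda>x. 2 *\<^sub>R x - p i) ` psi p i ` K \<subseteq> K" by (auto simp: psi_def)
    qed (intro continuous_intros)
    then show "continuous_on (psi p i ` K) (approx (Suc n) u)"
      using eq by (subst continuous_on_cong[OF refl eq]) auto
  qed simp
  then show ?case using K_eq by simp
qed

text \<open>
  The energy of a harmonic function in one cell is at most this fraction of the total energy, the
  renormalization included.
\<close>

definition shrink :: real where
  "shrink = ((real (card S))\<^sup>2 + real (card S) + 1) / ((real (card S))\<^sup>2 + 2 * real (card S))"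

lemma shrink: "0 < shrink" "shrink < 1"
proof -
  have n: "real (card S) \<ge> 3" by (rule card_S_ge)
  then have "(real (card S))\<^sup>2 + 2 * real (card S) > 0" by (intro add_nonneg_pos) auto
  moreover have "(real (card S))\<^sup>2 + real (card S) + 1 > 0" by (intro add_nonneg_pos) auto
  ultimately show "0 < shrink" "shrink < 1"
    unfolding shrink_def using n by simp_all
qed

lemma scaled_dirichlet_extend_le:
  "i \<in> S \<Longrightarrow> (real (card S) + 2) / real (card S) * dirichlet S (extend S i u) \<le> shrink * dirichlet S u"
  using dirichlet_extend_contracts[OF finite_S, of i u] by (simp only: shrink_def)

lemma dirichlet_extend_le:
  assumes "i \<in> S" shows "dirichlet S (extend S i u) \<le> shrink * dirichlet S u"
proof -
  have "1 * dirichlet S (extend S i u)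
      \<le> (real (card S) + 2) / real (card S) * dirichlet S (extend S i u)"
    using card_S_ge by (intro mult_right_mono dirichlet_nonneg) (auto simp: divide_simps)
  then show ?thesis using scaled_dirichlet_extend_le[OF assms, of u] by simp
qed

lemma approx_close:
  assumes "k \<le> m" "k \<le> n" "x \<in> K"
  shows "\<bar>approx m u x - approx n u x\<bar> \<le> 2 * sqrt (shrink ^ k * dirichlet S u)"
  using assms
proof (induction k arbitrary: m n u x)
  case 0
  have "\<bar>u l - u 1\<bar> \<le> sqrt (dirichlet S u)" if "l \<in> S" for l
    using difference_square_le_dirichlet[OF finite_S that one_in_S, of u]
    by (metis real_sqrt_abs real_sqrt_le_iff)
  then have "u 1 - sqrt (dirichlet S u) \<le> approx l u x \<and> approx l u x \<le> u 1 + sqrt (dirichlet S u)" for l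
    using 0 by (intro approx_between) (auto simp: abs_le_iff algebra_simps)
  from this[of m] this[of n]
  have "approx m u x - approx n u x \<le> 2 * sqrt (dirichlet S u)"
      "approx n u x - approx m u x \<le> 2 * sqrt (dirichlet S u)" by linarith+
  then show ?case by (simp add: abs_le_iff)
next
  case (Suc k)
  obtain i y where iy: "i \<in> S" "y \<in> K" "x = psi p i y" using K_cases[OF Suc.prems(3)] .
  obtain m' n' where mn: "m = Suc m'" "n = Suc n'" "k \<le> m'" "k \<le> n'"
    using Suc.prems by (metis Suc_le_D Suc_le_mono)
  have "\<bar>approx m u x - approx n u x\<bar>
      = \<bar>approx m' (extend S i u) y - approx n' (extend S i u) y\<bar>"
    using approx_psi[OF iy(1,2)] by (simp only: mn iy)
  also have "\<dots> \<le> 2 * sqrt (shrink ^ k * dirichlet S (extend S i u))"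
    using mn iy by (intro Suc.IH)
  also have "\<dots> \<le> 2 * sqrt (shrink ^ k * (shrink * dirichlet S u))"
    using shrink iy(1) by (intro mult_left_mono real_sqrt_le_mono dirichlet_extend_le) auto
  finally show ?case by (simp add: mult_ac)
qed

definition harmonic_ext :: "(nat \<Rightarrow> real) \<Rightarrow> 'a \<Rightarrow> real" where
  "harmonic_ext u x = lim (\<lambda>n. approx n u x)"

lemma uniform_limit_approx: "uniform_limit K (\<lambda>n. approx n u) (harmonic_ext u) sequentially"
proof -
  have "uniformly_Cauchy_on K (\<lambda>n. approx n u)"
  proof (rule uniformly_Cauchy_onI)
    fix e :: real assume e: "e > 0"
    have "(\<lambda>k. 2 * sqrt (shrink ^ k * dirichlet S u)) \<longlonglongrightarrow> 2 * sqrt (0 * dirichlet S u)"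
      using shrink by (intro tendsto_intros LIMSEQ_realpow_zero) auto
    then have "\<forall>\<^sub>F k in sequentially. 2 * sqrt (shrink ^ k * dirichlet S u) < e"
      using e by (intro order_tendstoD(2)) auto
    then obtain k where k: "2 * sqrt (shrink ^ k * dirichlet S u) < e"
      using eventually_happens' sequentially_bot by blast
    show "\<exists>M. \<forall>x\<in>K. \<forall>m\<ge>M. \<forall>n\<ge>M. dist (approx m u x) (approx n u x) < e"
    proof (intro exI[of _ k] ballI allI impI)
      fix x m n assume "x \<in> K" "k \<le> m" "k \<le> n"
      then show "dist (approx m u x) (approx n u x) < e"
        using approx_close[of k m n x u] k by (simp add: dist_real_def)
    qed
  qed
  then have "uniformly_convergent_on K (\<lambda>n. approx n u)"
    by (rule Cauchy_uniformly_convergent)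
  then show ?thesis
    unfolding uniformly_convergent_uniform_limit_iff harmonic_ext_def .
qed

lemma approx_tendsto: "x \<in> K \<Longrightarrow> (\<lambda>n. approx n u x) \<longlonglongrightarrow> harmonic_ext u x"
  by (rule tendsto_uniform_limitI[OF uniform_limit_approx])

lemma continuous_on_harmonic_ext: "continuous_on K (harmonic_ext u)"
  by (rule uniform_limit_theorem[OF _ uniform_limit_approx]) (auto simp: continuous_on_approx)

lemma harmonic_ext_vertex: "k \<in> S \<Longrightarrow> harmonic_ext u (p k) = u k"
  by (simp add: harmonic_ext_def approx_vertex)

lemma harmonic_ext_psi:
  assumes "i \<in> S" "y \<in> K"
  shows "harmonic_ext u (psi p i y) = harmonic_ext (extend S i u) y"
proof (rule LIMSEQ_unique)
  show "(\<lambda>n. approx (Suc n) u (psi p i y)) \<longlonglongrightarrow> harmonic_ext u (psi p i y)"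
    using assms by (intro LIMSEQ_Suc approx_tendsto) auto
  show "(\<lambda>n. approx (Suc n) u (psi p i y)) \<longlonglongrightarrow> harmonic_ext (extend S i u) y"
    using approx_tendsto[OF assms(2)] by (simp only: approx_psi[OF assms])
qed

lemma harmonic_ext_psi_word:
  "set w \<subseteq> S \<Longrightarrow> y \<in> K \<Longrightarrow>
     harmonic_ext u (psi_word p w y) = harmonic_ext (fold (extend S) w u) y"
  by (induction w arbitrary: u) (auto simp: harmonic_ext_psi psi_word_in_K)

lemma harmonic_ext_between:
  assumes "x \<in> K" "\<And>k. k \<in> S \<Longrightarrow> a \<le> u k" "\<And>k. k \<in> S \<Longrightarrow> u k \<le> b"
  shows "a \<le> harmonic_ext u x" "harmonic_ext u x \<le> b"
  using approx_between[OF assms]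
  by (auto intro: LIMSEQ_le_const[OF approx_tendsto[OF assms(1)]]
      LIMSEQ_le_const2[OF approx_tendsto[OF assms(1)]])

lemma harmonic_ext_pos:
  assumes "x \<in> K" "\<And>k. k \<in> S \<Longrightarrow> 0 < u k"
  shows "0 < harmonic_ext u x"
proof -
  have "u ` S \<noteq> {}" using one_in_S by blast
  then have "0 < Min (u ` S)" using assms(2) by (subst Min_gr_iff) auto
  also have "Min (u ` S) \<le> harmonic_ext u x"
    by (rule harmonic_ext_between(1)[OF assms(1), where b = "Max (u ` S)"]) auto
  finally show ?thesis .
qed

text \<open>
  If \<open>x\<close> lay in a cell \<open>k \<noteq> j\<close>, all vertex values on this cell would be positive. So \<open>x\<close> lies in the
  cell \<open>j\<close>, where the vertex values have the same signs again, and hence in all cells \<open>j \<dots> j\<close>.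
\<close>

lemma harmonic_ext_zero_only_at_vertex:
  assumes "j \<in> S" "u j = 0" "\<And>k. k \<in> S \<Longrightarrow> k \<noteq> j \<Longrightarrow> 0 < u k" "x \<in> K" "harmonic_ext u x = 0"
  shows "x = p j"
proof -
  have "dist x (p j) \<le> (1/2) ^ n * gasket_diameter" for n
    using assms
  proof (induction n arbitrary: u x)
    case 0
    then show ?case using gasket_diameter by auto
  next
    case (Suc n)
    obtain k y where ky: "k \<in> S" "y \<in> K" "x = psi p k y" using K_cases[OF Suc.prems(4)] .
    have nn: "0 \<le> u l" if "l \<in> S" for l using Suc.prems(2,3) that by (cases "l = j") force+
    then have sum: "0 \<le> sum u S" by (intro sum_nonneg) auto
    have den: "real (card S) + 2 > 0" by linarith
    have zero: "harmonic_ext (extend S k u) y = 0"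
      using Suc.prems(5) ky harmonic_ext_psi by simp
    have "k = j"
    proof (rule ccontr)
      assume "k \<noteq> j"
      then have "u k > 0" using Suc.prems(3) ky by simp
      then have "extend S k u l > 0" if "l \<in> S" for l
        using nn[OF that] sum den by (auto simp: extend_def intro!: divide_pos_pos)
      then have "0 < harmonic_ext (extend S k u) y" by (rule harmonic_ext_pos[OF ky(2)])
      with zero show False by simp
    qed
    moreover have "dist y (p j) \<le> (1/2) ^ n * gasket_diameter"
    proof (rule Suc.IH[of "extend S j u"])
      show "0 < extend S j u l" if "l \<in> S" "l \<noteq> j" for l
        using Suc.prems(3)[OF that] Suc.prems(2) that sum den
        by (auto simp: extend_def intro!: divide_pos_pos add_pos_nonneg)
    qed (use ky zero \<open>k = j\<close> assms(1) Suc.prems(2) in \<open>auto simp: extend_def\<close>)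
    ultimately show ?case
      using dist_psi_word[of "[j]" y "p j"] ky(3) by simp
  qed
  then show ?thesis by (rule eq_if_dist_le_half_powers)
qed

text \<open>
  The function with values \<open>1\<close> at \<open>p i\<close>, \<open>- 1\<close> at \<open>p j\<close> and \<open>0\<close> at the other vertices is nonnegative on
  the cell \<open>i\<close> and nonpositive on the cell \<open>j\<close>, so it vanishes at both points.
\<close>

lemma harmonic_ext_separates_cells:
  assumes "i \<in> S" "j \<in> S" "i \<noteq> j" "x \<in> K" "y \<in> K"
    and eq: "\<And>u. harmonic_ext u (psi p i x) = harmonic_ext u (psi p j y)"
  shows "x = p j"
proof -
  define u :: "nat \<Rightarrow> real" where "u k = of_bool (k = i) - of_bool (k = j)" for k
  have "sum u S = 0" using assms by (simp add: u_def sum_subtractf of_bool_def)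
  then have ext: "extend S i u k = (if k = i then 1 else if k = j then 0 else 1 / (real (card S) + 2))"
      "extend S j u k = (if k = j then - 1 else if k = i then 0 else - 1 / (real (card S) + 2))" for k
    using assms by (auto simp: extend_def u_def)
  have "0 \<le> harmonic_ext (extend S i u) x"
    by (rule harmonic_ext_between(1)[OF assms(4), where b = 1]) (auto simp: ext)
  moreover have "harmonic_ext (extend S j u) y \<le> 0"
    by (rule harmonic_ext_between(2)[OF assms(5), where a = "-1"]) (auto simp: ext)
  moreover have "harmonic_ext (extend S i u) x = harmonic_ext (extend S j u) y"
    using eq[of u] assms by (simp add: harmonic_ext_psi)
  ultimately have "harmonic_ext (extend S i u) x = 0" by simp
  then show ?thesis
    using assms by (intro harmonic_ext_zero_only_at_vertex[of j "extend S i u"]) (auto simp: ext)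
qed

text \<open>
  Points in different cells are separated unless they coincide with the junction point; points in
  the same cell are pulled back into the gasket, where all harmonic functions are again available.
  This is the hypothesis of the Stone-Weierstrass theorem for the algebra of functions of finite
  energy.
\<close>

lemma harmonic_ext_separates_points:
  assumes "x \<in> K" "y \<in> K" "x \<noteq> y"
  obtains u where "harmonic_ext u x \<noteq> harmonic_ext u y"
proof -
  have small: "dist x y \<le> (1/2) ^ n * gasket_diameter"
    if "x \<in> K" "y \<in> K" "\<And>u. harmonic_ext u x = harmonic_ext u y" for n x y
    using that
  proof (induction n arbitrary: x y)
    case 0
    then show ?case using gasket_diameter by auto
  next
    case (Suc n)
    obtain i a where ia: "i \<in> S" "a \<in> K" "x = psi p i a" using K_cases[OF Suc.prems(1)] .
    obtain j b where jb: "j \<in> S" "b \<in> K" "y = psi p j b" using K_cases[OF Suc.prems(2)] .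
    show ?case
    proof (cases "i = j")
      case True
      have "harmonic_ext v a = harmonic_ext v b" for v
      proof -
        obtain u where u: "extend S i u = v" using extend_surj[OF finite_S ia(1)] by blast
        show ?thesis using Suc.prems(3)[of u] ia jb True u harmonic_ext_psi by simp
      qed
      then have "dist a b \<le> (1/2) ^ n * gasket_diameter" using Suc.IH ia jb by blast
      then show ?thesis using dist_psi_word[of "[i]" a b] ia(3) jb(3) True by simp
    next
      case False
      have "a = p j"
        using harmonic_ext_separates_cells[OF ia(1) jb(1) False ia(2) jb(2)] Suc.prems(3) ia jb by simp
      moreover have "b = p i"
        using harmonic_ext_separates_cells[OF jb(1) ia(1) False[symmetric] jb(2) ia(2)] Suc.prems(3) ia jb
        by simp
      ultimately show ?thesis using ia jb gasket_diameter_nonneg by (simp add: junction_point)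
    qed
  qed
  have "x = y" if "\<And>u. harmonic_ext u x = harmonic_ext u y"
    by (rule eq_if_dist_le_half_powers) (rule small[OF assms(1,2) that])
  then show thesis using assms(3) that by metis
qed

end

section \<open>Energy\<close>

text \<open>
  The discrete energy measure of \<open>u\<close>, integrated against \<open>v\<close> averaged over the ends of each edge.
\<close>

definition weighted_dirichlet :: "nat set \<Rightarrow> (nat \<Rightarrow> real) \<Rightarrow> (nat \<Rightarrow> real) \<Rightarrow> real" where
  "weighted_dirichlet S u v = (\<Sum>k\<in>S. \<Sum>l\<in>S. (u k - u l)\<^sup>2 * (v k + v l)) / 2"

lemma dirichlet_add_le: "dirichlet S (\<lambda>k. u k + v k) \<le> 2 * dirichlet S u + 2 * dirichlet S v"
proof -
  have "(u k + v k - (u l + v l))\<^sup>2 \<le> 2 * (u k - u l)\<^sup>2 + 2 * (v k - v l)\<^sup>2" for k l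
    using sum_squares_bound[of "u k - u l" "v k - v l"]
    by (simp add: power2_eq_square algebra_simps)
  then have "(\<Sum>k\<in>S. \<Sum>l\<in>S. (u k + v k - (u l + v l))\<^sup>2)
      \<le> (\<Sum>k\<in>S. \<Sum>l\<in>S. 2 * (u k - u l)\<^sup>2 + 2 * (v k - v l)\<^sup>2)"
    by (intro sum_mono)
  then show ?thesis
    by (simp add: dirichlet_def sum.distrib flip: sum_distrib_left)
qed

lemma dirichlet_mult_le:
  assumes "\<And>k. k \<in> S \<Longrightarrow> \<bar>u k\<bar> \<le> a" "\<And>k. k \<in> S \<Longrightarrow> \<bar>v k\<bar> \<le> b"
  shows "dirichlet S (\<lambda>k. u k * v k) \<le> 2 * b\<^sup>2 * dirichlet S u + 2 * a\<^sup>2 * dirichlet S v"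
proof -
  have "(u k * v k - u l * v l)\<^sup>2 \<le> 2 * b\<^sup>2 * (u k - u l)\<^sup>2 + 2 * a\<^sup>2 * (v k - v l)\<^sup>2"
    if kl: "k \<in> S" "l \<in> S" for k l
  proof -
    have "u k * v k - u l * v l = u k * (v k - v l) + v l * (u k - u l)"
      by (simp add: algebra_simps)
    then have "(u k * v k - u l * v l)\<^sup>2
        \<le> 2 * (u k * (v k - v l))\<^sup>2 + 2 * (v l * (u k - u l))\<^sup>2"
      using sum_squares_bound[of "u k * (v k - v l)" "v l * (u k - u l)"]
      by (simp add: power2_sum)
    also have "\<dots> \<le> 2 * (a\<^sup>2 * (v k - v l)\<^sup>2) + 2 * (b\<^sup>2 * (u k - u l)\<^sup>2)"
      unfolding power_mult_distrib using assms(1)[OF kl(1)] assms(2)[OF kl(2)]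
      by (intro add_mono mult_left_mono mult_right_mono) (auto simp: abs_le_square_iff[symmetric])
    finally show ?thesis by simp
  qed
  then have "(\<Sum>k\<in>S. \<Sum>l\<in>S. (u k * v k - u l * v l)\<^sup>2)
      \<le> (\<Sum>k\<in>S. \<Sum>l\<in>S. 2 * b\<^sup>2 * (u k - u l)\<^sup>2 + 2 * a\<^sup>2 * (v k - v l)\<^sup>2)"
    by (intro sum_mono)
  then show ?thesis
    by (simp add: dirichlet_def sum.distrib flip: sum_distrib_left)
qed

lemma dirichlet_polarized:
  "dirichlet S (\<lambda>k. u k + v k) - dirichlet S u - dirichlet S v
     = (\<Sum>k\<in>S. \<Sum>l\<in>S. (u k - u l) * (v k - v l))"
proof -
  have "(u k + v k - (u l + v l))\<^sup>2
      = (u k - u l)\<^sup>2 + (v k - v l)\<^sup>2 + 2 * ((u k - u l) * (v k - v l))" for k l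
    by (simp add: power2_eq_square algebra_simps)
  then show ?thesis
    by (simp add: dirichlet_def sum.distrib add_divide_distrib flip: sum_distrib_left)
qed

text \<open>
  The discrete counterpart of the formula \<open>2 E(f, f g) - E(f\<^sup>2, g)\<close> that defines the energy measure.
\<close>

lemma weighted_dirichlet_eq:
  "2 * ((dirichlet S (\<lambda>k. u k + u k * v k) - dirichlet S u - dirichlet S (\<lambda>k. u k * v k)) / 2)
     - (dirichlet S (\<lambda>k. (u k)\<^sup>2 + v k) - dirichlet S (\<lambda>k. (u k)\<^sup>2) - dirichlet S v) / 2
   = weighted_dirichlet S u v"
proof -
  have eq: "(u k - u l)\<^sup>2 * (v k + v l) / 2
      = (u k - u l) * (u k * v k - u l * v l) - ((u k)\<^sup>2 - (u l)\<^sup>2) * (v k - v l) / 2" for k l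
    by (simp add: power2_eq_square field_simps)
  have "weighted_dirichlet S u v = (\<Sum>k\<in>S. \<Sum>l\<in>S. (u k - u l)\<^sup>2 * (v k + v l) / 2)"
    by (simp only: weighted_dirichlet_def sum_divide_distrib)
  also have "\<dots> = (\<Sum>k\<in>S. \<Sum>l\<in>S. (u k - u l) * (u k * v k - u l * v l))
      - (\<Sum>k\<in>S. \<Sum>l\<in>S. ((u k)\<^sup>2 - (u l)\<^sup>2) * (v k - v l)) / 2"
    by (simp only: eq sum_subtractf sum_divide_distrib)
  finally show ?thesis unfolding dirichlet_polarized by simp
qed

lemma weighted_dirichlet_cong:
  assumes "\<And>k. k \<in> S \<Longrightarrow> u k = u' k" "\<And>k. k \<in> S \<Longrightarrow> v k = v' k"
  shows "weighted_dirichlet S u v = weighted_dirichlet S u' v'"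
  unfolding weighted_dirichlet_def
  by (intro arg_cong2[where f = "(/)"] refl sum.cong) (simp_all only: assms)

lemma weighted_dirichlet_near_constant:
  assumes "\<And>k. k \<in> S \<Longrightarrow> \<bar>v k - c\<bar> \<le> e"
  shows "\<bar>weighted_dirichlet S u v - c * (2 * dirichlet S u)\<bar> \<le> e * (2 * dirichlet S u)"
proof -
  have "weighted_dirichlet S u v - c * (2 * dirichlet S u)
      = (\<Sum>k\<in>S. \<Sum>l\<in>S. (u k - u l)\<^sup>2 * (v k + v l - 2 * c)) / 2"
    by (simp add: weighted_dirichlet_def dirichlet_def right_diff_distrib sum_subtractf diff_divide_distrib
        mult.commute flip: sum_distrib_left)
  also have "\<bar>\<dots>\<bar> \<le> (\<Sum>k\<in>S. \<Sum>l\<in>S. (u k - u l)\<^sup>2 * (2 * e)) / 2"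
  proof -
    have "\<bar>\<Sum>k\<in>S. \<Sum>l\<in>S. (u k - u l)\<^sup>2 * (v k + v l - 2 * c)\<bar>
        \<le> (\<Sum>k\<in>S. \<Sum>l\<in>S. \<bar>(u k - u l)\<^sup>2 * (v k + v l - 2 * c)\<bar>)"
      by (rule order_trans[OF sum_abs sum_mono[OF sum_abs]])
    also have "\<dots> \<le> (\<Sum>k\<in>S. \<Sum>l\<in>S. (u k - u l)\<^sup>2 * (2 * e))"
    proof (intro sum_mono)
      fix k l assume "k \<in> S" "l \<in> S"
      with assms[of k] assms[of l] have "\<bar>v k + v l - 2 * c\<bar> \<le> 2 * e" by linarith
      then show "\<bar>(u k - u l)\<^sup>2 * (v k + v l - 2 * c)\<bar> \<le> (u k - u l)\<^sup>2 * (2 * e)"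
        by (simp add: abs_mult mult_left_mono)
    qed
    finally show ?thesis by simp
  qed
  also have "\<dots> = e * (2 * dirichlet S u)"
    by (simp add: dirichlet_def mult.commute flip: sum_distrib_left)
  finally show ?thesis .
qed

lemma fold_extend_cong:
  assumes "set w \<subseteq> S" "k \<in> S" "\<And>l. l \<in> S \<Longrightarrow> v l = v' l"
  shows "fold (extend S) w v k = fold (extend S) w v' k"
  using assms
proof (induction w arbitrary: v v')
  case (Cons i w)
  have "extend S i v l = extend S i v' l" if "l \<in> S" for l
    using Cons.prems that by (intro extend_cong) auto
  from Cons.IH[OF _ Cons.prems(2) this] Cons.prems(1) show ?case by simp
qed simp

context simplex_gasket begin

definition renorm :: real where "renorm = (real (card S) + 2) / real (card S)"

lemma renorm_ge_1: "renorm \<ge> 1"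
  using card_S_ge by (simp add: renorm_def divide_simps)

lemma renorm_pos: "renorm > 0" using renorm_ge_1 by simp

lemma S_nonempty [simp]: "S \<noteq> {}" using one_in_S by blast

lemma renorm_sum_dirichlet_extend: "renorm * (\<Sum>i\<in>S. dirichlet S (extend S i u)) = dirichlet S u"
  using sum_dirichlet_extend[OF finite_S, of u] card_S_ge by (simp add: renorm_def divide_simps mult.commute)

abbreviation word_set :: "nat \<Rightarrow> nat list set" where
  "word_set m \<equiv> {w. length w = m \<and> set w \<subseteq> S}"

lemma word_set_0: "word_set 0 = {[]}" by auto

lemma finite_word_set [simp]: "finite (word_set m)"
  using finite_lists_length_eq[OF finite_S, of m] by (simp add: conj_commute)

lemma sum_word_set_Suc:
  "(\<Sum>w\<in>word_set (Suc m). f w) = (\<Sum>i\<in>S. \<Sum>w\<in>word_set m. f (i # w))"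
proof -
  have "word_set (Suc m) = (\<lambda>(i, w). i # w) ` (S \<times> word_set m)"
    by (auto simp: length_Suc_conv image_iff)
  moreover have "inj_on (\<lambda>(i, w). i # w) (S \<times> word_set m)" by (auto simp: inj_on_def)
  ultimately show ?thesis
    by (simp add: sum.reindex sum.cartesian_product split_def)
qed

lemma level_energy_eq:
  "level_energy p m f = renorm ^ m * (\<Sum>w\<in>word_set m. dirichlet S (\<lambda>k. f (psi_word p w (p k))))"
  unfolding level_energy_def words_def Q0_def dirichlet_def S_eq[symmetric] renorm_def card_S
  by (simp add: add.commute)

lemma level_energy_0: "level_energy p 0 f = dirichlet S (\<lambda>k. f (p k))"
  unfolding level_energy_eq word_set_0 by simp

lemma level_energy_Suc:
  "level_energy p (Suc m) f = renorm * (\<Sum>i\<in>S. level_energy p m (\<lambda>x. f (psi p i x)))"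
  unfolding level_energy_eq sum_word_set_Suc
  by (simp add: mult.assoc flip: sum_distrib_left)

lemma level_energy_nonneg: "0 \<le> level_energy p m f"
  unfolding level_energy_eq using renorm_pos
  by (intro mult_nonneg_nonneg sum_nonneg dirichlet_nonneg) auto

lemma level_energy_cong:
  assumes "\<And>x. x \<in> K \<Longrightarrow> f x = g x"
  shows "level_energy p m f = level_energy p m g"
  unfolding level_energy_eq
  by (intro arg_cong2[where f = "(*)"] refl sum.cong dirichlet_cong assms psi_word_in_K vertex_in_K) auto

lemma level_energy_1:
  "level_energy p 1 f = level_energy p 0 f
     + renorm * (\<Sum>i\<in>S. dirichlet S (\<lambda>k. f (psi p i (p k)) - extend S i (\<lambda>k. f (p k)) k))"
proof -
  have "renorm * (\<Sum>i\<in>S. dirichlet S (\<lambda>k. f (psi p i (p k))))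
      = renorm * (real (card S) / (real (card S) + 2) * dirichlet S (\<lambda>k. f (p k))
        + (\<Sum>i\<in>S. dirichlet S (\<lambda>k. f (psi p i (p k)) - extend S i (\<lambda>k. f (p k)) k)))"
    by (subst dirichlet_subdivision[OF finite_S, where u = "\<lambda>k. f (p k)"])
       (simp_all add: junction_point)
  moreover have "renorm * (real (card S) / (real (card S) + 2)) = 1"
    using card_S_ge by (simp add: renorm_def)
  ultimately show ?thesis
    using level_energy_Suc[of 0 f] renorm_pos by (simp add: level_energy_0 distrib_left mult.assoc[symmetric])
qed

lemma level_energy_mono: "level_energy p m f \<le> level_energy p (Suc m) f"
proof (induction m arbitrary: f)
  case 0
  show ?case
    using level_energy_1[of f] renorm_pos by (auto intro!: mult_nonneg_nonneg sum_nonneg dirichlet_nonneg)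
next
  case (Suc m)
  then show ?case
    unfolding level_energy_Suc[of "Suc m"] level_energy_Suc[of m]
    using renorm_pos by (intro mult_left_mono sum_mono) auto
qed

lemma level_energy_le: "m \<le> n \<Longrightarrow> level_energy p m f \<le> level_energy p n f"
  by (rule lift_Suc_mono_le[of "\<lambda>m. level_energy p m f"]) (auto intro: level_energy_mono)

lemma energy_eq_SUP: "energy p f = (SUP m. ennreal (level_energy p m f))"
proof -
  have "incseq (\<lambda>m. ennreal (level_energy p m f))"
    by (intro monoI ennreal_leI level_energy_le)
  then show ?thesis unfolding energy_def by (intro limI LIMSEQ_SUP)
qed

lemma level_energy_le_energy: "ennreal (level_energy p m f) \<le> energy p f"
  unfolding energy_eq_SUP by (rule SUP_upper) simp

lemma energy_cong: "(\<And>x. x \<in> K \<Longrightarrow> f x = g x) \<Longrightarrow> energy p f = energy p g"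
  unfolding energy_eq_SUP using level_energy_cong[of f g] by simp

lemma energy_domI:
  assumes "continuous_on K f" "\<And>m. level_energy p m f \<le> b"
  shows "f \<in> energy_dom p"
proof -
  have "energy p f \<le> ennreal b"
    unfolding energy_eq_SUP by (intro SUP_least ennreal_leI assms)
  then show ?thesis
    using assms(1) le_less_trans[OF _ ennreal_less_top] by (auto simp: energy_dom_def infinity_ennreal_def)
qed

lemma energy_dom_continuous: "f \<in> energy_dom p \<Longrightarrow> continuous_on K f"
  by (simp add: energy_dom_def)

lemma level_energy_tendsto:
  assumes "f \<in> energy_dom p"
  shows "(\<lambda>m. level_energy p m f) \<longlonglongrightarrow> enn2real (energy p f)"
proof -
  have fin: "energy p f \<noteq> top" using assms by (auto simp: energy_dom_def)
  have "incseq (\<lambda>m. ennreal (level_energy p m f))"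
    by (intro monoI ennreal_leI level_energy_le)
  then have "(\<lambda>m. ennreal (level_energy p m f)) \<longlonglongrightarrow> energy p f"
    unfolding energy_eq_SUP by (rule LIMSEQ_SUP)
  moreover have "energy p f = ennreal (enn2real (energy p f))"
    using fin by (simp add: ennreal_enn2real_if)
  ultimately have "(\<lambda>m. enn2real (ennreal (level_energy p m f))) \<longlonglongrightarrow> enn2real (energy p f)"
    by (intro tendsto_enn2real) auto
  then show ?thesis by (simp add: level_energy_nonneg)
qed

lemma level_energy_le_real:
  assumes "f \<in> energy_dom p" shows "level_energy p m f \<le> enn2real (energy p f)"
  by (rule LIMSEQ_le_const[OF level_energy_tendsto[OF assms]]) (auto intro: level_energy_le)

lemma energy_dom_add:
  assumes "f \<in> energy_dom p" "g \<in> energy_dom p"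
  shows "(\<lambda>x. f x + g x) \<in> energy_dom p"
proof (rule energy_domI)
  show "continuous_on K (\<lambda>x. f x + g x)"
    using assms by (intro continuous_intros energy_dom_continuous)
  fix m
  have "level_energy p m (\<lambda>x. f x + g x) \<le> 2 * level_energy p m f + 2 * level_energy p m g"
  proof -
    have "(\<Sum>w\<in>word_set m. dirichlet S (\<lambda>k. f (psi_word p w (p k)) + g (psi_word p w (p k))))
        \<le> (\<Sum>w\<in>word_set m. 2 * dirichlet S (\<lambda>k. f (psi_word p w (p k)))
            + 2 * dirichlet S (\<lambda>k. g (psi_word p w (p k))))"
      by (intro sum_mono dirichlet_add_le)
    from mult_left_mono[OF this, of "renorm ^ m"] renorm_pos show ?thesis
      by (simp add: level_energy_eq sum.distrib algebra_simps flip: sum_distrib_left)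
  qed
  also have "\<dots> \<le> 2 * enn2real (energy p f) + 2 * enn2real (energy p g)"
    using assms by (intro add_mono mult_left_mono level_energy_le_real) auto
  finally show "level_energy p m (\<lambda>x. f x + g x)
      \<le> 2 * enn2real (energy p f) + 2 * enn2real (energy p g)" .
qed

lemma continuous_on_K_bounded:
  assumes "continuous_on K (f :: 'a \<Rightarrow> real)" obtains b where "\<And>x. x \<in> K \<Longrightarrow> \<bar>f x\<bar> \<le> b"
  using compact_imp_bounded[OF compact_continuous_image[OF assms compact_K]]
  by (auto simp: bounded_iff)

text \<open>
  So the functions of finite energy form an algebra; in particular the right-hand side of the
  defining identity of the energy measure is a limit of finite level energies.
\<close>

lemma energy_dom_mult:
  assumes "f \<in> energy_dom p" "g \<in> energy_dom p"
  shows "(\<lambda>x. f x * g x) \<in> energy_dom p"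
proof -
  have cont: "continuous_on K f" "continuous_on K g" using assms by (simp_all add: energy_dom_continuous)
  obtain a where a: "\<And>x. x \<in> K \<Longrightarrow> \<bar>f x\<bar> \<le> a" using continuous_on_K_bounded[OF cont(1)] by blast
  obtain b where b: "\<And>x. x \<in> K \<Longrightarrow> \<bar>g x\<bar> \<le> b" using continuous_on_K_bounded[OF cont(2)] by blast
  show ?thesis
  proof (rule energy_domI)
    show "continuous_on K (\<lambda>x. f x * g x)" using cont by (intro continuous_intros)
    fix m
    have "level_energy p m (\<lambda>x. f x * g x)
        \<le> 2 * b\<^sup>2 * level_energy p m f + 2 * a\<^sup>2 * level_energy p m g"
    proof -
      have "(\<Sum>w\<in>word_set m. dirichlet S (\<lambda>k. f (psi_word p w (p k)) * g (psi_word p w (p k))))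
          \<le> (\<Sum>w\<in>word_set m. 2 * b\<^sup>2 * dirichlet S (\<lambda>k. f (psi_word p w (p k)))
              + 2 * a\<^sup>2 * dirichlet S (\<lambda>k. g (psi_word p w (p k))))"
        by (intro sum_mono dirichlet_mult_le a b psi_word_in_K vertex_in_K) auto
      from mult_left_mono[OF this, of "renorm ^ m"] renorm_pos show ?thesis
        by (simp add: level_energy_eq sum.distrib algebra_simps flip: sum_distrib_left)
    qed
    also have "\<dots> \<le> 2 * b\<^sup>2 * enn2real (energy p f) + 2 * a\<^sup>2 * enn2real (energy p g)"
      using assms by (intro add_mono mult_left_mono level_energy_le_real) auto
    finally show "level_energy p m (\<lambda>x. f x * g x)
        \<le> 2 * b\<^sup>2 * enn2real (energy p f) + 2 * a\<^sup>2 * enn2real (energy p g)" .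
  qed
qed

lemma energy_dom_const: "(\<lambda>_. c) \<in> energy_dom p"
  by (rule energy_domI[where b = 0]) (auto simp: level_energy_eq dirichlet_def)

lemma level_energy_harmonic_ext: "level_energy p m (harmonic_ext u) = dirichlet S u"
proof (induction m arbitrary: u)
  case 0
  show ?case unfolding level_energy_0 by (rule dirichlet_cong) (rule harmonic_ext_vertex)
next
  case (Suc m)
  have "level_energy p m (\<lambda>x. harmonic_ext u (psi p i x)) = dirichlet S (extend S i u)"
    if "i \<in> S" for i
    using level_energy_cong[OF harmonic_ext_psi[OF that, of _ u], where m = m] Suc by simp
  then show ?case
    by (simp add: level_energy_Suc renorm_sum_dirichlet_extend)
qed

lemma energy_harmonic_ext: "energy p (harmonic_ext u) = ennreal (dirichlet S u)"
  by (simp add: energy_eq_SUP level_energy_harmonic_ext)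

lemma harmonic_ext_in_energy_dom: "harmonic_ext u \<in> energy_dom p"
  by (rule energy_domI[where b = "dirichlet S u"])
     (simp_all add: continuous_on_harmonic_ext level_energy_harmonic_ext)

lemma dirichlet_le_energy:
  assumes "\<And>k. k \<in> S \<Longrightarrow> f (p k) = u k" shows "ennreal (dirichlet S u) \<le> energy p f"
proof -
  have "dirichlet S u = level_energy p 0 f"
    unfolding level_energy_0 by (rule dirichlet_cong) (simp add: assms)
  then show ?thesis using level_energy_le_energy[of 0 f] by simp
qed

lemma harmonic_ext_like_is_harmonic:
  assumes "\<And>x. x \<in> K \<Longrightarrow> h x = harmonic_ext u x"
  shows "h \<in> harmonic p"
proof -
  have vals: "h (p k) = u k" if "k \<in> S" for k
    using assms harmonic_ext_vertex that vertex_in_K by metis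
  have en: "energy p h = ennreal (dirichlet S u)"
    using energy_cong[of h "harmonic_ext u"] assms energy_harmonic_ext by simp
  have dom: "h \<in> energy_dom p"
    using continuous_on_harmonic_ext[of u] en assms
    by (auto simp: energy_dom_def ennreal_less_top cong: continuous_on_cong)
  have "Inf {energy p f | f. f \<in> energy_dom p \<and> (\<forall>i\<in>S. f (p i) = h (p i))} = energy p h"
  proof (rule antisym)
    show "Inf {energy p f | f. f \<in> energy_dom p \<and> (\<forall>i\<in>S. f (p i) = h (p i))} \<le> energy p h"
      using dom by (intro Inf_lower) auto
    show "energy p h \<le> Inf {energy p f | f. f \<in> energy_dom p \<and> (\<forall>i\<in>S. f (p i) = h (p i))}"
      unfolding en by (rule Inf_greatest) (auto simp: vals intro!: dirichlet_le_energy)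
  qed
  then show ?thesis using dom by (simp add: harmonic_def S_eq)
qed

text \<open>
  If the level energies of \<open>f\<close> never exceed that of level \<open>0\<close>, they are constant, and the deviation
  from the harmonic rule vanishes in the first subdivision. The restrictions of \<open>f\<close> to the cells
  inherit the hypothesis, because their energies add up.
\<close>

lemma minimal_energy_vertex_values:
  assumes "\<And>m. level_energy p m f \<le> level_energy p 0 f" "set w \<subseteq> S" "k \<in> S"
  shows "f (psi_word p w (p k)) = fold (extend S) w (\<lambda>k. f (p k)) k"
  using assms
proof (induction w arbitrary: f)
  case (Cons i w)
  let ?d = "\<lambda>i. dirichlet S (\<lambda>k. f (psi p i (p k)) - extend S i (\<lambda>k. f (p k)) k)"
  have i: "i \<in> S" using Cons.prems by simp
  have "renorm * (\<Sum>i\<in>S. ?d i) \<le> 0"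
    using level_energy_1[of f] Cons.prems(1)[of 1] by simp
  then have "(\<Sum>i\<in>S. ?d i) \<le> 0" using renorm_pos by (simp add: mult_le_0_iff)
  then have "(\<Sum>i\<in>S. ?d i) = 0" by (intro antisym sum_nonneg dirichlet_nonneg)
  then have "?d i = 0" using i by (simp add: sum_nonneg_eq_0_iff dirichlet_nonneg)
  then have same: "f (psi p i (p l)) - extend S i (\<lambda>k. f (p k)) l
      = f (psi p i (p i)) - extend S i (\<lambda>k. f (p k)) i" if "l \<in> S" for l
    using i that unfolding dirichlet_eq_0_iff[OF finite_S] by blast
  then have step: "f (psi p i (p l)) = extend S i (\<lambda>k. f (p k)) l" if "l \<in> S" for l
    using same[OF that] by (simp add: extend_def[of S i])
  have min: "level_energy p m (\<lambda>x. f (psi p i x)) \<le> level_energy p 0 (\<lambda>x. f (psi p i x))" for m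
  proof -
    have "(\<Sum>j\<in>S. level_energy p m (\<lambda>x. f (psi p j x)) - level_energy p 0 (\<lambda>x. f (psi p j x))) \<le> 0"
    proof -
      have "level_energy p (Suc m) f \<le> level_energy p (Suc 0) f"
        using Cons.prems(1)[of "Suc m"] level_energy_le[of 0 "Suc 0" f] by simp
      then show ?thesis
        unfolding level_energy_Suc using renorm_pos by (simp add: sum_subtractf)
    qed
    moreover have "level_energy p m (\<lambda>x. f (psi p i x)) - level_energy p 0 (\<lambda>x. f (psi p i x))
        \<le> (\<Sum>j\<in>S. level_energy p m (\<lambda>x. f (psi p j x)) - level_energy p 0 (\<lambda>x. f (psi p j x)))"
      using i by (intro member_le_sum) (auto intro: level_energy_le)
    ultimately show ?thesis by simp
  qed
  have "f (psi_word p (i # w) (p k)) = fold (extend S) w (\<lambda>k. f (psi p i (p k))) k"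
    using Cons.IH[OF min] Cons.prems by simp
  also have "\<dots> = fold (extend S) w (extend S i (\<lambda>k. f (p k))) k"
    using Cons.prems step by (intro fold_extend_cong) auto
  finally show ?case by simp
qed simp

text \<open>
  A minimizer has at most the energy of \<open>harmonic_ext\<close>, which is the level energy \<open>0\<close>. So its values
  at all vertices of all levels are known, and these are dense.
\<close>

lemma harmonic_eq_harmonic_ext:
  assumes "h \<in> harmonic p" "x \<in> K"
  shows "h x = harmonic_ext (\<lambda>k. h (p k)) x"
proof -
  let ?u = "\<lambda>k. h (p k)"
  have dom: "h \<in> energy_dom p" using assms by (simp add: harmonic_def)
  have "energy p h = Inf {energy p f | f. f \<in> energy_dom p \<and> (\<forall>i\<in>S. f (p i) = h (p i))}"
    using assms by (simp add: harmonic_def S_eq)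
  also have "\<dots> \<le> energy p (harmonic_ext ?u)"
    by (rule Inf_lower) (auto simp: harmonic_ext_in_energy_dom harmonic_ext_vertex)
  finally have "energy p h \<le> ennreal (level_energy p 0 h)"
    by (simp add: energy_harmonic_ext level_energy_0)
  then have "ennreal (level_energy p m h) \<le> ennreal (level_energy p 0 h)" for m
    using level_energy_le_energy[of m h] by (rule order_trans[rotated])
  then have min: "level_energy p m h \<le> level_energy p 0 h" for m
    by (simp add: level_energy_nonneg ennreal_le_iff)
  have vals: "h (psi_word p w (p k)) = harmonic_ext ?u (psi_word p w (p k))"
    if "set w \<subseteq> S" "k \<in> S" for w k
    using minimal_energy_vertex_values[OF min that] that
    by (simp add: harmonic_ext_psi_word vertex_in_K)
      (metis (no_types) harmonic_ext_vertex)
  obtain \<omega> where \<omega>: "\<omega> \<in> codes" "x = code_point \<omega>"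
    using assms(2) gasket_eq_code_points by auto
  define y where "y n = psi_word p (map \<omega> [0..<n]) (p 1)" for n
  have pre: "set (map \<omega> [0..<n]) \<subseteq> S" for n using \<omega>(1) by (simp add: image_subset_iff)
  have yK: "y n \<in> K" for n unfolding y_def using pre by (intro psi_word_in_K vertex_in_K) auto
  have "y \<longlonglongrightarrow> x"
  proof (rule metric_tendsto_imp_tendsto)
    show "(\<lambda>n. (1/2) ^ n * gasket_diameter) \<longlonglongrightarrow> 0" by (rule half_power_tendsto_0)
    have "dist (y n) x \<le> (1/2) ^ n * gasket_diameter" for n
    proof -
      have "code_point (\<lambda>m. \<omega> (m + n)) \<in> K"
        unfolding gasket_eq_code_points using \<omega>(1) by (intro imageI) auto
      then show ?thesis
        unfolding y_def \<omega>(2)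
        by (subst code_point_prefix[OF \<omega>(1), of n], unfold dist_psi_word) (auto intro!: gasket_diameter)
    qed
    then show "\<forall>\<^sub>F n in sequentially. dist (y n) x \<le> dist ((1/2) ^ n * gasket_diameter) 0"
      using gasket_diameter_nonneg by (intro always_eventually allI) (simp add: abs_mult)
  qed
  then have lim: "(\<lambda>n. f (y n)) \<longlonglongrightarrow> f x" if "continuous_on K f" for f :: "'a \<Rightarrow> real"
    by (intro continuous_on_tendsto_compose[OF that _ assms(2)]) (simp_all add: yK)
  have "h (y n) = harmonic_ext ?u (y n)" for n
    unfolding y_def using pre by (intro vals) auto
  then show ?thesis
    using LIMSEQ_unique[OF lim[OF energy_dom_continuous[OF dom]]]
      lim[OF continuous_on_harmonic_ext[of ?u]] by simp
qed

definition level_mass :: "nat \<Rightarrow> ('a \<Rightarrow> real) \<Rightarrow> ('a \<Rightarrow> real) \<Rightarrow> real" where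
  "level_mass m f g = renorm ^ m * (\<Sum>w\<in>word_set m.
     weighted_dirichlet S (\<lambda>k. f (psi_word p w (p k))) (\<lambda>k. g (psi_word p w (p k))))"

lemma energy_form_tendsto:
  assumes "f \<in> energy_dom p" "g \<in> energy_dom p"
  shows "(\<lambda>m. (level_energy p m (\<lambda>x. f x + g x) - level_energy p m f - level_energy p m g) / 2)
    \<longlonglongrightarrow> energy_form p f g"
  unfolding energy_form_def
  using assms by (intro tendsto_intros level_energy_tendsto energy_dom_add) auto

lemma level_mass_tendsto:
  assumes "f \<in> energy_dom p" "g \<in> energy_dom p"
  shows "(\<lambda>m. level_mass m f g)
    \<longlonglongrightarrow> 2 * energy_form p f (\<lambda>x. f x * g x) - energy_form p (\<lambda>x. (f x)\<^sup>2) g"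
proof -
  have sq: "(\<lambda>x. (f x)\<^sup>2) \<in> energy_dom p"
    unfolding power2_eq_square using assms by (intro energy_dom_mult)
  have "level_mass m f g
      = 2 * ((level_energy p m (\<lambda>x. f x + f x * g x) - level_energy p m f
            - level_energy p m (\<lambda>x. f x * g x)) / 2)
        - (level_energy p m (\<lambda>x. (f x)\<^sup>2 + g x) - level_energy p m (\<lambda>x. (f x)\<^sup>2)
            - level_energy p m g) / 2" for m
    unfolding level_mass_def level_energy_eq weighted_dirichlet_eq[symmetric]
    by (simp only: sum_subtractf sum_distrib_left[symmetric] sum_divide_distrib[symmetric])
       (simp add: field_simps)
  then show ?thesis
    using assms sq by (simp only:) (intro tendsto_intros energy_form_tendsto energy_dom_mult)
qed

end

section \<open>A measure with prescribed cell masses\<close>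

lemma fold_extend_scale: "fold (extend S) w (\<lambda>k. a * v k) = (\<lambda>k. a * fold (extend S) w v k)"
  by (induction w arbitrary: v) (simp_all add: extend_scale)

context simplex_gasket begin

text \<open>
  Twice the energy, since the energy measure of \<open>f\<close> has total mass \<open>2 E(f, f)\<close>.
\<close>

definition mass :: "(nat \<Rightarrow> real) \<Rightarrow> real" where
  "mass u = 2 * dirichlet S u"

text \<open>
  The scaling puts the renormalization factor of the energy into the vertex vector, so that the
  masses of the branches add up to the mass of \<open>u\<close>.
\<close>

definition branch :: "nat \<Rightarrow> (nat \<Rightarrow> real) \<Rightarrow> nat \<Rightarrow> real" where
  "branch i u = (\<lambda>k. sqrt renorm * extend S i u k)"

definition offset :: "nat \<Rightarrow> (nat \<Rightarrow> real) \<Rightarrow> real" where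
  "offset i u = (\<Sum>k\<in>{k\<in>S. k < i}. mass (branch k u))"

text \<open>
  The interval \<open>[0, mass u)\<close> is cut into consecutive pieces whose lengths are the masses of the
  branches.
\<close>

definition interval :: "nat \<Rightarrow> (nat \<Rightarrow> real) \<Rightarrow> real set" where
  "interval i u = {offset i u ..< offset i u + mass (branch i u)}"

lemma mass_nonneg: "0 \<le> mass u"
  by (simp add: mass_def dirichlet_nonneg)

lemma mass_branch: "mass (branch i u) = renorm * mass (extend S i u)"
  using renorm_pos by (simp add: mass_def branch_def dirichlet_scale)

lemma sum_mass_branch: "(\<Sum>i\<in>S. mass (branch i u)) = mass u"
proof -
  have "(\<Sum>i\<in>S. mass (branch i u)) = (\<Sum>i\<in>S. 2 * renorm * dirichlet S (extend S i u))"
    by (simp only: mass_branch) (simp add: mass_def mult_ac)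
  also have "\<dots> = 2 * (renorm * (\<Sum>i\<in>S. dirichlet S (extend S i u)))"
    by (simp only: sum_distrib_left[symmetric] mult.assoc)
  finally show ?thesis by (simp add: renorm_sum_dirichlet_extend mass_def)
qed

lemma mass_branch_le:
  assumes "i \<in> S" shows "mass (branch i u) \<le> shrink * mass u"
proof -
  have "2 * (renorm * dirichlet S (extend S i u)) \<le> 2 * (shrink * dirichlet S u)"
    using scaled_dirichlet_extend_le[OF assms, of u] by (simp add: renorm_def)
  then show ?thesis by (simp only: mass_branch) (simp add: mass_def mult_ac)
qed

lemma offset_nonneg: "0 \<le> offset i u"
  unfolding offset_def by (intro sum_nonneg mass_nonneg)

lemma offset_mass_le:
  assumes "i \<in> S" "A \<subseteq> S" "\<And>k. k \<in> S \<Longrightarrow> k \<le> i \<Longrightarrow> k \<in> A"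
  shows "offset i u + mass (branch i u) \<le> (\<Sum>k\<in>A. mass (branch k u))"
proof -
  have "offset i u + mass (branch i u) = (\<Sum>k\<in>insert i {k\<in>S. k < i}. mass (branch k u))"
    by (simp add: offset_def)
  also have "\<dots> \<le> (\<Sum>k\<in>A. mass (branch k u))"
    using assms finite_subset[OF assms(2)] by (intro sum_mono2 mass_nonneg) auto
  finally show ?thesis .
qed

lemma interval_disjoint:
  assumes "i \<in> S" "k \<in> S" "t \<in> interval i u" "t \<in> interval k u"
  shows "i = k"
proof -
  have "\<not> i < k" if "i \<in> S" "k \<in> S" "t \<in> interval i u" "t \<in> interval k u" for i k
  proof
    assume "i < k"
    then have "offset i u + mass (branch i u) \<le> offset k u"
      unfolding offset_def[of k] using that by (intro offset_mass_le) auto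
    then show False using that by (auto simp: interval_def)
  qed
  from this[of i k] this[of k i] assms show ?thesis by auto
qed

lemma interval_subset: "i \<in> S \<Longrightarrow> interval i u \<subseteq> {0..<mass u}"
  using offset_mass_le[of i S u] offset_nonneg[of i u]
  by (auto simp: interval_def sum_mass_branch)

lemma interval_cover:
  assumes "t \<in> {0..<mass u}" obtains i where "i \<in> S" "t \<in> interval i u"
proof -
  \<comment> \<open>The last piece that starts no later than \<open>t\<close>.\<close>
  let ?i = "Max {k\<in>S. offset k u \<le> t}"
  have "{k\<in>S. k < 1} = {}" by (auto simp: S_eq letters_def)
  then have "offset 1 u = 0" by (simp only: offset_def sum.empty)
  then have ne: "{k\<in>S. offset k u \<le> t} \<noteq> {}" using assms one_in_S by auto
  have fin: "finite {k\<in>S. offset k u \<le> t}" by simp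
  have i: "?i \<in> S" "offset ?i u \<le> t" using Max_in[OF fin ne] by auto
  have "t < offset ?i u + mass (branch ?i u)"
  proof (cases "Suc ?i \<in> S")
    case True
    have "offset (Suc ?i) u = offset ?i u + mass (branch ?i u)"
    proof -
      have "{k\<in>S. k < Suc ?i} = insert ?i {k\<in>S. k < ?i}" using i(1) by auto
      then show ?thesis by (simp add: offset_def)
    qed
    moreover have "\<not> offset (Suc ?i) u \<le> t"
    proof
      assume "offset (Suc ?i) u \<le> t"
      then have "Suc ?i \<le> ?i" using True by (intro Max_ge[OF fin]) simp
      then show False by simp
    qed
    ultimately show ?thesis by simp
  next
    case False
    then have "S = insert ?i {k\<in>S. k < ?i}" using i(1) by (auto simp: S_eq letters_def)
    then have "(\<Sum>k\<in>S. mass (branch k u)) = (\<Sum>k\<in>insert ?i {k\<in>S. k < ?i}. mass (branch k u))"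
      by (rule arg_cong)
    also have "\<dots> = offset ?i u + mass (branch ?i u)" by (simp add: offset_def)
    finally show ?thesis using assms by (simp add: sum_mass_branch)
  qed
  then show thesis using that[OF i(1)] i(2) by (simp add: interval_def)
qed

lemma interval_sum:
  fixes f :: "nat \<Rightarrow> 'b::real_vector"
  assumes "i \<in> S" "t \<in> interval i u"
  shows "(\<Sum>k\<in>S. indicator (interval k u) t *\<^sub>R f k) = f i"
proof -
  have "(\<Sum>k\<in>S. indicator (interval k u) t *\<^sub>R f k) = (\<Sum>k\<in>S. if k = i then f i else 0)"
    using assms interval_disjoint by (intro sum.cong refl) (auto simp: indicator_def)
  also have "\<dots> = f i" using assms(1) by simp
  finally show ?thesis .
qed

text \<open>
  Descends \<open>n\<close> levels in the nested partitions and applies the corresponding maps to a vertex. The sum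
  has at most one nonzero term; in this form measurability is immediate.
\<close>

primrec locate :: "nat \<Rightarrow> (nat \<Rightarrow> real) \<Rightarrow> real \<Rightarrow> 'a" where
  "locate 0 u t = p 1"
| "locate (Suc n) u t = (\<Sum>i\<in>S. indicator (interval i u) t *\<^sub>R
     psi p i (locate n (branch i u) (t - offset i u)))"

lemma psi_measurable [measurable]: "psi p i \<in> borel_measurable borel"
  by (intro borel_measurable_continuous_onI continuous_intros)

lemma interval_measurable [measurable]: "interval i u \<in> sets borel"
  by (simp add: interval_def)

lemma locate_measurable [measurable]: "locate n u \<in> borel_measurable borel"
proof (induction n arbitrary: u)
  case 0
  have "locate 0 u = (\<lambda>_. p 1)" by (simp add: fun_eq_iff)
  then show ?case by simp
next
  case (Suc n)
  note Suc.IH [measurable]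
  have eq: "locate (Suc n) u = (\<lambda>t. \<Sum>i\<in>S. indicator (interval i u) t *\<^sub>R
     psi p i (locate n (branch i u) (t - offset i u)))" by (simp add: fun_eq_iff)
  show ?case unfolding eq by measurable
qed

lemma locate_Suc:
  assumes "i \<in> S" "t \<in> interval i u"
  shows "locate (Suc n) u t = psi p i (locate n (branch i u) (t - offset i u))"
  using interval_sum[OF assms] by simp

lemma interval_shift: "t \<in> interval i u \<longleftrightarrow> t - offset i u \<in> {0..<mass (branch i u)}"
  by (auto simp: interval_def)

lemma locate_in_K: "t \<in> {0..<mass u} \<Longrightarrow> locate n u t \<in> K"
proof (induction n arbitrary: u t)
  case 0
  then show ?case using vertex_in_K[OF one_in_S] by simp
next
  case (Suc n)
  obtain i where i: "i \<in> S" "t \<in> interval i u" using interval_cover[OF Suc.prems] .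
  show ?case unfolding locate_Suc[OF i] using i Suc.IH by (auto simp: interval_shift)
qed

lemma locate_close:
  assumes "k \<le> m" "k \<le> n" "t \<in> {0..<mass u}"
  shows "dist (locate m u t) (locate n u t) \<le> (1/2) ^ k * gasket_diameter"
  using assms
proof (induction k arbitrary: m n u t)
  case 0
  then show ?case by (simp add: gasket_diameter locate_in_K)
next
  case (Suc k)
  obtain i where i: "i \<in> S" "t \<in> interval i u" using interval_cover[OF Suc.prems(3)] .
  obtain m' n' where mn: "m = Suc m'" "n = Suc n'" "k \<le> m'" "k \<le> n'"
    using Suc.prems by (metis Suc_le_D Suc_le_mono)
  have "dist (locate m' (branch i u) (t - offset i u)) (locate n' (branch i u) (t - offset i u))
      \<le> (1/2) ^ k * gasket_diameter"
    using mn i(2) by (intro Suc.IH) (auto simp: interval_shift)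
  then show ?case
    unfolding mn(1,2) locate_Suc[OF i]
    using dist_psi_word[of "[i]"] by simp
qed

definition address :: "(nat \<Rightarrow> real) \<Rightarrow> real \<Rightarrow> 'a" where
  "address u t = lim (\<lambda>n. locate n u t)"

lemma address_measurable [measurable]: "address u \<in> borel_measurable borel"
  unfolding address_def[abs_def] by measurable

lemma address_tendsto:
  assumes "t \<in> {0..<mass u}" shows "(\<lambda>n. locate n u t) \<longlonglongrightarrow> address u t"
proof -
  have "Cauchy (\<lambda>n. locate n u t)"
  proof (rule metric_CauchyI)
    fix e :: real assume "e > 0"
    from order_tendstoD(2)[OF half_power_tendsto_0 this]
    obtain k where k: "(1/2) ^ k * gasket_diameter < e"
      using eventually_happens' sequentially_bot by blast
    show "\<exists>M. \<forall>m\<ge>M. \<forall>n\<ge>M. dist (locate m u t) (locate n u t) < e"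
      using locate_close[OF _ _ assms, of k] k by (intro exI[of _ k]) (auto intro: le_less_trans)
  qed
  then show ?thesis unfolding address_def by (simp add: Cauchy_convergent_iff convergent_LIMSEQ_iff)
qed

lemma address_in_K:
  assumes "t \<in> {0..<mass u}" shows "address u t \<in> K"
  by (rule closed_sequentially[OF closed_K _ address_tendsto[OF assms]]) (rule locate_in_K[OF assms])

lemma address_psi:
  assumes "i \<in> S" "t \<in> interval i u"
  shows "address u t = psi p i (address (branch i u) (t - offset i u))"
proof (rule LIMSEQ_unique)
  have "t \<in> {0..<mass u}" using interval_subset[OF assms(1)] assms(2) by blast
  then show "(\<lambda>n. locate (Suc n) u t) \<longlonglongrightarrow> address u t"
    by (intro LIMSEQ_Suc address_tendsto)
  have "(\<lambda>n. locate n (branch i u) (t - offset i u)) \<longlonglongrightarrow> address (branch i u) (t - offset i u)"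
    using assms by (intro address_tendsto) (simp add: interval_shift)
  then show "(\<lambda>n. locate (Suc n) u t) \<longlonglongrightarrow> psi p i (address (branch i u) (t - offset i u))"
    unfolding locate_Suc[OF assms] psi_def by (intro tendsto_intros)
qed

definition nu :: "(nat \<Rightarrow> real) \<Rightarrow> 'a measure" where
  "nu u = distr (restrict_space lborel {0..<mass u}) borel (address u)"

lemma address_measurable_restrict [measurable]:
  "address u \<in> measurable (restrict_space lborel A) borel"
  by (intro measurable_restrict_space1) simp

lemma space_nu [simp]: "space (nu u) = UNIV" and sets_nu [simp, measurable_cong]: "sets (nu u) = sets borel"
  by (simp_all add: nu_def)

lemma emeasure_nu_space: "emeasure (nu u) UNIV = ennreal (mass u)"
proof -
  have "emeasure (nu u) UNIV
      = emeasure (restrict_space lborel {0..<mass u}) (space (restrict_space lborel {0..<mass u}))"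
    unfolding nu_def by (subst emeasure_distr) auto
  also have "\<dots> = ennreal (mass u)"
    by (subst emeasure_restrict_space) (auto simp: space_restrict_space mass_nonneg)
  finally show ?thesis .
qed

lemma finite_measure_nu: "finite_measure (nu u)"
  by (rule finite_measureI) (simp add: emeasure_nu_space)

lemma measure_nu_space: "measure (nu u) UNIV = mass u"
  by (simp add: measure_def emeasure_nu_space mass_nonneg)

lemma K_borel [measurable]: "K \<in> sets borel"
  using closed_K by (rule borel_closed)

lemma AE_nu_in_K: "AE x in nu u. x \<in> K"
  unfolding nu_def
  by (subst AE_distr_iff) (auto simp: AE_restrict_space_iff address_in_K)

lemma integrable_nu:
  assumes "f \<in> borel_measurable borel" "\<And>x. x \<in> K \<Longrightarrow> \<bar>f x :: real\<bar> \<le> b"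
  shows "integrable (nu u) f"
proof -
  have "AE x in nu u. norm (f x) \<le> b"
    using AE_nu_in_K by (rule AE_mp) (use assms in auto)
  moreover have "f \<in> borel_measurable (nu u)"
    using assms(1) by (simp cong: measurable_cong_sets)
  ultimately show ?thesis
    using finite_measure.integrable_const_bound[OF finite_measure_nu] by blast
qed

lemma integral_nu:
  fixes f :: "'a \<Rightarrow> real"
  assumes [measurable]: "f \<in> borel_measurable borel"
  shows "(\<integral>x. f x \<partial>nu u) = (\<integral>t. indicator {0..<mass u} t * f (address u t) \<partial>lborel)"
  unfolding nu_def
  by (subst integral_distr) (auto simp: integral_restrict_space)

text \<open>
  Translation invariance of Lebesgue measure turns each piece of the partition into the interval
  that belongs to the branch.
\<close>

lemma nu_self_similar:
  fixes f :: "'a \<Rightarrow> real"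
  assumes [measurable]: "f \<in> borel_measurable borel" and bound: "\<And>x. \<bar>f x\<bar> \<le> b"
  shows "(\<integral>x. f x \<partial>nu u) = (\<Sum>i\<in>S. \<integral>x. f (psi p i x) \<partial>nu (branch i u))"
proof -
  let ?g = "\<lambda>i t. indicator (interval i u) t * f (psi p i (address (branch i u) (t - offset i u)))"
  have "(\<integral>x. f x \<partial>nu u) = (\<integral>t. (\<Sum>i\<in>S. ?g i t) \<partial>lborel)"
    unfolding integral_nu[OF assms(1)]
  proof (intro Bochner_Integration.integral_cong refl)
    fix t
    show "indicator {0..<mass u} t * f (address u t) = (\<Sum>i\<in>S. ?g i t)"
    proof (cases "t \<in> {0..<mass u}")
      case True
      obtain i where i: "i \<in> S" "t \<in> interval i u" using interval_cover[OF True] .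
      have "(\<Sum>i\<in>S. ?g i t) = f (psi p i (address (branch i u) (t - offset i u)))"
        using interval_sum[OF i, of "\<lambda>i. f (psi p i (address (branch i u) (t - offset i u)))"] by simp
      then show ?thesis using True address_psi[OF i] by simp
    next
      case False
      then have "?g i t = 0" if "i \<in> S" for i
        using interval_subset[OF that, of u] by (auto simp: indicator_def)
      then have "(\<Sum>i\<in>S. ?g i t) = 0" by (intro sum.neutral ballI)
      then show ?thesis using False by simp
    qed
  qed
  also have "\<dots> = (\<Sum>i\<in>S. \<integral>t. ?g i t \<partial>lborel)"
  proof (rule Bochner_Integration.integral_sum)
    fix i
    have "integrable lborel (\<lambda>t. indicator (interval i u) t *\<^sub>R f (psi p i (address (branch i u) (t - offset i u))))"
      by (rule integrableI_bounded_set_indicator[where B = b]) (auto simp: bound interval_def mass_nonneg)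
    then show "integrable lborel (?g i)" by simp
  qed
  also have "\<dots> = (\<Sum>i\<in>S. \<integral>x. f (psi p i x) \<partial>nu (branch i u))"
  proof (intro sum.cong refl)
    fix i
    have "(\<integral>t. ?g i t \<partial>lborel) = (\<integral>t. ?g i (offset i u + t) \<partial>lborel)"
      using lborel_integral_real_affine[of 1 "?g i" "offset i u"] by simp
    also have "\<dots> = (\<integral>t. indicator {0..<mass (branch i u)} t * f (psi p i (address (branch i u) t)) \<partial>lborel)"
      by (intro Bochner_Integration.integral_cong refl) (auto simp: indicator_def interval_def)
    also have "\<dots> = (\<integral>x. f (psi p i x) \<partial>nu (branch i u))"
      by (subst integral_nu) auto
    finally show "(\<integral>t. ?g i t \<partial>lborel) = (\<integral>x. f (psi p i x) \<partial>nu (branch i u))" .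
  qed
  finally show ?thesis .
qed

lemma measure_nu_self_similar:
  assumes [measurable]: "A \<in> sets borel"
  shows "measure (nu u) A = (\<Sum>i\<in>S. measure (nu (branch i u)) (psi p i -` A))"
proof -
  have "measure (nu u) A = (\<integral>x. indicator A x \<partial>nu u)" by simp
  also have "\<dots> = (\<Sum>i\<in>S. \<integral>x. indicator A (psi p i x) \<partial>nu (branch i u))"
    by (rule nu_self_similar[where b = 1]) (auto simp: indicator_def)
  also have "\<dots> = (\<Sum>i\<in>S. measure (nu (branch i u)) (psi p i -` A))"
    by (simp add: indicator_vimage[symmetric])
  finally show ?thesis .
qed

lemma measure_nu_Int_K:
  assumes "A \<in> sets borel" "B \<in> sets borel" "A \<inter> K = B \<inter> K"
  shows "measure (nu u) A = measure (nu u) B"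
proof (rule finite_measure.finite_measure_eq_AE[OF finite_measure_nu])
  show "AE x in nu u. x \<in> A \<longleftrightarrow> x \<in> B"
    using AE_nu_in_K by eventually_elim (use assms(3) in blast)
qed (use assms in simp_all)

lemma measure_nu_mono:
  assumes "A \<in> sets borel" "B \<in> sets borel" "A \<inter> K \<subseteq> B"
  shows "measure (nu u) A \<le> measure (nu u) B"
proof (rule finite_measure.finite_measure_mono_AE[OF finite_measure_nu])
  show "AE x in nu u. x \<in> A \<longrightarrow> x \<in> B"
    using AE_nu_in_K by eventually_elim (use assms(3) in blast)
qed (use assms in simp)

lemma psi_vimage_borel [measurable]: "A \<in> sets borel \<Longrightarrow> psi p i -` A \<in> sets borel"
  using measurable_sets[OF psi_measurable, of A i] by simp

text \<open>
  The cells that shrink to a vertex have masses that decrease at least by the factor \<open>shrink\<close>.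
\<close>

lemma measure_nu_vertex:
  assumes "j \<in> S" shows "measure (nu u) {p j} = 0"
proof -
  have "measure (nu u) {p j} \<le> shrink ^ n * mass u" for n
  proof (induction n arbitrary: u)
    case 0
    have "measure (nu u) {p j} \<le> measure (nu u) UNIV" by (rule measure_nu_mono) auto
    then show ?case by (simp add: measure_nu_space)
  next
    case (Suc n)
    have "measure (nu (branch i u)) (psi p i -` {p j}) = (if i = j then measure (nu (branch j u)) {p j} else 0)"
      if "i \<in> S" for i
    proof -
      have "psi p i -` {p j} \<inter> K = (if i = j then {p j} else {}) \<inter> K"
        using vertex_only_in_own_cell[OF that assms] by auto
      then have "measure (nu (branch i u)) (psi p i -` {p j})
          = measure (nu (branch i u)) (if i = j then {p j} else {})"
        by (intro measure_nu_Int_K) auto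
      then show ?thesis by auto
    qed
    then have "measure (nu u) {p j} = measure (nu (branch j u)) {p j}"
      using assms by (subst measure_nu_self_similar) auto
    also have "\<dots> \<le> shrink ^ n * mass (branch j u)" by (rule Suc)
    also have "\<dots> \<le> shrink ^ n * (shrink * mass u)"
      using shrink assms by (intro mult_left_mono mass_branch_le) auto
    finally show ?case by (simp add: mult_ac)
  qed
  moreover have "(\<lambda>n. shrink ^ n * mass u) \<longlonglongrightarrow> 0"
    using shrink by (intro tendsto_mult_left_zero LIMSEQ_realpow_zero) auto
  ultimately have "measure (nu u) {p j} \<le> 0" by (intro LIMSEQ_le_const) auto
  then show ?thesis by (simp add: measure_le_0_iff)
qed

text \<open>
  The branches \<open>l \<noteq> i\<close> contribute only a vertex, which is a null set.
\<close>

lemma measure_nu_psi_image: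
  assumes "i \<in> S" "compact B" "B \<subseteq> K"
  shows "measure (nu u) (psi p i ` B) = measure (nu (branch i u)) B"
proof -
  have "compact (psi p i ` B)" by (intro compact_continuous_image continuous_intros assms)
  then have meas: "psi p i ` B \<in> sets borel" "B \<in> sets borel"
    using assms compact_imp_closed borel_closed by blast+
  have "measure (nu (branch l u)) (psi p l -` (psi p i ` B))
      = (if l = i then measure (nu (branch i u)) B else 0)" if "l \<in> S" for l
  proof (cases "l = i")
    case True
    have "psi p i -` (psi p i ` B) = B" by auto
    then show ?thesis using True by simp
  next
    case False
    have "psi p l -` (psi p i ` B) \<inter> K \<subseteq> {p i}"
      using junction(1)[OF that assms(1) False] assms(3) by fastforce
    then have "measure (nu (branch l u)) (psi p l -` (psi p i ` B)) \<le> measure (nu (branch l u)) {p i}"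
      using meas by (intro measure_nu_mono) auto
    then show ?thesis using False measure_nu_vertex[OF assms(1)] by (simp add: measure_le_0_iff)
  qed
  then show ?thesis using assms(1) meas by (subst measure_nu_self_similar) auto
qed

lemma compact_cell: "compact (cell p w)"
proof -
  have "continuous_on A (psi_word p w)" for A
    by (induction w) (auto simp: comp_def intro!: continuous_intros)
  then show ?thesis unfolding cell_def by (intro compact_continuous_image compact_K)
qed

lemma cell_subset_K: "set w \<subseteq> S \<Longrightarrow> cell p w \<subseteq> K"
  unfolding cell_def by auto

lemma measure_nu_cell:
  "set w \<subseteq> S \<Longrightarrow> measure (nu u) (cell p w) = mass (fold branch w u)"
proof (induction w arbitrary: u)
  case Nil
  have "measure (nu u) K = measure (nu u) UNIV" by (rule measure_nu_Int_K) auto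
  then show ?case by (simp add: cell_def measure_nu_space)
next
  case (Cons i w)
  have "cell p (i # w) = psi p i ` cell p w" by (simp add: cell_def image_image)
  then show ?case
    using Cons by (simp add: measure_nu_psi_image compact_cell cell_subset_K)
qed

lemma mass_fold_branch: "mass (fold branch w u) = renorm ^ length w * (2 * dirichlet S (fold (extend S) w u))"
proof -
  have "fold branch w u = (\<lambda>k. sqrt renorm ^ length w * fold (extend S) w u k)"
  proof (induction w arbitrary: u)
    case (Cons i w)
    have "fold branch (i # w) u = (\<lambda>k. sqrt renorm ^ length w * fold (extend S) w (branch i u) k)"
      by (simp only: fold_simps Cons)
    also have "fold (extend S) w (branch i u) = (\<lambda>k. sqrt renorm * fold (extend S) w (extend S i u) k)"
      unfolding branch_def by (rule fold_extend_scale)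
    finally show ?case by (simp add: mult_ac)
  qed simp
  moreover have "(sqrt renorm ^ length w)\<^sup>2 = renorm ^ length w"
    using renorm_pos by (simp add: power2_eq_square flip: power_mult_distrib)
  ultimately show ?thesis by (simp add: mass_def dirichlet_scale)
qed

lemma sum_mass_words: "(\<Sum>w\<in>word_set m. mass (fold branch w u)) = mass u"
proof (induction m arbitrary: u)
  case 0
  show ?case unfolding word_set_0 by simp
next
  case (Suc m)
  show ?case unfolding sum_word_set_Suc by (simp add: Suc sum_mass_branch)
qed

end

section \<open>Energy measures and the Kusuoka measure\<close>

lemma integral_close:
  fixes f g :: "'a \<Rightarrow> real"
  assumes "integrable M f" "integrable M g" "finite_measure M"
    and "\<And>x. x \<in> space M \<Longrightarrow> \<bar>f x - g x\<bar> < e"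
  shows "\<bar>(\<integral>x. f x \<partial>M) - (\<integral>x. g x \<partial>M)\<bar> \<le> e * measure M (space M)"
proof -
  interpret finite_measure M by fact
  have "\<bar>(\<integral>x. f x \<partial>M) - (\<integral>x. g x \<partial>M)\<bar> = \<bar>\<integral>x. f x - g x \<partial>M\<bar>"
    using assms(1,2) by simp
  also have "\<dots> \<le> (\<integral>x. \<bar>f x - g x\<bar> \<partial>M)" by (rule integral_abs_bound)
  also have "\<dots> \<le> (\<integral>x. e \<partial>M)"
    using assms by (intro integral_mono integrable_abs Bochner_Integration.integrable_diff)
      (auto simp: less_imp_le)
  finally show ?thesis by (simp add: mult.commute)
qed

context simplex_gasket begin

text \<open>
  The measure gives each cell of level \<open>m\<close> the mass of its branch, so a function that is nearly
  constant on these cells is integrated like a step function.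
\<close>

lemma integral_nu_near_sum:
  fixes f :: "'a \<Rightarrow> real"
  assumes "f \<in> borel_measurable borel" "\<And>x. \<bar>f x\<bar> \<le> b"
    and "\<And>w x. w \<in> word_set m \<Longrightarrow> x \<in> K \<Longrightarrow> \<bar>f (psi_word p w x) - c w\<bar> \<le> e"
  shows "\<bar>(\<integral>x. f x \<partial>nu u) - (\<Sum>w\<in>word_set m. c w * mass (fold branch w u))\<bar> \<le> e * mass u"
  using assms
proof (induction m arbitrary: u f c)
  case 0
  have near: "\<bar>f x - c []\<bar> \<le> e" if "x \<in> K" for x using 0(3)[of "[]" x] that by simp
  have int: "integrable (nu u) f" using 0(1,2) by (rule integrable_nu)
  have const: "integrable (nu u) (\<lambda>x. a)" for a :: real
    by (rule integrable_nu[where b = "\<bar>a\<bar>"]) auto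
  have "(\<integral>x. f x \<partial>nu u) - c [] * mass u = (\<integral>x. f x - c [] \<partial>nu u)"
    using int const by (simp add: measure_nu_space mult.commute)
  also have "\<bar>\<dots>\<bar> \<le> (\<integral>x. \<bar>f x - c []\<bar> \<partial>nu u)" by (rule integral_abs_bound)
  also have "\<dots> \<le> (\<integral>x. e \<partial>nu u)"
  proof (rule integral_mono_AE)
    show "AE x in nu u. \<bar>f x - c []\<bar> \<le> e" using AE_nu_in_K by eventually_elim (rule near)
  qed (use int const in auto)
  also have "\<dots> = e * mass u" by (simp add: measure_nu_space mult.commute)
  finally show ?case unfolding word_set_0 by simp
next
  case (Suc m)
  let ?s = "\<lambda>i. \<Sum>w\<in>word_set m. c (i # w) * mass (fold branch w (branch i u))"
  have "\<bar>(\<integral>x. f (psi p i x) \<partial>nu (branch i u)) - ?s i\<bar> \<le> e * mass (branch i u)" if "i \<in> S" for i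
  proof (rule Suc.IH)
    show "(\<lambda>x. f (psi p i x)) \<in> borel_measurable borel" using Suc.prems(1) by measurable
    show "\<bar>f (psi p i (psi_word p w x)) - c (i # w)\<bar> \<le> e" if "w \<in> word_set m" "x \<in> K" for w x
      using Suc.prems(3)[of "i # w" x] that \<open>i \<in> S\<close> by simp
  qed (rule Suc.prems(2))
  then have "(\<Sum>i\<in>S. \<bar>(\<integral>x. f (psi p i x) \<partial>nu (branch i u)) - ?s i\<bar>) \<le> (\<Sum>i\<in>S. e * mass (branch i u))"
    by (rule sum_mono)
  then have "\<bar>\<Sum>i\<in>S. (\<integral>x. f (psi p i x) \<partial>nu (branch i u)) - ?s i\<bar> \<le> e * mass u"
    by (intro order_trans[OF sum_abs]) (simp add: sum_mass_branch flip: sum_distrib_left)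
  then show ?case
    unfolding sum_word_set_Suc nu_self_similar[OF Suc.prems(1,2)]
    by (simp add: sum_subtractf)
qed

text \<open>
  The discrete energy measure of level \<open>m\<close> has the same cell masses as \<open>nu u\<close>, hence the same limit of
  integrals.
\<close>

lemma level_mass_near_sum:
  assumes h: "\<And>x. x \<in> K \<Longrightarrow> h x = harmonic_ext u x"
    and g: "\<And>w x. w \<in> word_set m \<Longrightarrow> x \<in> K \<Longrightarrow> \<bar>g (psi_word p w x) - c w\<bar> \<le> e"
  shows "\<bar>level_mass m h g - (\<Sum>w\<in>word_set m. c w * mass (fold branch w u))\<bar> \<le> e * mass u"
proof -
  let ?W = "\<lambda>w. renorm ^ m * weighted_dirichlet S (\<lambda>k. h (psi_word p w (p k))) (\<lambda>k. g (psi_word p w (p k)))"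
  have "\<bar>?W w - c w * mass (fold branch w u)\<bar> \<le> e * mass (fold branch w u)" if w: "w \<in> word_set m" for w
  proof -
    have "h (psi_word p w (p k)) = fold (extend S) w u k" if "k \<in> S" for k
    proof -
      have "h (psi_word p w (p k)) = harmonic_ext u (psi_word p w (p k))"
        using w that by (intro h) auto
      also have "\<dots> = harmonic_ext (fold (extend S) w u) (p k)"
        using w that by (intro harmonic_ext_psi_word) auto
      finally show ?thesis using that by (simp add: harmonic_ext_vertex)
    qed
    then have W: "?W w = renorm ^ m * weighted_dirichlet S (fold (extend S) w u) (\<lambda>k. g (psi_word p w (p k)))"
      by (intro arg_cong2[where f = "(*)"] refl weighted_dirichlet_cong)
    have M: "mass (fold branch w u) = renorm ^ m * (2 * dirichlet S (fold (extend S) w u))"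
      using w by (simp add: mass_fold_branch)
    have "\<bar>weighted_dirichlet S (fold (extend S) w u) (\<lambda>k. g (psi_word p w (p k)))
        - c w * (2 * dirichlet S (fold (extend S) w u))\<bar> \<le> e * (2 * dirichlet S (fold (extend S) w u))"
      using w by (intro weighted_dirichlet_near_constant g) auto
    from mult_left_mono[OF this, of "renorm ^ m"] renorm_pos
    have "renorm ^ m * \<bar>weighted_dirichlet S (fold (extend S) w u) (\<lambda>k. g (psi_word p w (p k)))
        - c w * (2 * dirichlet S (fold (extend S) w u))\<bar>
        \<le> renorm ^ m * (e * (2 * dirichlet S (fold (extend S) w u)))" by simp
    moreover have "renorm ^ m * \<bar>weighted_dirichlet S (fold (extend S) w u) (\<lambda>k. g (psi_word p w (p k)))
        - c w * (2 * dirichlet S (fold (extend S) w u))\<bar>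
        = \<bar>renorm ^ m * (weighted_dirichlet S (fold (extend S) w u) (\<lambda>k. g (psi_word p w (p k)))
        - c w * (2 * dirichlet S (fold (extend S) w u)))\<bar>"
      using renorm_pos by (simp add: abs_mult)
    moreover have "renorm ^ m * (weighted_dirichlet S (fold (extend S) w u) (\<lambda>k. g (psi_word p w (p k)))
        - c w * (2 * dirichlet S (fold (extend S) w u))) = ?W w - c w * mass (fold branch w u)"
      unfolding W M by (simp add: algebra_simps)
    ultimately show ?thesis unfolding M by (simp add: mult_ac)
  qed
  then have "(\<Sum>w\<in>word_set m. \<bar>?W w - c w * mass (fold branch w u)\<bar>)
      \<le> (\<Sum>w\<in>word_set m. e * mass (fold branch w u))" by (rule sum_mono)
  also have "\<dots> = e * mass u" by (simp add: sum_mass_words flip: sum_distrib_left)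
  finally have "\<bar>\<Sum>w\<in>word_set m. ?W w - c w * mass (fold branch w u)\<bar> \<le> e * mass u"
    using sum_abs[of "\<lambda>w. ?W w - c w * mass (fold branch w u)" "word_set m"] by linarith
  then show ?thesis by (simp only: level_mass_def sum_subtractf sum_distrib_left)
qed

lemma cells_uniformly_small:
  assumes "continuous_on K (g :: 'a \<Rightarrow> real)" "e > 0"
  obtains m where "\<And>n w x y. m \<le> n \<Longrightarrow> w \<in> word_set n \<Longrightarrow> x \<in> K \<Longrightarrow> y \<in> K \<Longrightarrow>
     \<bar>g (psi_word p w x) - g (psi_word p w y)\<bar> \<le> e"
proof -
  obtain d where d: "d > 0" "\<And>x y. x \<in> K \<Longrightarrow> y \<in> K \<Longrightarrow> dist y x < d \<Longrightarrow> dist (g y) (g x) < e"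
    using compact_uniformly_continuous[OF assms(1) compact_K] assms(2)
    unfolding uniformly_continuous_on_def by meson
  from order_tendstoD(2)[OF half_power_tendsto_0 d(1)]
  obtain m where m: "\<And>n. m \<le> n \<Longrightarrow> (1/2) ^ n * gasket_diameter < d"
    unfolding eventually_sequentially by blast
  show thesis
  proof (rule that)
    fix n w x y assume *: "m \<le> n" "w \<in> word_set n" "x \<in> K" "y \<in> K"
    have "dist (psi_word p w x) (psi_word p w y) = (1/2) ^ n * dist x y"
      using * by (simp add: dist_psi_word)
    also have "\<dots> \<le> (1/2) ^ n * gasket_diameter"
      using * by (intro mult_left_mono gasket_diameter) auto
    also have "\<dots> < d" using m *(1) by blast
    finally have "dist (g (psi_word p w x)) (g (psi_word p w y)) < e"
      using * by (intro d(2)) auto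
    then show "\<bar>g (psi_word p w x) - g (psi_word p w y)\<bar> \<le> e" by (simp add: dist_real_def)
  qed
qed

lemma indicator_times_continuous_measurable:
  assumes "continuous_on K (g :: 'a \<Rightarrow> real)"
  shows "(\<lambda>x. indicator K x *\<^sub>R g x) \<in> borel_measurable borel"
  using borel_measurable_continuous_on_indicator[OF K_borel assms] .

lemma level_mass_tendsto_integral:
  assumes h: "\<And>x. x \<in> K \<Longrightarrow> h x = harmonic_ext u x" and g: "continuous_on K g"
  shows "(\<lambda>m. level_mass m h g) \<longlonglongrightarrow> (\<integral>x. indicator K x *\<^sub>R g x \<partial>nu u)"
proof (rule LIMSEQ_I)
  fix r :: real assume r: "r > 0"
  obtain b where b: "\<And>x. x \<in> K \<Longrightarrow> \<bar>g x\<bar> \<le> b" using continuous_on_K_bounded[OF g] by blast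
  have bnd: "\<bar>indicator K x *\<^sub>R g x\<bar> \<le> \<bar>b\<bar>" for x using b[of x] by (auto simp: indicator_def)
  \<comment> \<open>Two errors of size \<open>e * mass u\<close> occur; the summand \<open>1\<close> covers \<open>mass u = 0\<close>.\<close>
  define e where "e = r / (2 * mass u + 1)"
  have e: "e > 0" "2 * (e * mass u) < r"
    using r mass_nonneg[of u] by (auto simp: e_def divide_simps add_pos_nonneg add_nonneg_pos)
  obtain m where m: "\<And>n w x y. m \<le> n \<Longrightarrow> w \<in> word_set n \<Longrightarrow> x \<in> K \<Longrightarrow> y \<in> K \<Longrightarrow>
     \<bar>g (psi_word p w x) - g (psi_word p w y)\<bar> \<le> e" using cells_uniformly_small[OF g e(1)] by blast
  show "\<exists>m. \<forall>n\<ge>m. norm (level_mass n h g - (\<integral>x. indicator K x *\<^sub>R g x \<partial>nu u)) < r"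
  proof (intro exI[of _ m] allI impI)
    fix n assume n: "m \<le> n"
    let ?s = "\<Sum>w\<in>word_set n. g (psi_word p w (p 1)) * mass (fold branch w u)"
    have near: "\<bar>g (psi_word p w x) - g (psi_word p w (p 1))\<bar> \<le> e" if "w \<in> word_set n" "x \<in> K" for w x
      using m[OF n that] by blast
    have "\<bar>level_mass n h g - ?s\<bar> \<le> e * mass u"
      by (rule level_mass_near_sum[where h = h and g = g and c = "\<lambda>w. g (psi_word p w (p 1))"])
         (use h near in blast)+
    moreover have "\<bar>(\<integral>x. indicator K x *\<^sub>R g x \<partial>nu u) - ?s\<bar> \<le> e * mass u"
    proof (rule integral_nu_near_sum[OF indicator_times_continuous_measurable[OF g] bnd])
      fix w x assume wx: "w \<in> word_set n" "x \<in> K"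
      then have "psi_word p w x \<in> K" by auto
      then show "\<bar>indicator K (psi_word p w x) *\<^sub>R g (psi_word p w x) - g (psi_word p w (p 1))\<bar> \<le> e"
        using near[OF wx] by simp
    qed
    ultimately show "norm (level_mass n h g - (\<integral>x. indicator K x *\<^sub>R g x \<partial>nu u)) < r"
      using e(2) by (simp add: abs_le_iff abs_less_iff)
  qed
qed

lemma space_Int_K: "K \<inter> space (nu u) \<in> sets (nu u)" by simp

lemma energy_measure_candidate:
  assumes h: "\<And>x. x \<in> K \<Longrightarrow> h x = harmonic_ext u x" "h \<in> energy_dom p" and g: "g \<in> energy_dom p"
  shows "integrable (restrict_space (nu u) K) g"
    and "(\<integral>x. g x \<partial>restrict_space (nu u) K)
       = 2 * energy_form p h (\<lambda>x. h x * g x) - energy_form p (\<lambda>x. (h x)\<^sup>2) g"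
proof -
  have cont: "continuous_on K g" using g by (rule energy_dom_continuous)
  obtain b where b: "\<And>x. x \<in> K \<Longrightarrow> \<bar>g x\<bar> \<le> b" using continuous_on_K_bounded[OF cont] by blast
  show "integrable (restrict_space (nu u) K) g"
    unfolding integrable_restrict_space[OF space_Int_K]
    by (rule integrable_nu[OF indicator_times_continuous_measurable[OF cont]]) (use b in auto)
  show "(\<integral>x. g x \<partial>restrict_space (nu u) K)
       = 2 * energy_form p h (\<lambda>x. h x * g x) - energy_form p (\<lambda>x. (h x)\<^sup>2) g"
    unfolding integral_restrict_space[OF space_Int_K]
    by (rule LIMSEQ_unique[OF level_mass_tendsto_integral[OF h(1) cont] level_mass_tendsto[OF h(2) g]])
qed

interpretation energy_ring: function_ring_on "energy_dom p" K
proof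
  show "\<exists>f\<in>energy_dom p. f x \<noteq> f y" if "x \<in> K" "y \<in> K" "x \<noteq> y" for x y
    using harmonic_ext_separates_points[OF that] harmonic_ext_in_energy_dom by metis
qed (auto intro: compact_K energy_dom_continuous energy_dom_add energy_dom_mult energy_dom_const)

text \<open>
  Constants have finite energy.
\<close>

lemma finite_measure_of_integrable_dom:
  assumes "\<And>g. g \<in> energy_dom p \<Longrightarrow> integrable M g"
  shows "finite_measure M"
proof -
  have "integrable M (\<lambda>_. 1::real)" using assms energy_dom_const by blast
  then have "emeasure M (space M) < \<infinity>" by (simp add: integrable_iff_bounded)
  then show ?thesis by (intro finite_measureI) auto
qed

text \<open>
  Integrals of continuous functions agree by uniform approximation. Continuous functions decrease
  to the indicators of closed sets, and these generate the Borel sets.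
\<close>

lemma measure_eq_if_energy_integrals_eq:
  assumes sets: "sets M = sets (restrict_space borel K)" "sets M' = sets (restrict_space borel K)"
    and M: "\<And>g. g \<in> energy_dom p \<Longrightarrow> integrable M g"
    and M': "\<And>g. g \<in> energy_dom p \<Longrightarrow> integrable M' g"
    and eq: "\<And>g. g \<in> energy_dom p \<Longrightarrow> (\<integral>x. g x \<partial>M) = (\<integral>x. g x \<partial>M')"
  shows "M = M'"
proof -
  have space: "space M = K" "space M' = K"
    using sets_eq_imp_space_eq[OF sets(1)] sets_eq_imp_space_eq[OF sets(2)]
    by (auto simp: space_restrict_space)
  interpret M: finite_measure M using finite_measure_of_integrable_dom M by blast
  interpret M': finite_measure M' using finite_measure_of_integrable_dom M' by blast
  have meas: "f \<in> borel_measurable M" "f \<in> borel_measurable M'" if "continuous_on K f" for f :: "'a \<Rightarrow> real"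
    using borel_measurable_continuous_on_restrict[OF that] sets
    by (auto cong: measurable_cong_sets)
  have int: "integrable M f" "integrable M' f" if f: "continuous_on K f" for f :: "'a \<Rightarrow> real"
  proof -
    obtain b where "\<And>x. x \<in> K \<Longrightarrow> \<bar>f x\<bar> \<le> b" using continuous_on_K_bounded[OF f] by blast
    then show "integrable M f" "integrable M' f"
      using meas[OF f]
      by (auto intro!: M.integrable_const_bound[of _ b] M'.integrable_const_bound[of _ b] AE_I2 simp: space)
  qed
  have cont: "(\<integral>x. f x \<partial>M) = (\<integral>x. f x \<partial>M')" if f: "continuous_on K f" for f :: "'a \<Rightarrow> real"
  proof (rule ccontr)
    let ?t = "measure M K + measure M' K"
    assume ne: "(\<integral>x. f x \<partial>M) \<noteq> (\<integral>x. f x \<partial>M')"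
    define e where "e = \<bar>(\<integral>x. f x \<partial>M) - (\<integral>x. f x \<partial>M')\<bar> / (?t + 1)"
    have t: "?t \<ge> 0" by simp
    have tpos: "?t + 1 > 0" using t by linarith
    then have e: "e > 0" unfolding e_def using ne by (intro divide_pos_pos) auto
    obtain g where g: "g \<in> energy_dom p" "\<And>x. x \<in> K \<Longrightarrow> \<bar>f x - g x\<bar> < e"
      using energy_ring.Stone_Weierstrass_basic[OF f e] by blast
    have gc: "continuous_on K g" using g(1) by (rule energy_dom_continuous)
    have "\<bar>(\<integral>x. f x \<partial>M) - (\<integral>x. g x \<partial>M)\<bar> \<le> e * measure M K"
      using integral_close[OF int(1)[OF f] int(1)[OF gc], of e] g(2)
      by (simp add: space M.finite_measure_axioms)
    moreover have "\<bar>(\<integral>x. f x \<partial>M') - (\<integral>x. g x \<partial>M')\<bar> \<le> e * measure M' K"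
      using integral_close[OF int(2)[OF f] int(2)[OF gc], of e] g(2)
      by (simp add: space M'.finite_measure_axioms)
    ultimately have "\<bar>(\<integral>x. f x \<partial>M) - (\<integral>x. f x \<partial>M')\<bar> \<le> e * ?t"
      using eq[OF g(1)] by (simp add: distrib_left)
    also have "\<dots> < e * (?t + 1)" using e by simp
    also have "\<dots> = \<bar>(\<integral>x. f x \<partial>M) - (\<integral>x. f x \<partial>M')\<bar>" using tpos by (simp add: e_def)
    finally show False by simp
  qed
  have K_in: "A \<inter> K \<in> sets M" "A \<inter> K \<in> sets M'" if "A \<in> sets borel" for A
    using that sets by (auto simp: sets_restrict_space)
  have closed_eq: "measure M (C \<inter> K) = measure M' (C \<inter> K)" if C: "closed C" for C
  proof (cases "C = {}")
    case False
    \<comment> \<open>Continuous, equal to \<open>1\<close> on \<open>C\<close>, and eventually \<open>0\<close> at every point outside \<open>C\<close>.\<close>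
    define g where "g n x = max 0 (1 - real n * infdist x C)" for n x
    have gc: "continuous_on K (g n)" for n
      unfolding g_def by (intro continuous_intros)
    have lim: "(\<lambda>n. g n x) \<longlonglongrightarrow> indicator C x" for x
    proof (cases "x \<in> C")
      case True
      then show ?thesis by (simp add: g_def)
    next
      case False
      then have pos: "infdist x C > 0"
        using C \<open>C \<noteq> {}\<close> by (simp add: infdist_pos_not_in_closed)
      obtain N where N: "1 / infdist x C \<le> real N" using real_arch_simple by blast
      have "g n x = 0" if "n \<ge> N" for n
      proof -
        have "1 \<le> real N * infdist x C" using N pos by (simp add: divide_simps)
        also have "\<dots> \<le> real n * infdist x C" using that pos by (intro mult_right_mono) auto
        finally show ?thesis by (simp add: g_def)
      qed
      then have "\<forall>\<^sub>F n in sequentially. g n x = indicator C x"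
        using False unfolding eventually_sequentially by auto
      then show ?thesis by (rule tendsto_eventually)
    qed
    have g01: "\<bar>g n x\<bar> \<le> 1" for n x
      using infdist_nonneg[of x C] by (auto simp: g_def)
    have ind: "(\<lambda>x. indicator C x :: real) \<in> borel_measurable M"
        "(\<lambda>x. indicator C x :: real) \<in> borel_measurable M'"
      using K_in[OF borel_closed[OF C]] by (simp_all add: borel_measurable_indicator_iff space)
    have "(\<lambda>n. \<integral>x. g n x \<partial>M) \<longlonglongrightarrow> (\<integral>x. indicator C x \<partial>M)"
      by (rule integral_dominated_convergence[where w = "\<lambda>_. 1"])
         (use ind meas[OF gc] lim g01 in auto)
    moreover have "(\<lambda>n. \<integral>x. g n x \<partial>M') \<longlonglongrightarrow> (\<integral>x. indicator C x \<partial>M')"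
      by (rule integral_dominated_convergence[where w = "\<lambda>_. 1"])
         (use ind meas[OF gc] lim g01 in auto)
    ultimately have "(\<integral>x. indicator C x \<partial>M) = (\<integral>x. indicator C x \<partial>M' :: real)"
      unfolding cont[OF gc] by (rule LIMSEQ_unique)
    then show ?thesis by (simp add: space)
  qed simp
  have id_meas: "(\<lambda>x. x) \<in> measurable M borel" "(\<lambda>x. x) \<in> measurable M' borel"
    using K_in space by (auto intro!: measurableI)
  have "distr M borel (\<lambda>x. x) = distr M' borel (\<lambda>x. x)"
  proof (rule measure_eqI_generator_eq[where E = "Collect closed" and \<Omega> = UNIV and A = "\<lambda>_. UNIV"])
    show "Int_stable (Collect (closed :: 'a set \<Rightarrow> bool))"
      by (auto simp: Int_stable_def)
    fix C :: "'a set" assume "C \<in> Collect closed"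
    then show "emeasure (distr M borel (\<lambda>x. x)) C = emeasure (distr M' borel (\<lambda>x. x)) C"
      using closed_eq[of C]
      by (simp add: emeasure_distr[OF id_meas(1)] emeasure_distr[OF id_meas(2)] space
          M.emeasure_eq_measure M'.emeasure_eq_measure)
  next
    show "emeasure (distr M borel (\<lambda>x. x)) UNIV \<noteq> \<infinity>"
      by (simp add: emeasure_distr[OF id_meas(1)] space M.emeasure_eq_measure)
  qed (auto simp: borel_eq_closed)
  then have emeq: "emeasure (distr M borel (\<lambda>x. x)) A = emeasure (distr M' borel (\<lambda>x. x)) A" for A
    by simp
  show "M = M'"
  proof (rule measure_eqI)
    show "sets M = sets M'" using sets by simp
    fix A assume "A \<in> sets M"
    then obtain B where B: "B \<in> sets borel" "A = K \<inter> B"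
      using sets(1) by (auto simp: sets_restrict_space)
    show "emeasure M A = emeasure M' A"
      using emeq[of B] B
      by (simp add: emeasure_distr[OF id_meas(1)] emeasure_distr[OF id_meas(2)] space Int_commute)
  qed
qed

lemma energy_measure_eq:
  assumes "h \<in> harmonic p"
  shows "energy_measure p h = restrict_space (nu (\<lambda>k. h (p k))) K"
proof -
  let ?u = "\<lambda>k. h (p k)"
  have h: "\<And>x. x \<in> K \<Longrightarrow> h x = harmonic_ext ?u x" "h \<in> energy_dom p"
    using assms harmonic_eq_harmonic_ext by (auto simp: harmonic_def)
  note cand = energy_measure_candidate[OF h]
  have sets: "sets (restrict_space (nu ?u) K) = sets (restrict_space borel K)"
    by (rule sets_restrict_space_cong) simp
  show ?thesis
    unfolding energy_measure_def
  proof (rule the_equality)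
    fix M
    assume "sets M = sets (restrict_space borel K) \<and> (\<forall>g\<in>energy_dom p. integrable M g \<and>
      (\<integral>x. g x \<partial>M) = 2 * energy_form p h (\<lambda>x. h x * g x) - energy_form p (\<lambda>x. (h x)\<^sup>2) g)"
    then show "M = restrict_space (nu ?u) K"
      using sets cand by (intro measure_eq_if_energy_integrals_eq) auto
  qed (use sets cand in auto)
qed

lemma sets_energy_measure:
  "h \<in> harmonic p \<Longrightarrow> sets (energy_measure p h) = sets (restrict_space borel K)"
  unfolding energy_measure_eq by (rule sets_restrict_space_cong) simp

lemma finite_energy_measure: "h \<in> harmonic p \<Longrightarrow> finite_measure (energy_measure p h)"
  unfolding energy_measure_eq by (rule finite_measure_restrict_space[OF finite_measure_nu]) simp

lemma cell_in_sets: "set w \<subseteq> S \<Longrightarrow> cell p w \<in> sets (restrict_space borel K)"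
  using cell_subset_K compact_cell[THEN compact_imp_closed, THEN borel_closed]
  unfolding sets_restrict_space by (intro image_eqI[of _ _ "cell p w"]) auto

lemma measure_energy_cell:
  assumes "h \<in> harmonic p" "set w \<subseteq> S"
  shows "measure (energy_measure p h) (cell p w)
    = renorm ^ length w * (2 * dirichlet S (fold (extend S) w (\<lambda>k. h (p k))))"
  unfolding energy_measure_eq[OF assms(1)]
  using assms(2) by (subst measure_restrict_space) (auto simp: cell_subset_K measure_nu_cell mass_fold_branch)

definition unit :: "nat \<Rightarrow> nat \<Rightarrow> real" where "unit k = (\<lambda>i. if i = k then 1 else 0)"

lemma approx_cong:
  assumes "x \<in> K" "\<And>k. k \<in> S \<Longrightarrow> u k = v k" shows "approx n u x = approx n v x"
  using assms
proof (induction n arbitrary: u v x)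
  case 0
  have "(\<forall>k\<in>S. g (p k) = u k) \<longleftrightarrow> (\<forall>k\<in>S. g (p k) = v k)" for g :: "'a \<Rightarrow> real"
    using 0(2) by (intro ball_cong) simp_all
  then show ?case by (simp add: affine_ext_def)
next
  case (Suc n)
  obtain i y where iy: "i \<in> S" "y \<in> K" "x = psi p i y" using K_cases[OF Suc.prems(1)] .
  have "approx n (extend S i u) y = approx n (extend S i v) y"
    by (rule Suc.IH[OF iy(2)]) (rule extend_cong[OF Suc.prems(2) iy(1)])
  then show ?case unfolding iy(3) approx_psi[OF iy(1,2)] .
qed

text \<open>
  Values of \<open>u\<close> outside \<open>S\<close> are meaningless; they differ between \<open>unit k\<close> and the vertex values of
  \<open>harmonic_basis p k\<close>.
\<close>

lemma harmonic_ext_cong: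
  assumes "x \<in> K" "\<And>k. k \<in> S \<Longrightarrow> u k = v k" shows "harmonic_ext u x = harmonic_ext v x"
  unfolding harmonic_ext_def using approx_cong[OF assms] by simp

lemma harmonic_basis:
  assumes "k \<in> S"
  shows "harmonic_basis p k \<in> harmonic p" "\<And>i. i \<in> S \<Longrightarrow> harmonic_basis p k (p i) = unit k i"
proof -
  let ?P = "\<lambda>h. h \<in> harmonic p \<and> (\<forall>i\<in>S. h (p i) = (if i = k then 1 else 0)) \<and> (\<forall>x. x \<notin> K \<longrightarrow> h x = 0)"
  define h where "h x = (if x \<in> K then harmonic_ext (unit k) x else 0)" for x
  have h: "?P h"
    using harmonic_ext_like_is_harmonic[of h "unit k"]
    by (auto simp: h_def harmonic_ext_vertex vertex_in_K unit_def)
  have uniq: "g = h" if g: "?P g" for g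
  proof
    fix x
    show "g x = h x"
    proof (cases "x \<in> K")
      case True
      have "g x = harmonic_ext (\<lambda>k. g (p k)) x"
        using g True by (intro harmonic_eq_harmonic_ext) auto
      also have "\<dots> = harmonic_ext (unit k) x"
        using g by (intro harmonic_ext_cong[OF True]) (auto simp: unit_def)
      finally show ?thesis using True by (simp add: h_def)
    qed (use g h in auto)
  qed
  have "harmonic_basis p k = h"
    unfolding harmonic_basis_def S_eq[symmetric] by (rule the_equality) (rule h, rule uniq)
  then show "harmonic_basis p k \<in> harmonic p" "\<And>i. i \<in> S \<Longrightarrow> harmonic_basis p k (p i) = unit k i"
    using h by (auto simp: unit_def)
qed

lemma measure_kusuoka_cell:
  assumes w: "set w \<subseteq> S"
  shows "measure (kusuoka_measure p) (cell p w)
    = renorm ^ length w * (2 * (\<Sum>k\<in>S. dirichlet S (fold (extend S) w (unit k))))"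
proof -
  let ?\<mu> = "\<lambda>k. energy_measure p (harmonic_basis p k)"
  have sets: "sets (?\<mu> k) = sets (restrict_space borel K)" if "k \<in> S" for k
    using sets_energy_measure[OF harmonic_basis(1)[OF that]] .
  have "emeasure (kusuoka_measure p) (cell p w) = (\<Sum>k\<in>S. emeasure (?\<mu> k) (cell p w))"
  proof (rule emeasure_measure_of)
    show "kusuoka_measure p = measure_of K (sets (restrict_space borel K)) (\<lambda>A. \<Sum>k\<in>S. emeasure (?\<mu> k) A)"
      by (simp add: kusuoka_measure_def S_eq)
    show "sets (restrict_space borel K) \<subseteq> Pow K"
      using sets.space_closed[of "restrict_space borel K"] by (simp add: space_restrict_space)
    have sets_eq: "sets (kusuoka_measure p) = sets (restrict_space borel K)"
      unfolding kusuoka_measure_def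
      using sets.sets_measure_of_eq[of "restrict_space borel K"] by (simp add: space_restrict_space)
    show "cell p w \<in> sets (kusuoka_measure p)"
      unfolding sets_eq by (rule cell_in_sets[OF w])
    show "positive (sets (kusuoka_measure p)) (\<lambda>A. \<Sum>k\<in>S. emeasure (?\<mu> k) A)"
      by (simp add: positive_def)
    show "countably_additive (sets (kusuoka_measure p)) (\<lambda>A. \<Sum>k\<in>S. emeasure (?\<mu> k) A)"
    proof (rule countably_additiveI)
      fix A :: "nat \<Rightarrow> 'a set"
      assume A: "range A \<subseteq> sets (kusuoka_measure p)" "disjoint_family A"
      have "(\<Sum>n. \<Sum>k\<in>S. emeasure (?\<mu> k) (A n)) = (\<Sum>k\<in>S. \<Sum>n. emeasure (?\<mu> k) (A n))"
        by (rule suminf_sum) simp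
      also have "\<dots> = (\<Sum>k\<in>S. emeasure (?\<mu> k) (\<Union> (range A)))"
        using A sets_eq sets by (intro sum.cong refl suminf_emeasure) auto
      finally show "(\<Sum>n. \<Sum>k\<in>S. emeasure (?\<mu> k) (A n)) = (\<Sum>k\<in>S. emeasure (?\<mu> k) (\<Union> (range A)))" .
    qed
  qed
  also have "\<dots> = (\<Sum>k\<in>S. ennreal (renorm ^ length w * (2 * dirichlet S (fold (extend S) w (unit k)))))"
  proof (intro sum.cong refl)
    fix k assume k: "k \<in> S"
    have "emeasure (?\<mu> k) (cell p w) = ennreal (measure (?\<mu> k) (cell p w))"
      by (rule finite_measure.emeasure_eq_measure[OF finite_energy_measure[OF harmonic_basis(1)[OF k]]])
    also have "measure (?\<mu> k) (cell p w)
        = renorm ^ length w * (2 * dirichlet S (fold (extend S) w (\<lambda>l. harmonic_basis p k (p l))))"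
      by (rule measure_energy_cell[OF harmonic_basis(1)[OF k] w])
    also have "dirichlet S (fold (extend S) w (\<lambda>l. harmonic_basis p k (p l)))
        = dirichlet S (fold (extend S) w (unit k))"
      using w harmonic_basis(2)[OF k] by (intro dirichlet_cong fold_extend_cong) auto
    finally show "emeasure (?\<mu> k) (cell p w)
        = ennreal (renorm ^ length w * (2 * dirichlet S (fold (extend S) w (unit k))))" .
  qed
  also have "\<dots> = ennreal (\<Sum>k\<in>S. renorm ^ length w * (2 * dirichlet S (fold (extend S) w (unit k))))"
    using renorm_pos by (intro sum_ennreal) (auto simp: dirichlet_nonneg)
  finally show ?thesis
    using renorm_pos
    by (simp add: measure_def sum_nonneg dirichlet_nonneg flip: sum_distrib_left)
qed

text \<open>
  The renormalization factors of numerator and denominator cancel.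
\<close>

definition energy_ratio :: "(nat \<Rightarrow> real) \<Rightarrow> nat list \<Rightarrow> real" where
  "energy_ratio u w = dirichlet S (fold (extend S) w u) / (\<Sum>k\<in>S. dirichlet S (fold (extend S) w (unit k)))"

lemma density_ratio_eq:
  assumes "h \<in> harmonic p" "set w \<subseteq> S" "\<omega> \<in> codes"
  shows "density_ratio p h w \<omega> n = energy_ratio (\<lambda>k. h (p k)) (w @ map \<omega> [0..<n])"
proof -
  have "set (w @ map \<omega> [0..<n]) \<subseteq> S" using assms by (simp add: image_subset_iff)
  then show ?thesis
    unfolding density_ratio_def energy_ratio_def
    using renorm_pos by (simp only: measure_energy_cell[OF assms(1)] measure_kusuoka_cell) simp
qed

end

section \<open>Two letters: growth of cell masses and decay of the ratio increments\<close>

lemma flux_cong: "(\<And>k. k \<in> S \<Longrightarrow> u k = v k) \<Longrightarrow> i \<in> S \<Longrightarrow> flux S i u = flux S i v"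
  unfolding flux_def by (intro arg_cong2[where f = "(-)"] arg_cong2[where f = "(*)"] refl sum.cong) auto

lemma flux_sum: "flux S i (\<lambda>j. \<Sum>k\<in>I. a k * v k j) = (\<Sum>k\<in>I. a k * flux S i (v k))"
  unfolding flux_def
  by (subst sum.swap) (simp add: sum_distrib_left sum_subtractf right_diff_distrib mult_ac)

lemma fold_extend_sum:
  "fold (extend S) w (\<lambda>j. \<Sum>k\<in>I. a k * v k j) = (\<lambda>j. \<Sum>k\<in>I. a k * fold (extend S) w (v k) j)"
proof (induction w arbitrary: v)
  case (Cons i w)
  show ?case by (simp only: fold_simps extend_sum Cons)
qed simp

lemma fold_extend_surj:
  assumes "finite S" "set w \<subseteq> S" obtains x where "fold (extend S) w x = y"
  using assms
proof (induction w arbitrary: y thesis)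
  case (Cons i w)
  obtain z where z: "fold (extend S) w z = y" using Cons.IH Cons.prems by auto
  obtain x where "extend S i x = z" using extend_surj[of S i z] Cons.prems by auto
  with z have "fold (extend S) (i # w) x = y" by simp
  then show ?case by (rule Cons.prems(1))
qed simp

lemma dirichlet_sum_le:
  "dirichlet S (\<lambda>j. \<Sum>k\<in>I. a k * v k j) \<le> (\<Sum>k\<in>I. (a k)\<^sup>2) * (\<Sum>k\<in>I. dirichlet S (v k))"
proof -
  have "(\<Sum>i\<in>S. \<Sum>j\<in>S. ((\<Sum>k\<in>I. a k * v k i) - (\<Sum>k\<in>I. a k * v k j))\<^sup>2)
      \<le> (\<Sum>i\<in>S. \<Sum>j\<in>S. (\<Sum>k\<in>I. (a k)\<^sup>2) * (\<Sum>k\<in>I. (v k i - v k j)\<^sup>2))"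
  proof (intro sum_mono)
    fix i j
    have "(\<Sum>k\<in>I. a k * v k i) - (\<Sum>k\<in>I. a k * v k j) = (\<Sum>k\<in>I. a k * (v k i - v k j))"
      by (simp add: sum_subtractf right_diff_distrib)
    then show "((\<Sum>k\<in>I. a k * v k i) - (\<Sum>k\<in>I. a k * v k j))\<^sup>2
        \<le> (\<Sum>k\<in>I. (a k)\<^sup>2) * (\<Sum>k\<in>I. (v k i - v k j)\<^sup>2)"
      using Cauchy_Schwarz_ineq_sum[of a "\<lambda>k. v k i - v k j" I] by simp
  qed
  also have "\<dots> = (\<Sum>k\<in>I. (a k)\<^sup>2) * (\<Sum>k\<in>I. \<Sum>i\<in>S. \<Sum>j\<in>S. (v k i - v k j)\<^sup>2)"
  proof -
    have "(\<Sum>i\<in>S. \<Sum>j\<in>S. \<Sum>k\<in>I. (v k i - v k j)\<^sup>2) = (\<Sum>k\<in>I. \<Sum>i\<in>S. \<Sum>j\<in>S. (v k i - v k j)\<^sup>2)"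
    proof -
      have "(\<Sum>i\<in>S. \<Sum>j\<in>S. \<Sum>k\<in>I. (v k i - v k j)\<^sup>2) = (\<Sum>i\<in>S. \<Sum>k\<in>I. \<Sum>j\<in>S. (v k i - v k j)\<^sup>2)"
        by (intro sum.cong refl sum.swap)
      also have "\<dots> = (\<Sum>k\<in>I. \<Sum>i\<in>S. \<Sum>j\<in>S. (v k i - v k j)\<^sup>2)" by (rule sum.swap)
      finally show ?thesis .
    qed
    then show ?thesis by (simp flip: sum_distrib_left)
  qed
  finally show ?thesis
    by (simp add: dirichlet_def flip: sum_divide_distrib)
qed

locale gasket_edge = simplex_gasket p S
  for p :: "nat \<Rightarrow> 'a::euclidean_space" and S :: "nat set" +
  fixes i j :: nat
  assumes i: "i \<in> S" and j: "j \<in> S" and ij: "i \<noteq> j"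
begin

abbreviation n :: real where "n \<equiv> real (card S)"
abbreviation harm :: "nat list \<Rightarrow> (nat \<Rightarrow> real) \<Rightarrow> nat \<Rightarrow> real" where
  "harm w \<equiv> fold (extend S) w"

text \<open>
  Up to the renormalization factor, the Kusuoka measure of the cell \<open>w\<close>.
\<close>

definition total :: "nat list \<Rightarrow> real" where
  "total w = (\<Sum>k\<in>S. dirichlet S (harm w (unit k)))"

lemma n_ge: "n \<ge> 3" by (rule card_S_ge)

lemma unit_sum: "k \<in> S \<Longrightarrow> (\<Sum>l\<in>S. u l * unit l k) = u k"
proof -
  assume k: "k \<in> S"
  have "(\<Sum>l\<in>S. u l * unit l k) = (\<Sum>l\<in>S. if l = k then u k else 0)"
    by (intro sum.cong) (auto simp: unit_def)
  then show ?thesis using k by simp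
qed

lemma harm_expand:
  assumes "set w \<subseteq> S" "k \<in> S"
  shows "harm w u k = (\<Sum>l\<in>S. u l * harm w (unit l) k)"
  using fold_extend_cong[OF assms, of u "\<lambda>k. \<Sum>l\<in>S. u l * unit l k"] unit_sum
  by (simp add: fold_extend_sum)

lemma total_nonneg: "0 \<le> total w"
  unfolding total_def by (intro sum_nonneg dirichlet_nonneg)

text \<open>
  By Cauchy-Schwarz, since a vertex vector is a combination of unit vectors.
\<close>

lemma dirichlet_le_total:
  assumes "set w \<subseteq> S" shows "dirichlet S (harm w u) \<le> (\<Sum>k\<in>S. (u k)\<^sup>2) * total w"
proof -
  have "dirichlet S (harm w u) = dirichlet S (\<lambda>k. \<Sum>l\<in>S. u l * harm w (unit l) k)"
    by (intro dirichlet_cong harm_expand assms)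
  then show ?thesis unfolding total_def using dirichlet_sum_le by simp
qed

lemma unit_dirichlet_le_total: "k \<in> S \<Longrightarrow> dirichlet S (harm w (unit k)) \<le> total w"
  unfolding total_def by (rule member_le_sum) (auto simp: dirichlet_nonneg)

lemma flux_harm_square_le:
  assumes "set w \<subseteq> S" "l \<in> S"
  shows "(flux S l (harm w u))\<^sup>2 \<le> (\<Sum>k\<in>S. (u k)\<^sup>2) * (n * total w)"
proof -
  have "(flux S l (harm w u))\<^sup>2 \<le> n * dirichlet S (harm w u)"
    using assms by (intro flux_square_le) auto
  also have "\<dots> \<le> n * ((\<Sum>k\<in>S. (u k)\<^sup>2) * total w)"
    using n_ge by (intro mult_left_mono dirichlet_le_total assms) auto
  finally show ?thesis by (simp add: mult_ac)
qed

text \<open>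
  The square of the larger absolute eigenvalue for alternating letters, up to the factor
  \<open>(n + 2)\<^sup>2\<close>: the alternating product is the one with the slowest growth.
\<close>

definition lam :: real where "lam = (sqrt (4 * n + 1) + 1)\<^sup>2 / 4"

lemma lam_eq: "lam = n + 1/2 + sqrt (4 * n + 1) / 2"
  using n_ge by (simp add: lam_def power2_sum field_simps)

lemma lam_root: "lam\<^sup>2 = (2 * n + 1) * lam - n\<^sup>2"
proof -
  have "(sqrt (4 * n + 1))\<^sup>2 = 4 * n + 1" using n_ge by simp
  then show ?thesis unfolding lam_eq by (simp add: power2_eq_square field_simps)
qed

lemma lam_pos: "lam > 0" using n_ge by (simp add: lam_eq add_pos_nonneg)

lemma lam_less: "lam < n\<^sup>2"
proof -
  have "4 * n + 1 \<le> (n + 1)\<^sup>2" using n_ge by (simp add: power2_eq_square algebra_simps)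
  then have "sqrt (4 * n + 1) \<le> n + 1" using n_ge by (intro real_le_lsqrt) auto
  then have "lam \<le> 3/2 * n + 1" by (simp add: lam_eq)
  moreover have "3 * n \<le> n\<^sup>2" using n_ge by (simp add: power2_eq_square)
  ultimately show ?thesis using n_ge by linarith
qed

text \<open>
  The quadratic form on the left is chosen such that the difference of both sides is a perfect
  square up to a positive factor; its discriminant vanishes by \<open>lam_root\<close>. In the coordinate
  \<open>z = (a + b) / (a - b)\<close> the matrices act by Moebius maps that are contractions by \<open>tau\<close>, but only
  for the metric \<open>|dz| / (1 - (n - 2) / n * z\<^sup>2)\<close>, which belongs to this form.
\<close>

lemma dual_form_step:
  "lam * (a\<^sup>2 + b\<^sup>2 - 2 * (n - 1) * (a * b))
     \<le> (n * a - b)\<^sup>2 + b\<^sup>2 - 2 * (n - 1) * ((n * a - b) * b)"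
proof -
  let ?X = "(n * a - b)\<^sup>2 + b\<^sup>2 - 2 * (n - 1) * ((n * a - b) * b)
      - lam * (a\<^sup>2 + b\<^sup>2 - 2 * (n - 1) * (a * b))"
  have "(n\<^sup>2 - lam) * ?X = ((n\<^sup>2 - lam) * a - (n\<^sup>2 - (n - 1) * lam) * b)\<^sup>2"
    using lam_root by algebra
  then have "0 \<le> (n\<^sup>2 - lam) * ?X" by (simp only: zero_le_power2)
  then have "0 \<le> ?X" using lam_less by (simp add: zero_le_mult_iff)
  then show ?thesis by simp
qed

lemma dual_form_scale:
  "(a / d)\<^sup>2 + (b / d)\<^sup>2 - 2 * (n - 1) * (a / d * (b / d))
     = (a\<^sup>2 + b\<^sup>2 - 2 * (n - 1) * (a * b)) / d\<^sup>2"
proof -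
  have div: "x / e + y / e - c * (z / e) = (x + y - c * z) / e" for x y z c e :: real
    by (simp add: add_divide_distrib diff_divide_distrib)
  have prod: "a / d * (b / d) = a * b / d\<^sup>2" by (simp add: power2_eq_square)
  show ?thesis unfolding power_divide prod by (rule div)
qed

text \<open>
  The flux at \<open>i\<close> on the cell \<open>v\<close> is a linear combination of the two fluxes at the start, and its
  coefficient vector moves under the dual matrices, for which \<open>dual_form_step\<close> gives growth. The
  form is symmetric in \<open>a\<close> and \<open>b\<close>, which covers the letter \<open>j\<close>.
\<close>

lemma edge_functional:
  assumes "set v \<subseteq> {i, j}"
  obtains a b where "\<And>u. flux S i (harm v u) = a * flux S i u + b * flux S j u"
    "(lam / (n + 2)\<^sup>2) ^ length v \<le> a\<^sup>2 + b\<^sup>2 - 2 * (n - 1) * (a * b)"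
  using assms
proof (induction v arbitrary: thesis)
  case Nil
  show ?case by (rule Nil(1)[of 1 0]) auto
next
  case (Cons l v)
  obtain a b where ab: "\<And>u. flux S i (harm v u) = a * flux S i u + b * flux S j u"
    "(lam / (n + 2)\<^sup>2) ^ length v \<le> a\<^sup>2 + b\<^sup>2 - 2 * (n - 1) * (a * b)"
    using Cons.IH Cons.prems(2) by (metis set_subset_Cons subset_trans)
  have pos: "n + 2 > 0" using n_ge by simp
  have grow: "(lam / (n + 2)\<^sup>2) ^ length (l # v)
      \<le> (lam * (a\<^sup>2 + b\<^sup>2 - 2 * (n - 1) * (a * b))) / (n + 2)\<^sup>2"
    using mult_left_mono[OF ab(2), of "lam / (n + 2)\<^sup>2"] lam_pos by simp
  show ?case
  proof (cases "l = i")
    case True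
    show ?thesis
    proof (rule Cons.prems(1))
      show "flux S i (harm (l # v) u) = (n * a - b) / (n + 2) * flux S i u + b / (n + 2) * flux S j u" for u
        using ij pos by (simp add: True ab(1) flux_extend_same[OF finite_S i]
            flux_extend_other[OF finite_S i ij] divide_simps) (simp add: algebra_simps)
      have "((n * a - b) / (n + 2))\<^sup>2 + (b / (n + 2))\<^sup>2 - 2 * (n - 1) * ((n * a - b) / (n + 2) * (b / (n + 2)))
          = ((n * a - b)\<^sup>2 + b\<^sup>2 - 2 * (n - 1) * ((n * a - b) * b)) / (n + 2)\<^sup>2"
        by (rule dual_form_scale)
      moreover have "(lam * (a\<^sup>2 + b\<^sup>2 - 2 * (n - 1) * (a * b))) / (n + 2)\<^sup>2
          \<le> ((n * a - b)\<^sup>2 + b\<^sup>2 - 2 * (n - 1) * ((n * a - b) * b)) / (n + 2)\<^sup>2"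
        by (intro divide_right_mono dual_form_step) simp
      ultimately show "(lam / (n + 2)\<^sup>2) ^ length (l # v)
          \<le> ((n * a - b) / (n + 2))\<^sup>2 + (b / (n + 2))\<^sup>2
            - 2 * (n - 1) * ((n * a - b) / (n + 2) * (b / (n + 2)))"
        using grow by linarith
    qed
  next
    case False
    then have l: "l = j" using Cons.prems(2) by auto
    show ?thesis
    proof (rule Cons.prems(1))
      show "flux S i (harm (l # v) u) = a / (n + 2) * flux S i u + (n * b - a) / (n + 2) * flux S j u" for u
        using ij pos by (simp add: l ab(1) flux_extend_same[OF finite_S j]
            flux_extend_other[OF finite_S j ij[symmetric]] divide_simps) (simp add: algebra_simps)
      have form: "(a / (n + 2))\<^sup>2 + ((n * b - a) / (n + 2))\<^sup>2 - 2 * (n - 1) * (a / (n + 2) * ((n * b - a) / (n + 2)))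
          = ((n * b - a)\<^sup>2 + a\<^sup>2 - 2 * (n - 1) * ((n * b - a) * a)) / (n + 2)\<^sup>2"
        unfolding dual_form_scale by (simp only: mult.commute[of a] add.commute[of "a\<^sup>2"])
      have sym: "a\<^sup>2 + b\<^sup>2 - 2 * (n - 1) * (a * b) = b\<^sup>2 + a\<^sup>2 - 2 * (n - 1) * (b * a)"
        by (simp only: mult.commute[of a] add.commute[of "a\<^sup>2"])
      have "(lam * (b\<^sup>2 + a\<^sup>2 - 2 * (n - 1) * (b * a))) / (n + 2)\<^sup>2
          \<le> ((n * b - a)\<^sup>2 + a\<^sup>2 - 2 * (n - 1) * ((n * b - a) * a)) / (n + 2)\<^sup>2"
        by (intro divide_right_mono dual_form_step) simp
      from order_trans[OF grow[unfolded sym] this]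
      show "(lam / (n + 2)\<^sup>2) ^ length (l # v)
          \<le> (a / (n + 2))\<^sup>2 + ((n * b - a) / (n + 2))\<^sup>2
            - 2 * (n - 1) * (a / (n + 2) * ((n * b - a) / (n + 2)))"
        unfolding form .
    qed
  qed
qed

lemma flux_prescribed: obtains y where "flux S i y = s" "flux S j y = t"
proof -
  \<comment> \<open>The unit vector at \<open>i\<close> has flux \<open>1 - n\<close> at \<open>i\<close> and \<open>1\<close> at every other vertex.\<close>
  define a b where "a = - ((n - 1) * s + t) / (n * (n - 2))" and "b = - (s + (n - 1) * t) / (n * (n - 2))"
  define y where "y k = a * unit i k + b * unit j k" for k
  have "sum y S = a + b"
    using i j unfolding y_def unit_def by (simp add: sum.distrib flip: sum_distrib_left)
  then have "flux S i y = a + b - n * a" "flux S j y = a + b - n * b"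
    using ij by (simp_all add: flux_def y_def unit_def)
  moreover have "n * (n - 2) \<noteq> 0" using n_ge by simp
  then have "a + b - n * a = s" "a + b - n * b = t"
    unfolding a_def b_def by (simp_all add: divide_simps) (simp_all add: algebra_simps)
  ultimately show thesis using that by auto
qed

text \<open>
  The coefficients of \<open>edge_functional\<close> are attained as fluxes of two fixed vectors, since the map of
  the cell \<open>w\<close> is onto; their squares are bounded by the total mass.
\<close>

lemma total_growth:
  assumes w: "set w \<subseteq> S"
  obtains c where "c > 0" "\<And>v. set v \<subseteq> {i, j} \<Longrightarrow> c * (lam / (n + 2)\<^sup>2) ^ length v \<le> total (w @ v)"
proof -
  obtain y1 where y1: "flux S i y1 = 1" "flux S j y1 = 0" by (rule flux_prescribed)
  obtain y2 where y2: "flux S i y2 = 0" "flux S j y2 = 1" by (rule flux_prescribed)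
  obtain x1 where x1: "harm w x1 = y1" using fold_extend_surj[OF finite_S w] .
  obtain x2 where x2: "harm w x2 = y2" using fold_extend_surj[OF finite_S w] .
  define C where "C = (\<Sum>k\<in>S. (x1 k)\<^sup>2) + (\<Sum>k\<in>S. (x2 k)\<^sup>2)"
  have C: "C \<ge> 0" unfolding C_def by (intro add_nonneg_nonneg sum_nonneg) auto
  have Cn: "n * (n * C) + 1 > 0" using C n_ge by (intro add_nonneg_pos mult_nonneg_nonneg) auto
  \<comment> \<open>The summand \<open>1\<close> only avoids a division by zero.\<close>
  show thesis
  proof (rule that[of "1 / (n * (n * C) + 1)"])
    show "1 / (n * (n * C) + 1) > 0" using Cn by simp
    fix v assume v: "set v \<subseteq> {i, j}"
    then have wv: "set (w @ v) \<subseteq> S" using w i j by auto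
    obtain a b where ab: "\<And>u. flux S i (harm v u) = a * flux S i u + b * flux S j u"
      "(lam / (n + 2)\<^sup>2) ^ length v \<le> a\<^sup>2 + b\<^sup>2 - 2 * (n - 1) * (a * b)"
      using edge_functional[OF v] by blast
    have "flux S i (harm (w @ v) x1) = a" "flux S i (harm (w @ v) x2) = b"
      by (simp_all add: x1 x2 ab(1) y1 y2)
    then have "a\<^sup>2 + b\<^sup>2 \<le> C * (n * total (w @ v))"
      using flux_harm_square_le[OF wv i, of x1] flux_harm_square_le[OF wv i, of x2]
      by (simp add: C_def distrib_right)
    have "- (2 * (a * b)) \<le> a\<^sup>2 + b\<^sup>2" using sum_squares_bound[of a "- b"] by simp
    from mult_left_mono[OF this, of "n - 1"] n_ge
    have "a\<^sup>2 + b\<^sup>2 - 2 * (n - 1) * (a * b) \<le> n * (a\<^sup>2 + b\<^sup>2)" by (simp add: algebra_simps)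
    also have "\<dots> \<le> n * (C * (n * total (w @ v)))"
      using \<open>a\<^sup>2 + b\<^sup>2 \<le> C * (n * total (w @ v))\<close> n_ge by (intro mult_left_mono) auto
    also have "\<dots> \<le> (n * (n * C) + 1) * total (w @ v)"
      using total_nonneg[of "w @ v"] by (simp add: algebra_simps)
    finally have "(lam / (n + 2)\<^sup>2) ^ length v \<le> (n * (n * C) + 1) * total (w @ v)" using ab(2) by simp
    then have "(lam / (n + 2)\<^sup>2) ^ length v / (n * (n * C) + 1) \<le> total (w @ v)"
      by (subst pos_divide_le_eq[OF Cn]) (simp only: mult.commute)
    then show "1 / (n * (n * C) + 1) * (lam / (n + 2)\<^sup>2) ^ length v \<le> total (w @ v)"
      by (simp only: times_divide_eq_left mult_1)
  qed
qed

lemma total_pos: assumes "set w \<subseteq> S" shows "total w > 0"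
proof -
  obtain c where "c > 0" "\<And>v. set v \<subseteq> {i, j} \<Longrightarrow> c * (lam / (n + 2)\<^sup>2) ^ length v \<le> total (w @ v)"
    using total_growth[OF assms] by blast
  from this(1) this(2)[of "[]"] show ?thesis by simp
qed

text \<open>
  The part of the Dirichlet form that depends only on the fluxes \<open>a\<close> at \<open>i\<close> and \<open>b\<close> at \<open>j\<close>, that is, its
  minimum under prescribed fluxes.
\<close>

definition edge_form :: "real \<Rightarrow> real \<Rightarrow> real" where
  "edge_form a b = ((n - 1) * (a\<^sup>2 + b\<^sup>2) + 2 * (a * b)) / (n * (n - 2))"

definition residue :: "(nat \<Rightarrow> real) \<Rightarrow> real" where
  "residue u = dirichlet S u - edge_form (flux S i u) (flux S j u)"

definition wedge :: "(nat \<Rightarrow> real) \<Rightarrow> (nat \<Rightarrow> real) \<Rightarrow> real" where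
  "wedge u v = flux S i u * flux S j v - flux S i v * flux S j u"

lemma edge_form_sym: "edge_form a b = edge_form b a"
  by (simp add: edge_form_def add.commute mult.commute)

lemma edge_form_scale: "edge_form (a / d) (b / d) = edge_form a b / d\<^sup>2"
proof -
  have div: "(n - 1) * (x / e + y / e) + 2 * (z / e) = ((n - 1) * (x + y) + 2 * z) / e" for x y z e :: real
    by (simp add: add_divide_distrib distrib_left)
  have prod: "a / d * (b / d) = a * b / d\<^sup>2" by (simp add: power2_eq_square)
  show ?thesis
    unfolding edge_form_def power_divide prod div by (simp only: divide_divide_eq_left mult.commute)
qed

lemma edge_form_step:
  "edge_form (n / (n + 2) * a) ((b - a) / (n + 2)) = (edge_form a b + (n + 1) * a\<^sup>2) / (n + 2)\<^sup>2"
proof -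
  have nz: "n * (n - 2) \<noteq> 0" using n_ge by auto
  have "(n - 1) * ((n * a)\<^sup>2 + (b - a)\<^sup>2) + 2 * ((n * a) * (b - a))
      = (n - 1) * (a\<^sup>2 + b\<^sup>2) + 2 * (a * b) + n * (n - 2) * ((n + 1) * a\<^sup>2)"
    by algebra
  then have "edge_form (n * a) (b - a) = edge_form a b + (n + 1) * a\<^sup>2"
    unfolding edge_form_def by (simp only: add_divide_distrib nonzero_mult_div_cancel_left[OF nz])
  then show ?thesis using edge_form_scale[of "n * a" "n + 2" "b - a"] by simp
qed

text \<open>
  Both \<open>dirichlet\<close> and \<open>edge_form\<close> gain \<open>(n + 1)\<close> times the squared flux at \<open>l\<close> before the division by
  \<open>(n + 2)\<^sup>2\<close>, so their difference does not see it.
\<close>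

lemma residue_extend:
  assumes "l \<in> {i, j}" shows "residue (extend S l u) = residue u / (n + 2)\<^sup>2"
proof (cases "l = i")
  case True
  show ?thesis
    unfolding residue_def True dirichlet_extend[OF finite_S i] flux_extend_same[OF finite_S i]
      flux_extend_other[OF finite_S i ij] edge_form_step
    by (simp add: diff_divide_distrib add_divide_distrib)
next
  case False
  then have l: "l = j" using assms by auto
  show ?thesis
    unfolding residue_def l dirichlet_extend[OF finite_S j] flux_extend_same[OF finite_S j]
      flux_extend_other[OF finite_S j ij[symmetric]]
    unfolding edge_form_sym[of _ "n / (n + 2) * flux S j u"] edge_form_step
      edge_form_sym[of "flux S i u"]
    by (simp add: diff_divide_distrib add_divide_distrib)
qed

lemma wedge_extend:
  assumes "l \<in> {i, j}" shows "wedge (extend S l u) (extend S l v) = n / (n + 2)\<^sup>2 * wedge u v"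
proof -
  have nz: "n + 2 \<noteq> 0" using n_ge by auto
  show ?thesis
  proof (cases "l = i")
    case True
    show ?thesis
      unfolding wedge_def True flux_extend_same[OF finite_S i] flux_extend_other[OF finite_S i ij]
      using nz by (simp add: power2_eq_square divide_simps) (simp add: algebra_simps)
  next
    case False
    then have l: "l = j" using assms by auto
    show ?thesis
      unfolding wedge_def l flux_extend_same[OF finite_S j] flux_extend_other[OF finite_S j ij[symmetric]]
      using nz by (simp add: power2_eq_square divide_simps) (simp add: algebra_simps)
  qed
qed

lemma residue_harm: "set v \<subseteq> {i, j} \<Longrightarrow> residue (harm v u) = residue u / ((n + 2)\<^sup>2) ^ length v"
  by (induction v arbitrary: u) (simp_all add: residue_extend)

lemma wedge_harm: "set v \<subseteq> {i, j} \<Longrightarrow> wedge (harm v u) (harm v u') = (n / (n + 2)\<^sup>2) ^ length v * wedge u u'"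
  by (induction v arbitrary: u u') (simp_all add: wedge_extend)

text \<open>
  An antisymmetric combination of values of a binary quadratic form is divisible by the two-by-two
  minor of its arguments.
\<close>

lemma edge_form_cross:
  "a\<^sup>2 * edge_form a' b' - a'\<^sup>2 * edge_form a b
     = (a * b' - a' * b) * ((n - 1) * (a * b' + a' * b) + 2 * (a * a')) / (n * (n - 2))"
proof -
  have "a\<^sup>2 * ((n - 1) * (a'\<^sup>2 + b'\<^sup>2) + 2 * (a' * b')) - a'\<^sup>2 * ((n - 1) * (a\<^sup>2 + b\<^sup>2) + 2 * (a * b))
      = (a * b' - a' * b) * ((n - 1) * (a * b' + a' * b) + 2 * (a * a'))"
    by algebra
  then show ?thesis unfolding edge_form_def by (simp flip: diff_divide_distrib)
qed

lemma edge_form_cross_bound: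
  assumes "a\<^sup>2 \<le> n * M" "b\<^sup>2 \<le> n * M" "a'\<^sup>2 \<le> n * M" "b'\<^sup>2 \<le> n * M"
  shows "\<bar>a\<^sup>2 * edge_form a' b' - a'\<^sup>2 * edge_form a b\<bar> \<le> 2 * n\<^sup>2 * \<bar>a * b' - a' * b\<bar> * M"
proof -
  have prod: "\<bar>x * y\<bar> \<le> n * M" if "x\<^sup>2 \<le> n * M" "y\<^sup>2 \<le> n * M" for x y
    using sum_squares_bound[of "\<bar>x\<bar>" "\<bar>y\<bar>"] that by (simp add: abs_mult)
  have M: "0 \<le> n * M" using assms(1) zero_le_power2[of a] by linarith
  have "\<bar>(n - 1) * (a * b' + a' * b) + 2 * (a * a')\<bar> \<le> (n - 1) * \<bar>a * b' + a' * b\<bar> + 2 * \<bar>a * a'\<bar>"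
    using n_ge abs_triangle_ineq[of "(n - 1) * (a * b' + a' * b)" "2 * (a * a')"] by (simp add: abs_mult)
  also have "\<dots> \<le> (n - 1) * (n * M + n * M) + 2 * (n * M)"
    using n_ge prod[OF assms(1,4)] prod[OF assms(3,2)] prod[OF assms(1,3)]
    by (intro add_mono mult_left_mono order_trans[OF abs_triangle_ineq]) auto
  also have "\<dots> = 2 * n\<^sup>2 * M" by (simp add: power2_eq_square algebra_simps)
  finally have br: "\<bar>(n - 1) * (a * b' + a' * b) + 2 * (a * a')\<bar> \<le> 2 * n\<^sup>2 * M" .
  have "1 * 1 \<le> n * (n - 2)" using n_ge by (intro mult_mono) auto
  then have nn: "n * (n - 2) \<ge> 1" by simp
  have "\<bar>a\<^sup>2 * edge_form a' b' - a'\<^sup>2 * edge_form a b\<bar>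
      = \<bar>a * b' - a' * b\<bar> * \<bar>(n - 1) * (a * b' + a' * b) + 2 * (a * a')\<bar> / (n * (n - 2))"
    unfolding edge_form_cross using nn n_ge by (simp add: abs_mult)
  also have "\<dots> \<le> \<bar>a * b' - a' * b\<bar> * \<bar>(n - 1) * (a * b' + a' * b) + 2 * (a * a')\<bar> / 1"
    using nn by (intro divide_left_mono) auto
  also have "\<dots> \<le> \<bar>a * b' - a' * b\<bar> * (2 * n\<^sup>2 * M)"
    using br by (simp add: mult_left_mono)
  finally show ?thesis by (simp add: mult_ac)
qed

text \<open>
  Every term contains a minor or a residue, and both are small on deep cells.
\<close>

lemma cross_term_bound:
  assumes l: "l \<in> {i, j}"
    and D: "dirichlet S y \<le> M" "dirichlet S y' \<le> M"
    and E: "\<bar>residue y\<bar> \<le> E" "\<bar>residue y'\<bar> \<le> E" and W: "\<bar>wedge y y'\<bar> \<le> W"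
  shows "\<bar>(flux S l y)\<^sup>2 * dirichlet S y' - dirichlet S y * (flux S l y')\<^sup>2\<bar>
       \<le> (2 * n\<^sup>2 * W + 2 * n * E) * M"
proof -
  have M: "0 \<le> M" using D(1) dirichlet_nonneg[of S y] by linarith
  have E0: "0 \<le> E" using E(1) by linarith
  have sq: "(flux S k z)\<^sup>2 \<le> n * M" if "k \<in> S" "dirichlet S z \<le> M" for k z
    using flux_square_le[OF finite_S that(1), of z] mult_left_mono[OF that(2), of n] by simp
  have main: "\<bar>a\<^sup>2 * (edge_form a' b' + residue y') - (edge_form a b + residue y) * a'\<^sup>2\<bar>
      \<le> (2 * n\<^sup>2 * W + 2 * n * E) * M"
    if "a\<^sup>2 \<le> n * M" "b\<^sup>2 \<le> n * M" "a'\<^sup>2 \<le> n * M" "b'\<^sup>2 \<le> n * M" "\<bar>a * b' - a' * b\<bar> \<le> W" for a b a' b'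
  proof -
    have "\<bar>a\<^sup>2 * edge_form a' b' - a'\<^sup>2 * edge_form a b\<bar> \<le> 2 * n\<^sup>2 * W * M"
      using edge_form_cross_bound[OF that(1-4)] that(5) M n_ge
      by (elim order_trans) (intro mult_right_mono mult_left_mono, auto)
    moreover have "\<bar>a\<^sup>2 * residue y'\<bar> \<le> n * M * E"
      unfolding abs_mult using that E M n_ge by (intro mult_mono) auto
    moreover have "\<bar>residue y * a'\<^sup>2\<bar> \<le> E * (n * M)"
      unfolding abs_mult using that E E0 M n_ge by (intro mult_mono) auto
    ultimately have "\<bar>a\<^sup>2 * edge_form a' b' - a'\<^sup>2 * edge_form a b + a\<^sup>2 * residue y' - residue y * a'\<^sup>2\<bar>
        \<le> 2 * n\<^sup>2 * W * M + n * M * E + E * (n * M)" by linarith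
    then show ?thesis by (simp add: algebra_simps)
  qed
  have dir: "dirichlet S z = edge_form (flux S i z) (flux S j z) + residue z" for z
    by (simp add: residue_def)
  show ?thesis
  proof (cases "l = i")
    case True
    show ?thesis
      unfolding True dir using W unfolding wedge_def
      by (intro main sq i j D)
  next
    case False
    then have l: "l = j" using l by auto
    show ?thesis
      unfolding l dir edge_form_sym[of "flux S i _"] using W unfolding wedge_def
      by (intro main sq i j D) (simp_all add: abs_minus_commute mult.commute)
  qed
qed

definition tau :: real where
  "tau = (sqrt (4 * n + 1) - 1) / (sqrt (4 * n + 1) + 1)"

lemma sqrt_gt: "sqrt (4 * n + 1) > 3"
  using n_ge by (intro real_less_rsqrt) (simp add: power2_eq_square)

lemma tau_eq: "tau = n / lam"
proof -
  define r where "r = sqrt (4 * n + 1)"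
  have r: "r > 3" unfolding r_def by (rule sqrt_gt)
  have "r * r = 4 * n + 1" using n_ge by (simp add: r_def)
  then have "(r + 1) * (r - 1) / 4 = n" by (simp add: algebra_simps)
  moreover have "x\<^sup>2 / 4 * (y / x) = x * y / 4" if "x \<noteq> 0" for x y :: real
    using that by (simp add: power2_eq_square)
  from this[of "r + 1" "r - 1"] have "(r + 1)\<^sup>2 / 4 * ((r - 1) / (r + 1)) = (r + 1) * (r - 1) / 4"
    using r by simp
  ultimately have "lam * tau = n" by (simp only: lam_def tau_def r_def)
  then show ?thesis using lam_pos by (simp add: nonzero_eq_divide_eq mult.commute)
qed

lemma tau: "0 < tau" "tau < 1"
  unfolding tau_def using sqrt_gt n_ge by (auto intro!: divide_pos_pos)

text \<open>
  By \<open>dirichlet_extend\<close> the numerator of the increment is a sum of the terms of \<open>cross_term_bound\<close>.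
  Relative to the mass \<open>Z\<close> it has the order \<open>(n / (n + 2)\<^sup>2) ^ m * Z\<close>, and one of the two factors
  \<open>Z\<close> of the denominator remains to be bounded from below by \<open>total_growth\<close>.
\<close>

lemma energy_ratio_step:
  assumes w: "set w \<subseteq> S"
  obtains B where "B > 0"
    "\<And>v l. set v \<subseteq> {i, j} \<Longrightarrow> l \<in> {i, j} \<Longrightarrow>
       \<bar>energy_ratio u (w @ v @ [l]) - energy_ratio u (w @ v)\<bar> \<le> B * tau ^ length v"
proof -
  obtain c where c: "c > 0" "\<And>v. set v \<subseteq> {i, j} \<Longrightarrow> c * (lam / (n + 2)\<^sup>2) ^ length v \<le> total (w @ v)"
    using total_growth[OF w] by blast
  define U where "U = (\<Sum>k\<in>S. (u k)\<^sup>2) + 1"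
  define E0 where "E0 = \<bar>residue (harm w u)\<bar> + (\<Sum>k\<in>S. \<bar>residue (harm w (unit k))\<bar>)"
  define W0 where "W0 = (\<Sum>k\<in>S. \<bar>wedge (harm w u) (harm w (unit k))\<bar>)"
  define B1 where "B1 = n * ((2 * n\<^sup>2 * W0 + 2 * n * E0) * U)"
  define B0 where "B0 = (n + 1) * B1"
  have U: "U \<ge> 1" unfolding U_def by (simp add: sum_nonneg)
  have E0: "E0 \<ge> 0" and W0: "W0 \<ge> 0" unfolding E0_def W0_def by (auto intro!: add_nonneg_nonneg sum_nonneg)
  have B0: "B0 \<ge> 0" unfolding B0_def B1_def using n_ge U E0 W0
    by (intro mult_nonneg_nonneg add_nonneg_nonneg) auto
  show thesis
  proof (rule that[of "B0 / c + 1"])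
    show "B0 / c + 1 > 0" using B0 c(1) by (intro add_nonneg_pos divide_nonneg_pos) auto
    fix v l assume v: "set v \<subseteq> {i, j}" and l: "l \<in> {i, j}"
    let ?m = "length v"
    have wv: "set (w @ v) \<subseteq> S" and lS: "l \<in> S" using w v l i j by auto
    define q where "q = n / (n + 2)\<^sup>2"
    define y where "y = harm (w @ v) u"
    define z where "z k = harm (w @ v) (unit k)" for k
    define Z where "Z = total (w @ v)"
    define Z' where "Z' = total (w @ v @ [l])"
    let ?t = "\<lambda>k. (flux S l y)\<^sup>2 * dirichlet S (z k) - dirichlet S y * (flux S l (z k))\<^sup>2"
    have Z: "Z > 0" unfolding Z_def using wv by (rule total_pos)
    have pos: "(n + 2)\<^sup>2 > 0" using n_ge by simp
    have q: "q > 0" using n_ge by (simp add: q_def)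
    have Z_sum: "Z = (\<Sum>k\<in>S. dirichlet S (z k))" by (simp add: Z_def total_def z_def)
    have Z'_eq: "Z' = (Z + (n + 1) * (\<Sum>k\<in>S. (flux S l (z k))\<^sup>2)) / (n + 2)\<^sup>2"
      unfolding Z'_def total_def Z_sum
      by (simp add: dirichlet_extend[OF finite_S lS] z_def sum.distrib flip: sum_divide_distrib sum_distrib_left)
    \<comment> \<open>One step reduces the total mass at most by a fixed factor.\<close>
    have Z'_ge: "Z \<le> (n + 2)\<^sup>2 * Z'"
      unfolding Z'_eq using pos n_ge by (simp add: sum_nonneg)
    then have Z': "Z' > 0" using Z pos by (metis less_le_trans zero_less_mult_pos)
    have y_eq: "dirichlet S (harm (w @ v @ [l]) u) = (dirichlet S y + (n + 1) * (flux S l y)\<^sup>2) / (n + 2)\<^sup>2"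
      by (simp add: dirichlet_extend[OF finite_S lS] y_def)
    have numerator: "dirichlet S (harm (w @ v @ [l]) u) * Z - dirichlet S y * Z'
        = (n + 1) * (\<Sum>k\<in>S. ?t k) / (n + 2)\<^sup>2"
    proof -
      have "dirichlet S (harm (w @ v @ [l]) u) * Z - dirichlet S y * Z'
          = ((dirichlet S y + (n + 1) * (flux S l y)\<^sup>2) * Z
             - dirichlet S y * (Z + (n + 1) * (\<Sum>k\<in>S. (flux S l (z k))\<^sup>2))) / (n + 2)\<^sup>2"
        unfolding y_eq Z'_eq by (simp add: diff_divide_distrib)
      also have "\<dots> = (n + 1) * ((flux S l y)\<^sup>2 * Z - dirichlet S y * (\<Sum>k\<in>S. (flux S l (z k))\<^sup>2)) / (n + 2)\<^sup>2"
        by (simp add: algebra_simps)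
      also have "(flux S l y)\<^sup>2 * Z - dirichlet S y * (\<Sum>k\<in>S. (flux S l (z k))\<^sup>2)
          = (\<Sum>k\<in>S. ?t k)"
        unfolding Z_sum by (simp add: sum_subtractf sum_distrib_left)
      finally show ?thesis .
    qed
    have res: "\<bar>residue (harm v x)\<bar> \<le> q ^ ?m * \<bar>residue x\<bar>" for x
    proof -
      have "\<bar>residue (harm v x)\<bar> = (1 / (n + 2)\<^sup>2) ^ ?m * \<bar>residue x\<bar>"
        by (simp add: residue_harm[OF v] power_one_over)
      also have "\<dots> \<le> q ^ ?m * \<bar>residue x\<bar>"
        using n_ge by (intro mult_right_mono power_mono) (auto simp: q_def divide_right_mono)
      finally show ?thesis .
    qed
    have each: "\<bar>?t k\<bar>
        \<le> (2 * n\<^sup>2 * (q ^ ?m * W0) + 2 * n * (q ^ ?m * E0)) * (U * Z)" if k: "k \<in> S" for k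
    proof (rule cross_term_bound[OF l])
      show "dirichlet S y \<le> U * Z"
        unfolding y_def Z_def using dirichlet_le_total[OF wv, of u] total_nonneg[of "w @ v"]
        by (simp add: U_def distrib_right)
      have "dirichlet S (z k) \<le> 1 * Z" unfolding z_def Z_def mult_1 by (rule unit_dirichlet_le_total[OF k])
      also have "\<dots> \<le> U * Z" using U Z by (intro mult_right_mono) auto
      finally show "dirichlet S (z k) \<le> U * Z" .
      have "\<bar>residue y\<bar> \<le> q ^ ?m * \<bar>residue (harm w u)\<bar>" unfolding y_def using res by simp
      also have "\<dots> \<le> q ^ ?m * E0"
        unfolding E0_def using q by (intro mult_left_mono) (auto simp: sum_nonneg)
      finally show "\<bar>residue y\<bar> \<le> q ^ ?m * E0" .
      have mem: "\<bar>residue (harm w (unit k))\<bar> \<le> (\<Sum>k\<in>S. \<bar>residue (harm w (unit k))\<bar>)"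
        using k by (intro member_le_sum) auto
      have "\<bar>residue (z k)\<bar> \<le> q ^ ?m * \<bar>residue (harm w (unit k))\<bar>" unfolding z_def using res by simp
      also have "\<dots> \<le> q ^ ?m * E0"
        unfolding E0_def using q mem by (intro mult_left_mono) auto
      finally show "\<bar>residue (z k)\<bar> \<le> q ^ ?m * E0" .
      have "\<bar>wedge y (z k)\<bar> = q ^ ?m * \<bar>wedge (harm w u) (harm w (unit k))\<bar>"
        using q by (simp add: y_def z_def wedge_harm[OF v] abs_mult q_def[symmetric])
      also have "\<dots> \<le> q ^ ?m * W0"
        unfolding W0_def using q k by (intro mult_left_mono member_le_sum) auto
      finally show "\<bar>wedge y (z k)\<bar> \<le> q ^ ?m * W0" .
    qed
    have "\<bar>\<Sum>k\<in>S. ?t k\<bar>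
        \<le> (\<Sum>k\<in>S. (2 * n\<^sup>2 * (q ^ ?m * W0) + 2 * n * (q ^ ?m * E0)) * (U * Z))"
      by (intro order_trans[OF sum_abs] sum_mono each)
    also have "\<dots> = B1 * (q ^ ?m * Z)"
      unfolding B1_def by (simp add: algebra_simps)
    finally have sum_bound: "\<bar>\<Sum>k\<in>S. ?t k\<bar>
        \<le> B1 * (q ^ ?m * Z)" .
    have num_bound: "\<bar>dirichlet S (harm (w @ v @ [l]) u) * Z - dirichlet S y * Z'\<bar> \<le> B0 * (q ^ ?m * Z) / (n + 2)\<^sup>2"
    proof -
      have "\<bar>dirichlet S (harm (w @ v @ [l]) u) * Z - dirichlet S y * Z'\<bar>
          = (n + 1) * \<bar>\<Sum>k\<in>S. ?t k\<bar> / (n + 2)\<^sup>2"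
        unfolding numerator using n_ge pos by (simp add: abs_mult)
      also have "\<dots> \<le> (n + 1) * (B1 * (q ^ ?m * Z)) / (n + 2)\<^sup>2"
        using n_ge sum_bound by (intro divide_right_mono mult_left_mono) auto
      finally show ?thesis by (simp add: B0_def mult.assoc)
    qed
    have "energy_ratio u (w @ v @ [l]) - energy_ratio u (w @ v)
        = (dirichlet S (harm (w @ v @ [l]) u) * Z - dirichlet S y * Z') / (Z * Z')"
      using Z Z' unfolding energy_ratio_def total_def[symmetric] Z_def[symmetric] Z'_def[symmetric] y_def[symmetric]
      by (simp add: diff_divide_distrib mult.commute)
    then have "\<bar>energy_ratio u (w @ v @ [l]) - energy_ratio u (w @ v)\<bar>
        = \<bar>dirichlet S (harm (w @ v @ [l]) u) * Z - dirichlet S y * Z'\<bar> / (Z * Z')"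
      using Z Z' by (simp add: abs_mult)
    also have "\<dots> \<le> (B0 * (q ^ ?m * Z) / (n + 2)\<^sup>2) / (Z * Z')"
      using num_bound Z Z' by (intro divide_right_mono) auto
    also have "\<dots> = B0 * q ^ ?m / ((n + 2)\<^sup>2 * Z')" using Z by simp
    also have "\<dots> \<le> B0 * q ^ ?m / Z"
      using Z'_ge Z Z' pos B0 q by (intro divide_left_mono mult_nonneg_nonneg mult_pos_pos) auto
    also have "\<dots> \<le> B0 * q ^ ?m / (c * (lam / (n + 2)\<^sup>2) ^ ?m)"
      using c(2)[OF v] c(1) Z B0 q lam_pos pos unfolding Z_def
      by (intro divide_left_mono mult_nonneg_nonneg mult_pos_pos zero_less_power divide_pos_pos) auto
    also have "\<dots> = B0 / c * (q / (lam / (n + 2)\<^sup>2)) ^ ?m"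
    proof -
      have "b * x ^ m / (c * y ^ m) = b / c * (x / y) ^ m" for b c x y :: real and m
        by (simp add: power_divide)
      then show ?thesis .
    qed
    also have "q / (lam / (n + 2)\<^sup>2) = tau"
      unfolding q_def tau_eq using pos by simp
    also have "B0 / c * tau ^ ?m \<le> (B0 / c + 1) * tau ^ ?m"
      using tau by (intro mult_right_mono) auto
    finally show "\<bar>energy_ratio u (w @ v @ [l]) - energy_ratio u (w @ v)\<bar> \<le> (B0 / c + 1) * tau ^ ?m" .
  qed
qed

end

section \<open>Limits of the ratios along an edge\<close>

lemma first_difference:
  fixes f g :: "nat \<Rightarrow> 'b"
  assumes "f \<noteq> g" obtains k where "f k \<noteq> g k" "\<And>l. l < k \<Longrightarrow> f l = g l"
proof -
  have "\<exists>k. f k \<noteq> g k" using assms by (auto simp: fun_eq_iff)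
  then have "f (LEAST k. f k \<noteq> g k) \<noteq> g (LEAST k. f k \<noteq> g k)" by (rule LeastI_ex)
  moreover have "f l = g l" if "l < (LEAST k. f k \<noteq> g k)" for l
    using not_less_Least[OF that] by simp
  ultimately show thesis by (rule that)
qed

context gasket_edge begin

lemma flux_harm_expand:
  assumes "set w \<subseteq> S" "l \<in> S"
  shows "flux S l (harm w x) = (\<Sum>k\<in>S. x k * flux S l (harm w (unit k)))"
proof -
  have "flux S l (harm w x) = flux S l (\<lambda>m. \<Sum>k\<in>S. x k * harm w (unit k) m)"
    using assms by (intro flux_cong harm_expand) auto
  then show ?thesis by (simp add: flux_sum)
qed

lemma sum_flux_unit_pos:
  assumes "set w \<subseteq> S" "l \<in> S"
  shows "0 < (\<Sum>k\<in>S. (flux S l (harm w (unit k)))\<^sup>2)"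
proof -
  obtain x where x: "harm w x = unit l" using fold_extend_surj[OF finite_S assms(1)] .
  have "sum (unit l) S = 1" using assms(2) by (simp add: unit_def)
  then have "flux S l (unit l) = 1 - n" by (simp add: flux_def unit_def)
  then have "flux S l (harm w x) \<noteq> 0" using n_ge x by simp
  then have "(\<Sum>k\<in>S. x k * flux S l (harm w (unit k))) \<noteq> 0"
    unfolding flux_harm_expand[OF assms, of x] .
  then obtain k where k: "k \<in> S" "x k * flux S l (harm w (unit k)) \<noteq> 0"
    by (rule sum.not_neutral_contains_not_neutral)
  then show ?thesis by (intro sum_pos2[of S k]) auto
qed

text \<open>
  For a repeated letter \<open>l\<close> the flux at \<open>l\<close> is an eigenvector; removing its share of the Dirichlet form
  leaves a part that only scales.
\<close>

lemma dirichlet_harm_replicate: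
  assumes "l \<in> S"
  shows "((n + 2)\<^sup>2) ^ m * dirichlet S (harm (replicate m l) y)
    = (n\<^sup>2) ^ m * ((flux S l y)\<^sup>2 / (n - 1)) + (dirichlet S y - (flux S l y)\<^sup>2 / (n - 1))"
proof (induction m arbitrary: y)
  case (Suc m)
  let ?s = "flux S l y" and ?y = "extend S l y"
  have nz: "n + 2 \<noteq> 0" "n - 1 \<noteq> 0" using n_ge by auto
  have s: "(n + 2)\<^sup>2 * (flux S l ?y)\<^sup>2 = n\<^sup>2 * ?s\<^sup>2"
    using nz(1) unfolding flux_extend_same[OF finite_S assms]
    by (simp add: power_mult_distrib power_divide)
  have d: "(n + 2)\<^sup>2 * dirichlet S ?y = dirichlet S y + (n + 1) * ?s\<^sup>2"
    using nz(1) by (simp add: dirichlet_extend[OF finite_S assms])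
  have "((n + 2)\<^sup>2) ^ Suc m * dirichlet S (harm (replicate (Suc m) l) y)
      = (n + 2)\<^sup>2 * (((n + 2)\<^sup>2) ^ m * dirichlet S (harm (replicate m l) ?y))" by simp
  also have "\<dots> = (n\<^sup>2) ^ m * ((n + 2)\<^sup>2 * (flux S l ?y)\<^sup>2 / (n - 1))
      + ((n + 2)\<^sup>2 * dirichlet S ?y - (n + 2)\<^sup>2 * (flux S l ?y)\<^sup>2 / (n - 1))"
    unfolding Suc by (simp add: distrib_left right_diff_distrib)
  also have "\<dots> = (n\<^sup>2) ^ m * (n\<^sup>2 * ?s\<^sup>2 / (n - 1)) + (dirichlet S y + (n + 1) * ?s\<^sup>2 - n\<^sup>2 * ?s\<^sup>2 / (n - 1))"
    unfolding s d ..
  also have "(n + 1) * ?s\<^sup>2 - n\<^sup>2 * ?s\<^sup>2 / (n - 1) = - (?s\<^sup>2 / (n - 1))"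
    using nz(2) by (simp add: divide_simps) (simp add: power2_eq_square algebra_simps)
  then have "dirichlet S y + (n + 1) * ?s\<^sup>2 - n\<^sup>2 * ?s\<^sup>2 / (n - 1) = dirichlet S y - ?s\<^sup>2 / (n - 1)"
    by linarith
  finally show ?case by simp
qed simp

lemma dirichlet_replicate_tendsto:
  assumes "l \<in> S"
  shows "(\<lambda>m. ((n + 2)\<^sup>2 / n\<^sup>2) ^ m * dirichlet S (harm (replicate m l) y)) \<longlonglongrightarrow> (flux S l y)\<^sup>2 / (n - 1)"
proof -
  let ?a = "(flux S l y)\<^sup>2 / (n - 1)"
  have n2: "1 < n\<^sup>2" using n_ge power_strict_mono[of 1 n 2] by simp
  have "((n + 2)\<^sup>2 / n\<^sup>2) ^ m * dirichlet S (harm (replicate m l) y)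
      = ?a + (dirichlet S y - ?a) * (1 / n\<^sup>2) ^ m" for m
  proof -
    have "((n + 2)\<^sup>2 / n\<^sup>2) ^ m * dirichlet S (harm (replicate m l) y)
        = (((n + 2)\<^sup>2) ^ m * dirichlet S (harm (replicate m l) y)) / (n\<^sup>2) ^ m"
      by (simp add: power_divide)
    also have "\<dots> = ?a + (dirichlet S y - ?a) / (n\<^sup>2) ^ m"
      unfolding dirichlet_harm_replicate[OF assms] using n2 n_ge by (simp add: add_divide_distrib)
    also have "(dirichlet S y - ?a) / (n\<^sup>2) ^ m = (dirichlet S y - ?a) * (1 / n\<^sup>2) ^ m"
      by (simp only: power_one_over times_divide_eq_right mult_1_right)
    finally show ?thesis .
  qed
  moreover have "(\<lambda>m. ?a + (dirichlet S y - ?a) * (1 / n\<^sup>2) ^ m) \<longlonglongrightarrow> ?a + (dirichlet S y - ?a) * 0"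
    using n2 by (intro tendsto_intros LIMSEQ_realpow_zero) auto
  ultimately show ?thesis by simp
qed

abbreviation edge_codes :: "(nat \<Rightarrow> nat) set" where "edge_codes \<equiv> UNIV \<rightarrow> {i, j}"

lemma edge_code_letter: "\<omega> \<in> edge_codes \<Longrightarrow> \<omega> m = i \<or> \<omega> m = j" by auto

lemma edge_codes_subset:
  assumes "\<omega> \<in> edge_codes" shows "\<omega> \<in> codes"
proof (rule Pi_I)
  fix m show "\<omega> m \<in> S" using edge_code_letter[OF assms, of m] i j by auto
qed

lemma edge_prefix: "\<omega> \<in> edge_codes \<Longrightarrow> set (map \<omega> [0..<m]) \<subseteq> {i, j}" by auto

definition ratio_limit :: "nat list \<Rightarrow> (nat \<Rightarrow> real) \<Rightarrow> (nat \<Rightarrow> nat) \<Rightarrow> real" where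
  "ratio_limit w u \<omega> = lim (\<lambda>m. energy_ratio u (w @ map \<omega> [0..<m]))"

lemma ratio_converges:
  assumes w: "set w \<subseteq> S"
  shows "\<exists>C\<ge>0. \<forall>\<omega>\<in>edge_codes. (\<lambda>m. energy_ratio u (w @ map \<omega> [0..<m])) \<longlonglongrightarrow> ratio_limit w u \<omega>
    \<and> (\<forall>m. \<bar>ratio_limit w u \<omega> - energy_ratio u (w @ map \<omega> [0..<m])\<bar> \<le> C * tau ^ m)"
proof -
  obtain B where B: "B > 0" "\<And>v l. set v \<subseteq> {i, j} \<Longrightarrow> l \<in> {i, j} \<Longrightarrow>
       \<bar>energy_ratio u (w @ v @ [l]) - energy_ratio u (w @ v)\<bar> \<le> B * tau ^ length v"
    using energy_ratio_step[OF w] by blast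
  define C where "C = B / (1 - tau)"
  have C: "C \<ge> 0" using B tau by (simp add: C_def)
  define R where "R \<omega> m = energy_ratio u (w @ map \<omega> [0..<m])" for \<omega> m
  have near: "\<bar>R \<omega> (m + k) - R \<omega> m\<bar> \<le> C * tau ^ m" if \<omega>: "\<omega> \<in> edge_codes" for \<omega> m k
  proof -
    have "\<bar>R \<omega> (m + k) - R \<omega> m\<bar> \<le> C * tau ^ m * (1 - tau ^ k)"
    proof (induction k)
      case (Suc k)
      have "\<bar>R \<omega> (Suc (m + k)) - R \<omega> (m + k)\<bar> \<le> B * tau ^ (m + k)"
        using B(2)[OF edge_prefix[OF \<omega>, of "m + k"], of "\<omega> (m + k)"] edge_code_letter[OF \<omega>, of "m + k"]
        by (simp add: R_def)
      moreover have "B * tau ^ (m + k) = C * tau ^ m * (tau ^ k - tau ^ Suc k)"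
        using tau by (simp add: C_def power_add) (simp add: divide_simps algebra_simps)
      ultimately have "\<bar>R \<omega> (m + Suc k) - R \<omega> m\<bar>
          \<le> C * tau ^ m * (1 - tau ^ k) + C * tau ^ m * (tau ^ k - tau ^ Suc k)"
        using Suc by simp
      then show ?case by (simp add: algebra_simps)
    qed simp
    also have "\<dots> \<le> C * tau ^ m * 1" using C tau by (intro mult_left_mono) auto
    finally show ?thesis by simp
  qed
  have lim: "R \<omega> \<longlonglongrightarrow> ratio_limit w u \<omega>" if \<omega>: "\<omega> \<in> edge_codes" for \<omega>
  proof -
    have "Cauchy (R \<omega>)"
    proof (rule metric_CauchyI)
      fix e :: real assume "e > 0"
      moreover have "(\<lambda>m. 2 * (C * tau ^ m)) \<longlonglongrightarrow> 2 * (C * 0)"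
        using tau by (intro tendsto_intros LIMSEQ_realpow_zero) auto
      ultimately have "\<forall>\<^sub>F m in sequentially. 2 * (C * tau ^ m) < e" by (intro order_tendstoD(2)) auto
      then obtain M where M: "2 * (C * tau ^ M) < e"
        using eventually_happens' sequentially_bot by blast
      show "\<exists>M. \<forall>m\<ge>M. \<forall>k\<ge>M. dist (R \<omega> m) (R \<omega> k) < e"
      proof (intro exI[of _ M] allI impI)
        fix m k assume "M \<le> m" "M \<le> k"
        then show "dist (R \<omega> m) (R \<omega> k) < e"
          using near[OF \<omega>, of M "m - M"] near[OF \<omega>, of M "k - M"] M
          by (simp add: dist_real_def abs_le_iff abs_less_iff)
      qed
    qed
    then have "R \<omega> \<longlonglongrightarrow> lim (R \<omega>)" by (simp add: Cauchy_convergent_iff convergent_LIMSEQ_iff)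
    then show ?thesis by (simp add: ratio_limit_def R_def[abs_def])
  qed
  show ?thesis
  proof (intro exI[of _ C] conjI ballI allI C)
    fix \<omega> m assume \<omega>: "\<omega> \<in> edge_codes"
    show "(\<lambda>m. energy_ratio u (w @ map \<omega> [0..<m])) \<longlonglongrightarrow> ratio_limit w u \<omega>"
      using lim[OF \<omega>] by (simp add: R_def[abs_def])
    have "(\<lambda>k. \<bar>R \<omega> (k + m) - R \<omega> m\<bar>) \<longlonglongrightarrow> \<bar>ratio_limit w u \<omega> - R \<omega> m\<bar>"
      by (intro tendsto_intros LIMSEQ_ignore_initial_segment lim[OF \<omega>])
    then show "\<bar>ratio_limit w u \<omega> - energy_ratio u (w @ map \<omega> [0..<m])\<bar> \<le> C * tau ^ m"
      unfolding R_def[symmetric]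
      by (rule LIMSEQ_le_const2) (use near[OF \<omega>, of m] in \<open>auto simp: add.commute\<close>)
  qed
qed

lemma ratio_limit_tendsto:
  assumes "set w \<subseteq> S" "\<omega> \<in> edge_codes"
  shows "(\<lambda>m. energy_ratio u (w @ map \<omega> [0..<m])) \<longlonglongrightarrow> ratio_limit w u \<omega>"
  using ratio_converges[OF assms(1), of u] assms(2) by blast

text \<open>
  With a constant tail the flux at its letter dominates both the numerator and the denominator.
\<close>

lemma ratio_limit_tail:
  assumes w: "set w \<subseteq> S" and \<omega>: "\<omega> \<in> edge_codes" and l: "l \<in> S"
    and tail: "\<And>k. m \<le> k \<Longrightarrow> \<omega> k = l"
  defines "v \<equiv> w @ map \<omega> [0..<m]"
  shows "ratio_limit w u \<omega> = (flux S l (harm v u))\<^sup>2 / (\<Sum>k\<in>S. (flux S l (harm v (unit k)))\<^sup>2)"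
proof -
  let ?X = "(n + 2)\<^sup>2 / n\<^sup>2"
  have v: "set v \<subseteq> S" unfolding v_def using w edge_prefix[OF \<omega>, of m] i j by auto
  have X: "?X > 0" using n_ge by simp
  have pre: "map \<omega> [0..<k + m] = map \<omega> [0..<m] @ replicate k l" for k
    by (induction k) (auto simp: tail replicate_append_same)
  have R: "energy_ratio u (w @ map \<omega> [0..<k + m])
      = (?X ^ k * dirichlet S (harm (replicate k l) (harm v u)))
        / (\<Sum>m\<in>S. ?X ^ k * dirichlet S (harm (replicate k l) (harm v (unit m))))" for k
    using X unfolding energy_ratio_def pre v_def by (simp flip: sum_distrib_left)
  have "(\<Sum>k\<in>S. (flux S l (harm v (unit k)))\<^sup>2 / (n - 1)) > 0"
    using sum_flux_unit_pos[OF v l] n_ge by (simp flip: sum_divide_distrib)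
  then have "(\<lambda>k. energy_ratio u (w @ map \<omega> [0..<k + m]))
      \<longlonglongrightarrow> ((flux S l (harm v u))\<^sup>2 / (n - 1)) / (\<Sum>k\<in>S. (flux S l (harm v (unit k)))\<^sup>2 / (n - 1))"
    unfolding R by (intro tendsto_divide tendsto_sum dirichlet_replicate_tendsto l) auto
  moreover have "(\<lambda>k. energy_ratio u (w @ map \<omega> [0..<k + m])) \<longlonglongrightarrow> ratio_limit w u \<omega>"
    by (rule LIMSEQ_ignore_initial_segment[OF ratio_limit_tendsto[OF w \<omega>]])
  ultimately have "ratio_limit w u \<omega>
      = ((flux S l (harm v u))\<^sup>2 / (n - 1)) / (\<Sum>k\<in>S. (flux S l (harm v (unit k)))\<^sup>2 / (n - 1))"
    by (rule LIMSEQ_unique[rotated])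
  then show ?thesis using n_ge by (simp flip: sum_divide_distrib)
qed

text \<open>
  The two codes approach the same junction point from the cells \<open>i\<close> and \<open>j\<close>. The limits are given by
  squared normal derivatives there, which agree up to sign by \<open>flux_extend_other\<close>.
\<close>

lemma ratio_limit_junction:
  assumes w: "set w \<subseteq> S" and \<mu>: "\<mu> \<in> edge_codes" and \<mu>': "\<mu>' \<in> edge_codes"
    and pre: "\<And>k. k < m \<Longrightarrow> \<mu> k = \<mu>' k"
    and at: "\<mu> m = i" "\<mu>' m = j" and tail: "\<And>k. m < k \<Longrightarrow> \<mu> k = j \<and> \<mu>' k = i"
  shows "ratio_limit w u \<mu> = ratio_limit w u \<mu>'"
proof -
  define v where "v = w @ map \<mu> [0..<m]"
  have v: "w @ map \<mu> [0..<Suc m] = v @ [i]" "w @ map \<mu>' [0..<Suc m] = v @ [j]"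
    using pre at by (simp_all add: v_def)
  have opp: "(flux S j (harm (v @ [i]) x))\<^sup>2 = (flux S i (harm (v @ [j]) x))\<^sup>2" for x
    by (simp add: flux_extend_other[OF finite_S i ij] flux_extend_other[OF finite_S j ij[symmetric]]
        power_divide power2_commute)
  have "ratio_limit w u \<mu> = (flux S j (harm (v @ [i]) u))\<^sup>2 / (\<Sum>k\<in>S. (flux S j (harm (v @ [i]) (unit k)))\<^sup>2)"
    using ratio_limit_tail[OF w \<mu> j, of "Suc m"] tail unfolding v by auto
  moreover have "ratio_limit w u \<mu>' = (flux S i (harm (v @ [j]) u))\<^sup>2 / (\<Sum>k\<in>S. (flux S i (harm (v @ [j]) (unit k)))\<^sup>2)"
    using ratio_limit_tail[OF w \<mu>' i, of "Suc m"] tail unfolding v by auto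
  ultimately show ?thesis unfolding opp by simp
qed

text \<open>
  Chosen such that \<open>(1/2) powr gam = tau\<close>.
\<close>

definition gam :: real where "gam = log 2 (1 / tau)"

lemma gam_pos: "gam > 0" using tau by (simp add: gam_def)

lemma half_power_gam: "((1/2) ^ k) powr gam = tau ^ k"
proof -
  have "(1/2 :: real) powr gam = tau"
    using tau unfolding gam_def by (simp add: powr_divide)
  moreover have "((1/2 :: real) ^ k) powr gam = ((1/2) powr gam) ^ k"
    by (simp add: powr_power powr_realpow[symmetric] powr_powr mult.commute)
  ultimately show ?thesis by simp
qed

text \<open>
  If the binary digits of \<open>\<omega>\<close> are dominated by those of \<open>\<mu>\<close>, the first difference, at place \<open>k\<close>, is not
  compensated by later digits: the weights differ by at least \<open>2 ^ (- (k + 1))\<close>. The codes share \<open>k\<close>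
  letters, so the limits differ by at most a constant times \<open>tau ^ k\<close>.
\<close>

lemma ratio_limit_le_of_dominated:
  assumes w: "set w \<subseteq> S"
  shows "\<exists>C\<ge>0. \<forall>\<omega>\<in>edge_codes. \<forall>\<mu>\<in>edge_codes. (\<forall>l. \<omega> l = j \<longrightarrow> \<mu> l = j) \<longrightarrow>
       \<bar>ratio_limit w u \<omega> - ratio_limit w u \<mu>\<bar> \<le> C * (weight j \<mu> - weight j \<omega>) powr gam"
proof -
  obtain C where C: "C \<ge> 0" "\<forall>\<omega>\<in>edge_codes. \<forall>m.
      \<bar>ratio_limit w u \<omega> - energy_ratio u (w @ map \<omega> [0..<m])\<bar> \<le> C * tau ^ m"
    using ratio_converges[OF w, of u] by blast
  show ?thesis
  proof (intro exI[of _ "2 * C / tau"] conjI ballI impI)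
    show "2 * C / tau \<ge> 0" using C(1) tau by simp
    fix \<omega> \<mu> assume \<omega>: "\<omega> \<in> edge_codes" and \<mu>: "\<mu> \<in> edge_codes" and dom: "\<forall>l. \<omega> l = j \<longrightarrow> \<mu> l = j"
    show "\<bar>ratio_limit w u \<omega> - ratio_limit w u \<mu>\<bar> \<le> 2 * C / tau * (weight j \<mu> - weight j \<omega>) powr gam"
    proof (cases "\<omega> = \<mu>")
      case False
      obtain k where k: "\<omega> k \<noteq> \<mu> k" and less: "\<And>l. l < k \<Longrightarrow> \<omega> l = \<mu> l"
        using first_difference[OF False] by blast
      have k_val: "\<omega> k = i" "\<mu> k = j"
        using k dom[rule_format, of k] edge_code_letter[OF \<omega>, of k] edge_code_letter[OF \<mu>, of k] by auto
      let ?f = "\<lambda>l. (1/2::real) ^ Suc l * of_bool (\<mu> l = j) - (1/2) ^ Suc l * of_bool (\<omega> l = j)"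
      have single: "(\<lambda>l. if l = k then ?f l else 0) sums ?f k" by (rule sums_single)
      have all: "?f sums (weight j \<mu> - weight j \<omega>)" by (intro sums_diff weight_sums)
      have "(if l = k then ?f l else 0) \<le> ?f l" for l
        using dom[rule_format, of l] by (auto simp: of_bool_def)
      then have "?f k \<le> weight j \<mu> - weight j \<omega>" by (rule sums_le[OF _ single all])
      then have gap: "(1/2) ^ Suc k \<le> weight j \<mu> - weight j \<omega>" using k_val ij by simp
      have pre: "map \<mu> [0..<k] = map \<omega> [0..<k]" using less by simp
      have "\<bar>ratio_limit w u \<omega> - ratio_limit w u \<mu>\<bar> \<le> 2 * (C * tau ^ k)"
        using C(2)[rule_format, OF \<omega>, of k] C(2)[rule_format, OF \<mu>, of k, unfolded pre]
        by linarith
      also have "\<dots> = 2 * C / tau * tau ^ Suc k" using tau by simp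
      also have "\<dots> = 2 * C / tau * ((1/2) ^ Suc k) powr gam" by (simp only: half_power_gam)
      also have "\<dots> \<le> 2 * C / tau * (weight j \<mu> - weight j \<omega>) powr gam"
        using C(1) tau gap gam_pos by (intro mult_left_mono powr_mono2) auto
      finally show ?thesis .
    qed simp
  qed
qed

lemma weight_common_prefix:
  assumes "\<And>l. l < m \<Longrightarrow> \<omega> l = \<eta> l"
  shows "weight k \<omega> - weight k \<eta>
    = (1/2) ^ m * (weight k (\<lambda>l. \<omega> (l + m)) - weight k (\<lambda>l. \<eta> (l + m)))"
  using assms
proof (induction m arbitrary: \<omega> \<eta>)
  case (Suc m)
  have "weight k (\<lambda>l. \<omega> (Suc l)) - weight k (\<lambda>l. \<eta> (Suc l))
      = (1/2) ^ m * (weight k (\<lambda>l. \<omega> (Suc (l + m))) - weight k (\<lambda>l. \<eta> (Suc (l + m))))"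
    by (rule Suc.IH) (simp add: Suc.prems)
  then show ?case
    using weight_step[of k \<omega>] weight_step[of k \<eta>] Suc.prems[of 0] by simp
qed simp

lemma weight_const: "weight k (\<lambda>_. l) = of_bool (l = k)"
  using weight_step[of k "\<lambda>_. l"] by simp

text \<open>
  Codes of nearby points need not share letters, so the comparison passes through the dyadic point
  that separates them. At the first difference \<open>m\<close>, this point has the codes \<open>v i j j j \<dots>\<close> and
  \<open>v j i i i \<dots>\<close>, which have the same limit; the first dominates \<open>\<omega>\<close> and the second is dominated
  by \<open>\<eta>\<close>, so \<open>ratio_limit_le_of_dominated\<close> applies on both sides.
\<close>

lemma ratio_limit_holder:
  assumes w: "set w \<subseteq> S"
  shows "\<exists>C\<ge>0. \<forall>\<omega>\<in>edge_codes. \<forall>\<eta>\<in>edge_codes.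
       \<bar>ratio_limit w u \<omega> - ratio_limit w u \<eta>\<bar> \<le> C * \<bar>weight j \<omega> - weight j \<eta>\<bar> powr gam"
proof -
  obtain C where C: "C \<ge> 0" "\<forall>\<omega>\<in>edge_codes. \<forall>\<mu>\<in>edge_codes. (\<forall>l. \<omega> l = j \<longrightarrow> \<mu> l = j) \<longrightarrow>
       \<bar>ratio_limit w u \<omega> - ratio_limit w u \<mu>\<bar> \<le> C * (weight j \<mu> - weight j \<omega>) powr gam"
    using ratio_limit_le_of_dominated[OF w, of u] by blast
  have weight_mono: "weight j \<omega> \<le> weight j \<mu>" if "\<And>l. \<omega> l = j \<Longrightarrow> \<mu> l = j" for \<omega> \<mu>
    by (rule sums_le[OF _ weight_sums weight_sums]) (use that in \<open>auto simp: of_bool_def\<close>)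
  have ordered: "\<bar>ratio_limit w u \<omega> - ratio_limit w u \<eta>\<bar> \<le> 2 * C * \<bar>weight j \<omega> - weight j \<eta>\<bar> powr gam"
    if \<omega>: "\<omega> \<in> edge_codes" and \<eta>: "\<eta> \<in> edge_codes" and less: "\<And>l. l < m \<Longrightarrow> \<omega> l = \<eta> l"
      and at: "\<omega> m = i" "\<eta> m = j" for \<omega> \<eta> m
  proof -
    define \<mu> where "\<mu> l = (if l < m then \<omega> l else if l = m then i else j)" for l
    define \<mu>' where "\<mu>' l = (if l < m then \<omega> l else if l = m then j else i)" for l
    have mem: "\<mu> \<in> edge_codes" "\<mu>' \<in> edge_codes"
      using edge_code_letter[OF \<omega>] by (auto simp: \<mu>_def \<mu>'_def)
    have dom: "\<omega> l = j \<Longrightarrow> \<mu> l = j" "\<mu>' l = j \<Longrightarrow> \<eta> l = j" for l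
      using at ij less[of l] by (cases "l < m"; cases "l = m"; simp add: \<mu>_def \<mu>'_def)+
    have same: "ratio_limit w u \<mu> = ratio_limit w u \<mu>'"
      by (rule ratio_limit_junction[OF w mem, of m]) (auto simp: \<mu>_def \<mu>'_def)
    have "weight j (\<lambda>l. \<mu> (l + m)) = weight j (\<lambda>l. \<mu>' (l + m))"
      using weight_step[of j "\<lambda>l. \<mu> (l + m)"] weight_step[of j "\<lambda>l. \<mu>' (l + m)"] ij
      by (simp add: \<mu>_def \<mu>'_def weight_const)
    then have same_weight: "weight j \<mu> = weight j \<mu>'"
      using weight_common_prefix[of m \<mu> \<mu>' j] by (simp add: \<mu>_def \<mu>'_def)
    have "weight j \<omega> \<le> weight j \<mu>" by (rule weight_mono) (rule dom(1))
    moreover have "weight j \<mu>' \<le> weight j \<eta>" by (rule weight_mono) (rule dom(2))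
    ultimately have le: "weight j \<omega> \<le> weight j \<mu>" "weight j \<mu> \<le> weight j \<eta>"
      using same_weight by simp_all
    have "\<bar>ratio_limit w u \<omega> - ratio_limit w u \<eta>\<bar>
        \<le> C * (weight j \<mu> - weight j \<omega>) powr gam + C * (weight j \<eta> - weight j \<mu>) powr gam"
      using C(2)[rule_format, OF \<omega> mem(1) dom(1)] C(2)[rule_format, OF mem(2) \<eta> dom(2)] same same_weight by simp
    also have "\<dots> \<le> C * \<bar>weight j \<omega> - weight j \<eta>\<bar> powr gam + C * \<bar>weight j \<omega> - weight j \<eta>\<bar> powr gam"
      using C(1) le gam_pos by (intro add_mono mult_left_mono powr_mono2) auto
    finally show ?thesis by simp
  qed
  show ?thesis
  proof (intro exI[of _ "2 * C"] conjI ballI)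
    show "2 * C \<ge> 0" using C(1) by simp
    fix \<omega> \<eta> assume \<omega>: "\<omega> \<in> edge_codes" and \<eta>: "\<eta> \<in> edge_codes"
    show "\<bar>ratio_limit w u \<omega> - ratio_limit w u \<eta>\<bar> \<le> 2 * C * \<bar>weight j \<omega> - weight j \<eta>\<bar> powr gam"
    proof (cases "\<omega> = \<eta>")
      case False
      obtain m where m: "\<omega> m \<noteq> \<eta> m" and less: "\<And>l. l < m \<Longrightarrow> \<omega> l = \<eta> l"
        using first_difference[OF False] by blast
      consider "\<omega> m = i" "\<eta> m = j" | "\<eta> m = i" "\<omega> m = j"
        using m edge_code_letter[OF \<omega>, of m] edge_code_letter[OF \<eta>, of m] by auto
      then show ?thesis
      proof cases
        case 1
        then show ?thesis using ordered[OF \<omega> \<eta> less] by blast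
      next
        case 2
        have "\<bar>ratio_limit w u \<eta> - ratio_limit w u \<omega>\<bar> \<le> 2 * C * \<bar>weight j \<eta> - weight j \<omega>\<bar> powr gam"
          using ordered[OF \<eta> \<omega> _ 2] less by simp
        then show ?thesis by (simp add: abs_minus_commute)
      qed
    qed simp
  qed
qed

lemma edge_code_point:
  assumes "\<omega> \<in> edge_codes"
  shows "code_point \<omega> = p i + weight j \<omega> *\<^sub>R (p j - p i)"
proof -
  have "(\<lambda>m. (1/2) ^ Suc m *\<^sub>R p i + ((1/2) ^ Suc m * of_bool (\<omega> m = j)) *\<^sub>R (p j - p i))
      sums (1 *\<^sub>R p i + weight j \<omega> *\<^sub>R (p j - p i))"
    by (intro sums_add sums_scaleR_left power_half_series weight_sums)
  moreover have "(1/2) ^ Suc m *\<^sub>R p i + ((1/2) ^ Suc m * of_bool (\<omega> m = j)) *\<^sub>R (p j - p i)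
      = (1/2) ^ Suc m *\<^sub>R p (\<omega> m)" for m
    using edge_code_letter[OF assms, of m] ij by (auto simp: scaleR_diff_right)
  ultimately show ?thesis
    using code_point_sums[OF edge_codes_subset[OF assms]] by (simp add: sums_unique2)
qed

lemma binary_expansion:
  assumes "0 \<le> t" "t \<le> 1"
  obtains \<omega> where "\<omega> \<in> edge_codes" "weight j \<omega> = t"
proof -
  \<comment> \<open>The doubling map produces the binary digits.\<close>
  define r where "r t = (if t \<ge> 1/2 then 2 * t - 1 else 2 * t)" for t :: real
  define e where "e t m = (if (r ^^ m) t \<ge> 1/2 then j else i)" for t :: real and m
  have e_Suc: "(\<lambda>m. e t (Suc m)) = e (r t)" for t
    by (simp add: e_def fun_eq_iff funpow_swap1)
  have "\<bar>weight j (e t) - t\<bar> \<le> (1/2) ^ m" if "0 \<le> t" "t \<le> 1" for t m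
    using that
  proof (induction m arbitrary: t)
    case 0
    then show ?case using weight_nonneg[of j "e t"] weight_le_1[of j "e t"] by simp
  next
    case (Suc m)
    have near: "\<bar>weight j (e (r t)) - r t\<bar> \<le> (1/2) ^ m"
      using Suc.prems by (intro Suc.IH) (auto simp: r_def)
    have half: "weight j (e t) - t = (weight j (e (r t)) - r t) / 2"
      using weight_step[of j "e t"] ij unfolding e_Suc by (simp add: e_def r_def field_simps)
    show ?case using near unfolding half by simp
  qed
  moreover have "(\<lambda>m. (1/2::real) ^ m) \<longlonglongrightarrow> 0" by (rule LIMSEQ_realpow_zero) auto
  ultimately have "\<bar>weight j (e t) - t\<bar> \<le> 0" using assms by (intro LIMSEQ_le_const) auto
  moreover have "e t \<in> edge_codes" by (auto simp: e_def)
  ultimately show thesis using that by auto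
qed

lemma edge_point_coded:
  assumes w: "set w \<subseteq> S" and "x \<in> psi_word p w ` closed_segment (p i) (p j)"
  obtains \<omega> where "\<omega> \<in> edge_codes" "coding p w \<omega> = x"
proof -
  obtain y where y: "y \<in> closed_segment (p i) (p j)" "x = psi_word p w y" using assms(2) by blast
  obtain t where t: "0 \<le> t" "t \<le> 1" "y = (1 - t) *\<^sub>R p i + t *\<^sub>R p j"
    using y(1) by (auto simp: closed_segment_def)
  obtain \<omega> where \<omega>: "\<omega> \<in> edge_codes" "weight j \<omega> = t" using binary_expansion[OF t(1,2)] .
  have "coding p w \<omega> = psi_word p w (p i + t *\<^sub>R (p j - p i))"
    using coding_eq[OF w edge_codes_subset[OF \<omega>(1)]] edge_code_point[OF \<omega>(1)] \<omega>(2) by simp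
  also have "p i + t *\<^sub>R (p j - p i) = y" unfolding t(3) by (simp add: algebra_simps)
  finally show thesis using that \<omega>(1) y(2) by blast
qed

lemma vertices_distinct: "p i \<noteq> p j"
  using simplex i j ij by (auto simp: simplex_vertices_def S_eq dest: inj_onD)

lemma dist_coding:
  assumes "set w \<subseteq> S" "\<omega> \<in> edge_codes" "\<eta> \<in> edge_codes"
  shows "dist (coding p w \<omega>) (coding p w \<eta>)
    = (1/2) ^ length w * dist (p i) (p j) * \<bar>weight j \<omega> - weight j \<eta>\<bar>"
proof -
  have "dist (p i + weight j \<omega> *\<^sub>R (p j - p i)) (p i + weight j \<eta> *\<^sub>R (p j - p i))
      = \<bar>weight j \<omega> - weight j \<eta>\<bar> * dist (p i) (p j)"
    by (simp add: dist_norm norm_minus_commute flip: scaleR_diff_left)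
  then show ?thesis
    using assms by (simp add: coding_eq edge_codes_subset dist_psi_word edge_code_point)
qed

lemma density_limit_eq:
  assumes "h \<in> harmonic p" "set w \<subseteq> S" "\<omega> \<in> edge_codes"
  shows "density_ratio p h w \<omega> = (\<lambda>m. energy_ratio (\<lambda>k. h (p k)) (w @ map \<omega> [0..<m]))"
    and "density_limit p h w \<omega> = ratio_limit w (\<lambda>k. h (p k)) \<omega>"
proof -
  show *: "density_ratio p h w \<omega> = (\<lambda>m. energy_ratio (\<lambda>k. h (p k)) (w @ map \<omega> [0..<m]))"
    using density_ratio_eq[OF assms(1,2) edge_codes_subset[OF assms(3)]] by (simp add: fun_eq_iff)
  show "density_limit p h w \<omega> = ratio_limit w (\<lambda>k. h (p k)) \<omega>"
    unfolding density_limit_def ratio_limit_def * ..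
qed

end

text \<open>
  On the edge, distances of points are proportional to differences of the weights of their codes.
  Well-definedness is the case of distance \<open>0\<close> of the Hoelder estimate.
\<close>

theorem theorem2p2:
  fixes p :: "nat \<Rightarrow> 'a::euclidean_space"
    and w :: "nat list" and i j :: nat and h :: "'a \<Rightarrow> real"
  assumes "DIM('a) \<ge> 2"
    and "simplex_vertices p"
    and "set w \<subseteq> letters TYPE('a)"
    and "i \<in> letters TYPE('a)" and "j \<in> letters TYPE('a)" and "i \<noteq> j"
    and "h \<in> harmonic p"
  shows "(\<forall>\<omega>\<in>UNIV \<rightarrow> {i, j}. convergent (density_ratio p h w \<omega>)) \<and>
    (\<forall>\<omega>\<in>UNIV \<rightarrow> {i, j}. \<forall>\<omega>'\<in>UNIV \<rightarrow> {i, j}.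
       coding p w \<omega> = coding p w \<omega>' \<longrightarrow> density_limit p h w \<omega> = density_limit p h w \<omega>') \<and>
    holder_on
      (log 2 ((sqrt (4 * real DIM('a) + 5) + 1) / (sqrt (4 * real DIM('a) + 5) - 1)))
      (psi_word p w ` closed_segment (p i) (p j))
      (edge_density p h w i j)"
proof -
  interpret gasket_edge p "letters TYPE('a)" i j
    using assms by unfold_locales auto
  let ?u = "\<lambda>k. h (p k)" and ?\<gamma> = "log 2 ((sqrt (4 * real DIM('a) + 5) + 1) / (sqrt (4 * real DIM('a) + 5) - 1))"
  have gam: "?\<gamma> = gam"
  proof -
    have "4 * real (card (letters TYPE('a))) + 1 = 4 * real DIM('a) + 5" by (simp add: card_S)
    then show ?thesis by (simp only: gam_def tau_def divide_divide_eq_right mult_1)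
  qed
  obtain C where C: "C \<ge> 0" "\<forall>\<omega>\<in>edge_codes. \<forall>\<eta>\<in>edge_codes.
      \<bar>ratio_limit w ?u \<omega> - ratio_limit w ?u \<eta>\<bar> \<le> C * \<bar>weight j \<omega> - weight j \<eta>\<bar> powr gam"
    using ratio_limit_holder[OF assms(3), of ?u] by blast
  let ?r = "(1/2) ^ length w * dist (p i) (p j)"
  have r: "?r > 0" using vertices_distinct by simp
  have holder: "\<bar>density_limit p h w \<omega> - density_limit p h w \<eta>\<bar>
      \<le> C / ?r powr gam * dist (coding p w \<omega>) (coding p w \<eta>) powr gam"
    if "\<omega> \<in> edge_codes" "\<eta> \<in> edge_codes" for \<omega> \<eta>
  proof -
    have "dist (coding p w \<omega>) (coding p w \<eta>) powr gam = ?r powr gam * \<bar>weight j \<omega> - weight j \<eta>\<bar> powr gam"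
      unfolding dist_coding[OF assms(3) that] by (rule powr_mult)
    then show ?thesis
      using C(2)[rule_format, OF that] vertices_distinct that assms by (simp add: density_limit_eq)
  qed
  have well_defined: "density_limit p h w \<omega> = density_limit p h w \<eta>"
    if "\<omega> \<in> edge_codes" "\<eta> \<in> edge_codes" "coding p w \<omega> = coding p w \<eta>" for \<omega> \<eta>
    using holder[OF that(1,2)] that(3) by simp
  have density: "edge_density p h w i j (coding p w \<omega>) = density_limit p h w \<omega>" if "\<omega> \<in> edge_codes" for \<omega>
    unfolding edge_density_def using that well_defined by (intro the_equality) blast+
  have "holder_on gam (psi_word p w ` closed_segment (p i) (p j)) (edge_density p h w i j)"
    unfolding holder_on_def
  proof (intro exI ballI)
    fix x y
    assume "x \<in> psi_word p w ` closed_segment (p i) (p j)" "y \<in> psi_word p w ` closed_segment (p i) (p j)"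
    then obtain \<omega> \<eta> where xy: "\<omega> \<in> edge_codes" "coding p w \<omega> = x" "\<eta> \<in> edge_codes" "coding p w \<eta> = y"
      using edge_point_coded[OF assms(3)] by metis
    show "\<bar>edge_density p h w i j x - edge_density p h w i j y\<bar> \<le> C / ?r powr gam * dist x y powr gam"
      using holder[OF xy(1,3)] unfolding density[OF xy(1), unfolded xy(2)] density[OF xy(3), unfolded xy(4)] xy .
  qed
  moreover have "convergent (density_ratio p h w \<omega>)" if "\<omega> \<in> edge_codes" for \<omega>
    unfolding density_limit_eq(1)[OF assms(7,3) that]
    by (rule convergentI[OF ratio_limit_tendsto[OF assms(3) that]])
  ultimately show ?thesis using well_defined unfolding gam by blast
qed

end
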